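(* Let $\mathbf{k}$ be an algebraically closed field of characteristic $\neq 2,3$. The space $P_3(\mathbf{k}^{\infty})$ is noetherian with respect to the action of $\mathrm{GL}_{\infty}$; that is, every $\mathrm{GL}_{\infty}$-stable Zariski closed subset of $P_3(\mathbf{k}^{\infty})$ can be defined by finitely many $\mathrm{GL}_{\infty}$-orbits of equations.
   Context: $\mathbf{k}^{\infty}=\bigcup_{n\ge 1}\mathbf{k}^n$ is the vector space with a countably infinite basis, and $\mathrm{GL}_{\infty}=\mathrm{GL}(\mathbf{k}^{\infty})$. For a $\mathbf{k}$-vector space $V$, $P_d(V)=\mathrm{Sym}^d(V)^*$ is the space of (homogeneous) degree $d$ polynomials on $V$; $P_3(\mathbf{k}^{\infty})$ is the inverse limit of the spaces $P_3(\mathbf{k}^n)$ of cubic forms in $n$ variables under restriction, so its elements are certain infinite series. The space $P_d(V)$ carries the Zariski topology: precisely, $P_d(V)$ is identified with the spectrum of the ring $\mathrm{Sym}(\mathrm{Sym}^d(V))$, whose elements are the polynomial functions in the coefficients of the form. An "equation" is an element of this ring, and $\mathrm{GL}(V)$ acts naturally on $P_d(V)$ and on this ring. *)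

theory Defs
  imports
    "HOL-Library.Poly_Mapping"
    "HOL-Algebra.Algebraic_Closure_Type"
begin

text \<open>The free vector space on a basis indexed by \<open>'b\<close> is the type \<open>'b \<Rightarrow>\<^sub>0 'k\<close> of finitely
  supported functions, with basis vectors \<open>Poly_Mapping.single i 1\<close>. In particular
  \<open>nat \<Rightarrow>\<^sub>0 'k\<close> is $\mathbf{k}^\infty$.\<close>

definition smult_vec :: "'k::field \<Rightarrow> ('b \<Rightarrow>\<^sub>0 'k) \<Rightarrow> ('b \<Rightarrow>\<^sub>0 'k)"
  where "smult_vec c v = Poly_Mapping.map ((*) c) v"

lemma lookup_smult_vec [simp]:
  "Poly_Mapping.lookup (smult_vec c v) i = c * Poly_Mapping.lookup v i"
  by (simp add: smult_vec_def Poly_Mapping.map.rep_eq when_def)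

lemma vector_space_smult_vec: "vector_space smult_vec"
  by unfold_locales
     (simp_all add: poly_mapping_eq_iff fun_eq_iff plus_poly_mapping.rep_eq algebra_simps)

definition GL_infty :: "((nat \<Rightarrow>\<^sub>0 'k::field) \<Rightarrow> (nat \<Rightarrow>\<^sub>0 'k)) set"
  where "GL_infty = {g. Vector_Spaces.linear smult_vec smult_vec g \<and> bij g}"

text \<open>The symmetric algebra of the free vector space on \<open>'b\<close> is the polynomial ring with variables
  indexed by \<open>'b\<close>; exponent vectors are elements of \<open>'b \<Rightarrow>\<^sub>0 nat\<close>, and multiplication is
  the convolution product on \<open>poly_mapping\<close>.\<close>

type_synonym ('b, 'k) sym = "('b \<Rightarrow>\<^sub>0 nat) \<Rightarrow>\<^sub>0 'k"

text \<open>The inclusion of a vector space as the degree one part of its symmetric algebra.\<close>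

definition sym_incl :: "('b \<Rightarrow>\<^sub>0 'k::field) \<Rightarrow> ('b, 'k) sym"
  where "sym_incl v = (\<Sum>i\<in>Poly_Mapping.keys v.
    Poly_Mapping.single (Poly_Mapping.single i 1) (Poly_Mapping.lookup v i))"

text \<open>The algebra homomorphism $\mathrm{Sym}(\varphi)$ induced by a linear map $\varphi$: substitute
  $\varphi(e_i)$ for the variable $e_i$.\<close>

definition sym_map ::
  "(('b \<Rightarrow>\<^sub>0 'k::field) \<Rightarrow> ('c \<Rightarrow>\<^sub>0 'k)) \<Rightarrow> ('b, 'k) sym \<Rightarrow> ('c, 'k) sym"
  where "sym_map \<phi> p = (\<Sum>m\<in>Poly_Mapping.keys p.
    Poly_Mapping.single 0 (Poly_Mapping.lookup p m) *
    (\<Prod>i\<in>Poly_Mapping.keys m.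
      sym_incl (\<phi> (Poly_Mapping.single i 1)) ^ Poly_Mapping.lookup m i))"

text \<open>$\mathrm{Sym}^3(\mathbf{k}^\infty)$ is the free vector space on the monomials of degree 3 in the
  basis vectors of $\mathbf{k}^\infty$.\<close>

typedef cubic_monom =
  "{m :: nat \<Rightarrow>\<^sub>0 nat. (\<Sum>i\<in>Poly_Mapping.keys m. Poly_Mapping.lookup m i) = 3}"
  by (rule exI[of _ "Poly_Mapping.single 1 3"]) simp

definition sym3_incl :: "(cubic_monom \<Rightarrow>\<^sub>0 'k::field) \<Rightarrow> (nat, 'k) sym"
  where "sym3_incl v = (\<Sum>m\<in>Poly_Mapping.keys v.
    Poly_Mapping.single (Rep_cubic_monom m) (Poly_Mapping.lookup v m))"

definition sym3_proj :: "(nat, 'k::field) sym \<Rightarrow> (cubic_monom \<Rightarrow>\<^sub>0 'k)"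
  where "sym3_proj p = Poly_Mapping.map_key Rep_cubic_monom p"

text \<open>The linear map $\mathrm{Sym}^3(g)$ on $\mathrm{Sym}^3(\mathbf{k}^\infty)$. The projection loses
  nothing, since $\mathrm{Sym}(g)$ preserves degrees.\<close>

definition sym3_map ::
  "((nat \<Rightarrow>\<^sub>0 'k::field) \<Rightarrow> (nat \<Rightarrow>\<^sub>0 'k)) \<Rightarrow> (cubic_monom \<Rightarrow>\<^sub>0 'k) \<Rightarrow> (cubic_monom \<Rightarrow>\<^sub>0 'k)"
  where "sym3_map g v = sym3_proj (sym_map g (sym3_incl v))"

text \<open>The ring $\mathrm{Sym}(\mathrm{Sym}^3(\mathbf{k}^\infty))$ of equations. A cubic form
  $\lambda \in P_3(\mathbf{k}^\infty) = \mathrm{Sym}^3(\mathbf{k}^\infty)^*$ is an arbitrary family of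
  values $\lambda(m)$, one for each cubic monomial $m$, and the variable of the ring indexed by
  $m$ is the coordinate function $\lambda \mapsto \lambda(m)$.\<close>

type_synonym 'k equation = "(cubic_monom, 'k) sym"

definition act ::
  "((nat \<Rightarrow>\<^sub>0 'k::field) \<Rightarrow> (nat \<Rightarrow>\<^sub>0 'k)) \<Rightarrow> 'k equation \<Rightarrow> 'k equation"
  where "act g = sym_map (sym3_map g)"

definition GL_orbit :: "'k::field equation \<Rightarrow> 'k equation set"
  where "GL_orbit f = {act g f | g. g \<in> GL_infty}"

text \<open>$P_3(\mathbf{k}^\infty)$ as the spectrum of this ring. A form $\lambda$ corresponds to the
  prime ideal of all equations vanishing at $\lambda$.\<close>

definition P3 :: "'k::field equation set set"
  where "P3 = {\<pp>. primeideal \<pp> (ring_of_type_algebra :: 'k equation ring)}"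

definition zero_locus :: "'k::field equation set \<Rightarrow> 'k equation set set"
  where "zero_locus S = {\<pp> \<in> P3. S \<subseteq> \<pp>}"

definition Zariski_closed :: "'k::field equation set set \<Rightarrow> bool"
  where "Zariski_closed Z \<longleftrightarrow> (\<exists>S. Z = zero_locus S)"

text \<open>The action of \<open>g\<close> on the spectrum takes a prime ideal to its image under \<open>act g\<close>:
  if \<open>f\<close> vanishes at a point \<open>x\<close>, then \<open>g f\<close> vanishes at \<open>g x\<close>.\<close>

definition GL_stable :: "'k::field equation set set \<Rightarrow> bool"
  where "GL_stable Z \<longleftrightarrow> (\<forall>g\<in>GL_infty. \<forall>\<pp>\<in>Z. act g ` \<pp> \<in> Z)"

end

theory Submission
  imports Defs
begin

text \<open>A closed set is the zero locus of the intersection of its points, a stable radical ideal; so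
  the claim is that every stable radical ideal arises from finitely many equations by ring
  operations, the group action and extraction of roots. The proof is Draisma's induction over
  polynomial functors, carried out inside the single ring of equations.

  Fix \<open>n\<close> and call the part of a cubic monomial that involves the first \<open>n\<close> basis vectors its
  front. The coordinates with a given front \<open>l\<close> are the coordinates on a copy of
  $\mathrm{Sym}^{3-\deg l}$ of the span of the remaining basis vectors. A finite set \<open>L\<close> of fronts
  therefore describes a finite sum of symmetric powers, whose coordinate ring is
  \<open>polys_in (vars_with_front n L)\<close>, and the group acting on it is \<open>GL_block n\<close>. The whole ring is
  the case \<open>n = 0\<close>, \<open>L = {0}\<close>. Raising \<open>n\<close> to \<open>n'\<close> turns one copy of $\mathrm{Sym}^d$ into a copy of
  $\mathrm{Sym}^d$ and finitely many lower symmetric powers. Hence raising \<open>n\<close> and then dropping one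
  summand of maximal degree decreases the multiset of degrees, along which
  \<open>topologically_noetherian_vars_with_front\<close> proceeds by induction. If all degrees are zero, only
  finitely many variables are left (\<open>topologically_noetherian_finite\<close>).

  For the induction step, let \<open>I\<close> be a stable radical ideal, \<open>l0\<close> a front whose summand has maximal
  degree \<open>d > 0\<close>, and \<open>R\<close> the set of variables with this front. If \<open>I\<close> contains all
  coefficients of its elements with respect to \<open>R\<close>, it is generated by its elements free of \<open>R\<close>, and
  the summand can be dropped. Otherwise take \<open>f \<in> I\<close> of least degree in \<open>R\<close> with coefficients
  outside \<open>I\<close>, and let \<open>q\<close> be the largest power of the characteristic (\<open>1\<close> in characteristic 0) such that the variables in \<open>R\<close>
  occur in \<open>f\<close> only through their \<open>q\<close>-th powers. By minimality some derivative \<open>h\<close> of \<open>f\<close> with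
  respect to these \<open>q\<close>-th powers is not in \<open>I\<close> (\<open>ex_derivative_not_in_ideal\<close>). Choose \<open>n'\<close> larger
  than all indices in \<open>f\<close>, and let \<open>B\<close> be the ring without the variables whose front at level \<open>n'\<close>
  is \<open>l0\<close>. Substituting $e_i \mapsto e_i + t\,a_i\,\ell$ in \<open>f\<close>, with $\ell$ in the span of the basis
  vectors from \<open>n'\<close> on, the coefficient of $t^{dq}$ is \<open>h\<close> times the \<open>q\<close>-th power of the linear form
  belonging to $l_0\,\ell^d$, up to \<open>B\<close> (\<open>tangent_equation\<close>). As powers $\ell^d$ span
  $\mathrm{Sym}^d$ in characteristic not 2 or 3 (\<open>polarization\<close>), \<open>h\<close> times the \<open>q\<close>-th power of each
  missing variable lies in \<open>B\<close> modulo the closure of \<open>f\<close>, and so does every \<open>q\<close>-th power times a power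
  of \<open>h\<close> (\<open>elimination\<close>). Away from the zeros of \<open>h\<close>, the ideal \<open>I\<close> is thus determined by \<open>f\<close> and
  \<open>I \<inter> B\<close>, and \<open>B\<close> has a smaller type. On the zeros of the orbit of \<open>h\<close>, \<open>I\<close> is replaced by a
  strictly larger ideal. By Zorn's lemma it suffices to treat an \<open>I\<close> all of whose proper enlargements
  are already known to be finitely cut out (\<open>topologically_noetherian_by_localization\<close>).\<close>

section \<open>Radical ideals stable under a group\<close>

text \<open>The least radical ideal of the ring \<open>A\<close> that contains \<open>F\<close> and is stable under \<open>G\<close>. It is
  generated by all these operations at once, not built as the radical of the ideal spanned by the
  orbits, so that its properties follow by rule induction without describing its elements.\<close>

inductive_set radical_closure :: "('a \<Rightarrow> 'a) set \<Rightarrow> 'a::comm_ring_1 set \<Rightarrow> 'a set \<Rightarrow> 'a set"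
  for G A F where
  gen: "x \<in> F \<Longrightarrow> x \<in> radical_closure G A F"
| zero: "0 \<in> radical_closure G A F"
| add: "x \<in> radical_closure G A F \<Longrightarrow> y \<in> radical_closure G A F \<Longrightarrow> x + y \<in> radical_closure G A F"
| mult: "a \<in> A \<Longrightarrow> x \<in> radical_closure G A F \<Longrightarrow> a * x \<in> radical_closure G A F"
| act: "g \<in> G \<Longrightarrow> x \<in> radical_closure G A F \<Longrightarrow> g x \<in> radical_closure G A F"
| root: "x \<in> A \<Longrightarrow> x ^ n \<in> radical_closure G A F \<Longrightarrow> x \<in> radical_closure G A F"

definition stable_radical_ideal :: "('a \<Rightarrow> 'a) set \<Rightarrow> 'a::comm_ring_1 set \<Rightarrow> 'a set \<Rightarrow> bool"
  where "stable_radical_ideal G A I \<longleftrightarrow> I \<subseteq> A \<and> radical_closure G A I \<subseteq> I"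

text \<open>Finiteness up to radicals: the zero locus of \<open>I\<close> is cut out by the orbits of finitely many elements.\<close>

definition finitely_cut :: "('a \<Rightarrow> 'a) set \<Rightarrow> 'a::comm_ring_1 set \<Rightarrow> 'a set \<Rightarrow> bool"
  where "finitely_cut G A I \<longleftrightarrow> (\<exists>F. finite F \<and> F \<subseteq> I \<and> I \<subseteq> radical_closure G A F)"

definition topologically_noetherian :: "('a \<Rightarrow> 'a) set \<Rightarrow> 'a::comm_ring_1 set \<Rightarrow> bool"
  where "topologically_noetherian G A \<longleftrightarrow> (\<forall>I. stable_radical_ideal G A I \<longrightarrow> finitely_cut G A I)"

lemma radical_closure_mono:
  assumes "G \<subseteq> G'" "A \<subseteq> A'" "F \<subseteq> radical_closure G' A' F'"
  shows "radical_closure G A F \<subseteq> radical_closure G' A' F'"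
proof
  fix x assume "x \<in> radical_closure G A F"
  then show "x \<in> radical_closure G' A' F'"
  proof induction
    case (act g x)
    then have "g \<in> G'" using assms(1) by auto
    then show ?case by (rule radical_closure.act) (rule act.IH)
  next
    case (root x n)
    then have "x \<in> A'" using assms(2) by auto
    then show ?case by (rule radical_closure.root) (rule root.IH)
  qed (use assms in \<open>auto intro: radical_closure.zero radical_closure.add radical_closure.mult\<close>)
qed

lemma radical_closure_gens: "F \<subseteq> radical_closure G A F"
  by (auto intro: radical_closure.gen)

lemma radical_closure_mono_gens: "F \<subseteq> F' \<Longrightarrow> radical_closure G A F \<subseteq> radical_closure G A F'"
  by (rule radical_closure_mono) (use radical_closure_gens[of F' G A] in auto)

lemma radical_closure_compact:
  assumes "x \<in> radical_closure G A F"
  shows "\<exists>F'. finite F' \<and> F' \<subseteq> F \<and> x \<in> radical_closure G A F'"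
  using assms
proof induction
  case (gen x)
  then show ?case by (intro exI[of _ "{x}"]) (auto intro: radical_closure.gen)
next
  case zero
  then show ?case by (intro exI[of _ "{}"]) (auto intro: radical_closure.zero)
next
  case (add x y)
  then obtain F1 F2 where
    "finite F1" "F1 \<subseteq> F" "x \<in> radical_closure G A F1" "finite F2" "F2 \<subseteq> F" "y \<in> radical_closure G A F2"
    by auto
  moreover have "F1 \<subseteq> radical_closure G A (F1 \<union> F2)" "F2 \<subseteq> radical_closure G A (F1 \<union> F2)"
    by (auto intro: radical_closure.gen)
  ultimately show ?case
    using radical_closure_mono[of G G A A F1 "F1 \<union> F2"] radical_closure_mono[of G G A A F2 "F1 \<union> F2"]
    by (intro exI[of _ "F1 \<union> F2"]) (auto intro!: radical_closure.add)
next
  case (act g x)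
  then obtain F' where F': "finite F'" "F' \<subseteq> F" "x \<in> radical_closure G A F'" by auto
  with radical_closure.act[OF act(1) F'(3)] show ?case by (intro exI[of _ F'] conjI)
qed (auto intro: radical_closure.mult radical_closure.root)

lemma radical_closure_compact_set:
  assumes "finite E" "E \<subseteq> radical_closure G A F"
  shows "\<exists>F'. finite F' \<and> F' \<subseteq> F \<and> E \<subseteq> radical_closure G A F'"
proof -
  have "\<forall>x\<in>E. \<exists>F'. finite F' \<and> F' \<subseteq> F \<and> x \<in> radical_closure G A F'"
    using assms radical_closure_compact by fast
  then obtain \<Phi> where \<Phi>: "\<And>x. x \<in> E \<Longrightarrow> finite (\<Phi> x) \<and> \<Phi> x \<subseteq> F \<and> x \<in> radical_closure G A (\<Phi> x)"
    by metis
  have "x \<in> radical_closure G A (\<Union>x\<in>E. \<Phi> x)" if "x \<in> E" for x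
    using \<Phi>[OF that] radical_closure_mono[of G G A A "\<Phi> x" "\<Union>x\<in>E. \<Phi> x"] that
    by (auto intro: radical_closure.gen)
  with \<Phi> assms(1) show ?thesis
    by (intro exI[of _ "\<Union>x\<in>E. \<Phi> x"]) auto
qed

lemma
  assumes "stable_radical_ideal G A I"
  shows stable_radical_ideal_subset: "I \<subseteq> A"
    and stable_radical_ideal_zero: "0 \<in> I"
    and stable_radical_ideal_add: "x \<in> I \<Longrightarrow> y \<in> I \<Longrightarrow> x + y \<in> I"
    and stable_radical_ideal_mult: "a \<in> A \<Longrightarrow> x \<in> I \<Longrightarrow> a * x \<in> I"
    and stable_radical_ideal_act: "g \<in> G \<Longrightarrow> x \<in> I \<Longrightarrow> g x \<in> I"
    and stable_radical_ideal_root: "z \<in> A \<Longrightarrow> z ^ n \<in> I \<Longrightarrow> z \<in> I"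
    and stable_radical_ideal_closure: "radical_closure G A I \<subseteq> I"
proof -
  have cl: "radical_closure G A I \<subseteq> I" and "I \<subseteq> A"
    using assms by (auto simp: stable_radical_ideal_def)
  have eq: "x \<in> radical_closure G A I \<longleftrightarrow> x \<in> I" for x
    using cl radical_closure.gen by blast
  show "I \<subseteq> A" "radical_closure G A I \<subseteq> I" by fact+
  show "0 \<in> I" "x \<in> I \<Longrightarrow> y \<in> I \<Longrightarrow> x + y \<in> I" "a \<in> A \<Longrightarrow> x \<in> I \<Longrightarrow> a * x \<in> I"
    "g \<in> G \<Longrightarrow> x \<in> I \<Longrightarrow> g x \<in> I" "z \<in> A \<Longrightarrow> z ^ n \<in> I \<Longrightarrow> z \<in> I"
    using radical_closure.intros[where F = I and G = G and A = A] unfolding eq by blast+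
qed

lemma stable_radical_idealI:
  assumes "I \<subseteq> A" "0 \<in> I" "\<And>x y. x \<in> I \<Longrightarrow> y \<in> I \<Longrightarrow> x + y \<in> I"
    "\<And>a x. a \<in> A \<Longrightarrow> x \<in> I \<Longrightarrow> a * x \<in> I" "\<And>g x. g \<in> G \<Longrightarrow> x \<in> I \<Longrightarrow> g x \<in> I"
    "\<And>x n. x \<in> A \<Longrightarrow> x ^ n \<in> I \<Longrightarrow> x \<in> I"
  shows "stable_radical_ideal G A I"
  unfolding stable_radical_ideal_def
proof (intro conjI subsetI)
  fix x assume "x \<in> radical_closure G A I"
  then show "x \<in> I" by induction (use assms in auto)
qed (use assms in auto)

lemma finitely_cut_mono:
  assumes "finitely_cut G A J" "G \<subseteq> G'" "A \<subseteq> A'" "J \<subseteq> I" "I \<subseteq> radical_closure G' A' J"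
  shows "finitely_cut G' A' I"
proof -
  obtain F where F: "finite F" "F \<subseteq> J" "J \<subseteq> radical_closure G A F"
    using assms(1) by (auto simp: finitely_cut_def)
  have "J \<subseteq> radical_closure G' A' F"
    using F(3) radical_closure_mono[of G G' A A' F F] assms(2,3) by (auto intro: radical_closure.gen)
  then have "I \<subseteq> radical_closure G' A' F"
    using assms(5) radical_closure_mono[of G' G' A' A' J F] by auto
  with F assms(4) show ?thesis by (auto simp: finitely_cut_def)
qed

text \<open>The set \<open>G\<close> consists of maps on the ambient ring type that act on the subring \<open>A\<close> by invertible
  multiplicative maps. Keeping \<open>A\<close> a subset lets all rings of the induction live in one type.\<close>

locale acted_ring =
  fixes G :: "('a::comm_ring_1 \<Rightarrow> 'a) set" and A :: "'a set"
  assumes zero_closed: "0 \<in> A"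
    and add_closed: "x \<in> A \<Longrightarrow> y \<in> A \<Longrightarrow> x + y \<in> A"
    and mult_closed: "x \<in> A \<Longrightarrow> y \<in> A \<Longrightarrow> x * y \<in> A"
    and act_closed: "g \<in> G \<Longrightarrow> x \<in> A \<Longrightarrow> g x \<in> A"
    and act_mult: "g \<in> G \<Longrightarrow> x \<in> A \<Longrightarrow> y \<in> A \<Longrightarrow> g (x * y) = g x * g y"
    and act_inverse: "g \<in> G \<Longrightarrow> \<exists>g'\<in>G. \<forall>x\<in>A. g (g' x) = x"
begin

lemma radical_closure_subset: "F \<subseteq> A \<Longrightarrow> radical_closure G A F \<subseteq> A"
proof
  fix x assume "F \<subseteq> A" and "x \<in> radical_closure G A F"
  from this(2,1) show "x \<in> A"
  proof induction
    case (act g x)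
    then show ?case by (simp add: act_closed)
  qed (auto simp: zero_closed add_closed mult_closed)
qed

lemma stable_radical_ideal_radical_closure:
  assumes "F \<subseteq> A" shows "stable_radical_ideal G A (radical_closure G A F)"
  using radical_closure_subset[OF assms] radical_closure_mono[of G G A A "radical_closure G A F" F]
  by (simp add: stable_radical_ideal_def)

text \<open>The set of \<open>y\<close> with \<open>I y \<subseteq> K\<close> is itself a stable radical ideal, because \<open>I\<close> and \<open>K\<close> are
  stable and \<open>K\<close> is radical. It contains the closure of \<open>h\<close> and \<open>F\<close> as soon as it contains \<open>h\<close>
  and \<open>F\<close>; geometrically, \<open>I\<close> need only be compared with \<open>K\<close> off the zeros of \<open>h\<close>.\<close>

lemma closure_by_localization:
  assumes I: "stable_radical_ideal G A I" and K: "stable_radical_ideal G A K"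
    and h: "h \<in> A" and F: "F \<subseteq> K" and local: "\<And>b. b \<in> I \<Longrightarrow> b * h \<in> K"
    and y: "y \<in> radical_closure G A (insert h F)"
  shows "\<forall>b\<in>I. b * y \<in> K"
  using y
proof induction
  case (gen y)
  show ?case
  proof
    fix b assume b: "b \<in> I"
    then have "b \<in> A" using stable_radical_ideal_subset[OF I] by blast
    then show "b * y \<in> K"
      using gen local[OF b] stable_radical_ideal_mult[OF K, of b y] F by blast
  qed
next
  case zero
  show ?case using stable_radical_ideal_zero[OF K] by simp
next
  case (add x y)
  then show ?case using stable_radical_ideal_add[OF K] by (auto simp: distrib_left)
next
  case (mult a x)
  then have "a * (b * x) \<in> K" if "b \<in> I" for b
    using that stable_radical_ideal_mult[OF K] by blast
  then show ?case by (simp add: ac_simps)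
next
  case (act g x)
  have xA: "x \<in> A"
    using act(2) radical_closure_subset[of "insert h F"] h F stable_radical_ideal_subset[OF K] by auto
  show ?case
  proof
    fix b assume b: "b \<in> I"
    obtain g' where g': "g' \<in> G" "\<forall>x\<in>A. g (g' x) = x" using act_inverse[OF act(1)] by blast
    have bA: "b \<in> A" using b stable_radical_ideal_subset[OF I] by auto
    \<comment> \<open>Stability of \<open>I\<close> moves \<open>g\<close> from \<open>x\<close> to \<open>b\<close>: \<open>b * g x = g (g' b * x)\<close>.\<close>
    have "g' b * x \<in> K" using act(3) stable_radical_ideal_act[OF I g'(1) b] by blast
    then have "g (g' b * x) \<in> K" by (rule stable_radical_ideal_act[OF K act(1)])
    then show "b * g x \<in> K"
      using act_mult[OF act(1) act_closed[OF g'(1) bA] xA] g'(2) bA by simp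
  qed
next
  case (root x n)
  show ?case
  proof
    fix b assume b: "b \<in> I"
    then have bA: "b \<in> A" using stable_radical_ideal_subset[OF I] by auto
    have bn: "b ^ n \<in> A" if "n > 0" for n
      using that
    proof (induction n rule: nat_induct_non_zero)
      case (Suc n)
      then show ?case using mult_closed[OF bA Suc.IH] by simp
    qed (simp add: bA)
    have bx: "b * x ^ n \<in> K" using root(3) b by blast
    show "b * x \<in> K"
    proof (cases n)
      case 0
      with bx have "x * b \<in> K" using stable_radical_ideal_mult[OF K root(1)] by simp
      then show ?thesis by (simp add: ac_simps)
    next
      case (Suc m)
      have "(b * x) ^ n \<in> K"
      proof (cases "m = 0")
        case False
        then have "b ^ m * (b * x ^ n) \<in> K" using stable_radical_ideal_mult[OF K bn bx] by simp
        then show ?thesis using Suc by (simp add: power_mult_distrib ac_simps)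
      qed (use bx Suc in simp)
      then show ?thesis by (rule stable_radical_ideal_root[OF K mult_closed[OF bA root(1)]])
    qed
  qed
qed

text \<open>Noetherian induction in the form needed here. Compactness of \<open>radical_closure\<close> makes the ideals that
  are not finitely cut out closed under unions of chains, so a maximal one \<open>I\<close> exists. For \<open>h \<notin> I\<close>
  the closure of \<open>I\<close> and \<open>h\<close> is finitely cut out, which controls \<open>I\<close> on the zeros of the orbit of \<open>h\<close>;
  the hypothesis controls \<open>I\<close> off these zeros. An \<open>x \<in> I\<close> then has \<open>x\<^sup>2\<close> in the closure of finitely
  many elements of \<open>I\<close>.\<close>

theorem topologically_noetherian_by_localization:
  assumes step: "\<And>I. stable_radical_ideal G A I \<Longrightarrow> finitely_cut G A I \<or>
    (\<exists>h\<in>A - I. \<exists>F. finite F \<and> F \<subseteq> I \<and> (\<forall>b\<in>I. b * h \<in> radical_closure G A F))"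
  shows "topologically_noetherian G A"
  unfolding topologically_noetherian_def
proof (intro allI impI, rule ccontr)
  define bad where "bad = {I. stable_radical_ideal G A I \<and> \<not> finitely_cut G A I}"
  fix I0 assume "stable_radical_ideal G A I0" "\<not> finitely_cut G A I0"
  then have ne: "bad \<noteq> {}" by (auto simp: bad_def)
  have "\<exists>M\<in>bad. \<forall>J\<in>bad. M \<subseteq> J \<longrightarrow> J = M"
  proof (rule subset_Zorn_nonempty[OF ne])
    fix \<C> assume \<C>: "\<C> \<noteq> {}" "subset.chain bad \<C>"
    then have ideal: "\<And>I. I \<in> \<C> \<Longrightarrow> stable_radical_ideal G A I"
      and nfc: "\<And>I. I \<in> \<C> \<Longrightarrow> \<not> finitely_cut G A I"
      by (auto simp: subset_chain_def bad_def)
    have dir: "\<exists>K\<in>\<C>. I \<subseteq> K \<and> J \<subseteq> K" if "I \<in> \<C>" "J \<in> \<C>" for I J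
      using \<C>(2) that unfolding subset_chain_def by (metis subset_refl)
    have "stable_radical_ideal G A (\<Union>\<C>)"
    proof (rule stable_radical_idealI)
      fix x y assume "x \<in> \<Union>\<C>" "y \<in> \<Union>\<C>"
      then obtain K where "K \<in> \<C>" "x \<in> K" "y \<in> K" using dir by blast
      then show "x + y \<in> \<Union>\<C>" using stable_radical_ideal_add[OF ideal] by blast
    next
      show "\<Union>\<C> \<subseteq> A" using stable_radical_ideal_subset[OF ideal] by blast
      show "0 \<in> \<Union>\<C>" using stable_radical_ideal_zero[OF ideal] \<C>(1) by blast
      show "a * x \<in> \<Union>\<C>" if "a \<in> A" "x \<in> \<Union>\<C>" for a x
        using stable_radical_ideal_mult[OF ideal] that by blast
      show "g x \<in> \<Union>\<C>" if "g \<in> G" "x \<in> \<Union>\<C>" for g x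
        using stable_radical_ideal_act[OF ideal] that by blast
      show "x \<in> \<Union>\<C>" if "x \<in> A" "x ^ n \<in> \<Union>\<C>" for x n
        using stable_radical_ideal_root[OF ideal] that by blast
    qed
    moreover have "\<not> finitely_cut G A (\<Union>\<C>)"
    proof
      assume "finitely_cut G A (\<Union>\<C>)"
      then obtain F where F: "finite F" "F \<subseteq> \<Union>\<C>" "\<Union>\<C> \<subseteq> radical_closure G A F"
        by (auto simp: finitely_cut_def)
      obtain K where "K \<in> \<C>" "F \<subseteq> K"
        by (rule finite_subset_Union_chain[OF F(1,2) \<C>])
      then have "K \<subseteq> radical_closure G A F" using F(3) by auto
      with F(1) \<open>F \<subseteq> K\<close> have "finitely_cut G A K" unfolding finitely_cut_def by (intro exI[of _ F] conjI)
      with nfc[OF \<open>K \<in> \<C>\<close>] show False by contradiction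
    qed
    ultimately show "\<Union>\<C> \<in> bad" by (simp add: bad_def)
  qed
  then obtain I where I: "stable_radical_ideal G A I" "\<not> finitely_cut G A I"
    and max: "\<And>J. stable_radical_ideal G A J \<Longrightarrow> I \<subset> J \<Longrightarrow> finitely_cut G A J"
    unfolding bad_def by blast
  obtain h F where h: "h \<in> A" "h \<notin> I" and F: "finite F" "F \<subseteq> I"
    and local: "\<And>b. b \<in> I \<Longrightarrow> b * h \<in> radical_closure G A F"
    using step[OF I(1)] I(2) by auto
  have IA: "I \<subseteq> A" using I(1) by (rule stable_radical_ideal_subset)
  let ?J = "radical_closure G A (insert h I)"
  have "stable_radical_ideal G A ?J"
    using h(1) IA by (intro stable_radical_ideal_radical_closure) auto
  moreover have "h \<in> ?J" "I \<subseteq> ?J" by (auto intro: radical_closure.gen)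
  ultimately have "finitely_cut G A ?J" using h(2) max[of ?J] by blast
  then obtain E where E: "finite E" "E \<subseteq> ?J" "?J \<subseteq> radical_closure G A E"
    unfolding finitely_cut_def by blast
  obtain E' where E': "finite E'" "E' \<subseteq> insert h I" "E \<subseteq> radical_closure G A E'"
    using radical_closure_compact_set[OF E(1,2)] by blast
  let ?F = "E' - {h}" and ?K = "radical_closure G A (E' - {h} \<union> F)"
  have K: "stable_radical_ideal G A ?K"
    using E' F IA by (intro stable_radical_ideal_radical_closure) auto
  have "x \<in> ?K" if x: "x \<in> I" for x
  proof -
    have "x \<in> radical_closure G A E'"
      using x E(3) radical_closure_mono[OF order_refl order_refl E'(3)]
        radical_closure_gens[of "insert h I" G A] by blast
    then have "x \<in> radical_closure G A (insert h ?F)"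
      using radical_closure_mono_gens[of E' "insert h ?F" G A] by blast
    moreover have "b * h \<in> ?K" if "b \<in> I" for b
      using local[OF that] radical_closure_mono_gens[of F "?F \<union> F" G A] by blast
    moreover have "?F \<subseteq> ?K"
      using radical_closure_gens[of "?F \<union> F" G A] by blast
    ultimately have "x * x \<in> ?K"
      using closure_by_localization[OF I(1) K h(1)] x by blast
    then have "x ^ 2 \<in> ?K" by (simp add: power2_eq_square)
    then show ?thesis using stable_radical_ideal_root[OF K, of x 2] x IA by blast
  qed
  then have "I \<subseteq> ?K" by blast
  moreover have "finite (?F \<union> F)" "?F \<union> F \<subseteq> I" using E' F by auto
  ultimately have "finitely_cut G A I"
    unfolding finitely_cut_def by (intro exI[of _ "?F \<union> F"] conjI)
  with I(2) show False by contradiction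
qed

end

section \<open>Polynomials in arbitrarily many variables\<close>

abbreviation "lookup \<equiv> Poly_Mapping.lookup"
abbreviation "keys \<equiv> Poly_Mapping.keys"
abbreviation "single \<equiv> Poly_Mapping.single"

definition const :: "'k::field \<Rightarrow> ('v, 'k) sym" where "const c = single 0 c"
definition mon :: "('v \<Rightarrow>\<^sub>0 nat) \<Rightarrow> ('v, 'k::field) sym" where "mon m = single m 1"
definition var :: "'v \<Rightarrow> ('v, 'k::field) sym" where "var v = mon (single v 1)"

lemma const_simps [simp]:
  "const 0 = 0" "const 1 = 1" "const (a + b) = const a + const b" "const (a * b) = const a * const b"
  "const (- a) = - const a" "const (a - b) = const a - const b"
  by (simp_all add: const_def single_add mult_single single_uminus single_diff)

lemma const_of_nat: "const (of_nat n) = of_nat n" by (induction n) simp_all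

lemma const_power: "const (a ^ n) = const a ^ n" by (induction n) simp_all

lemma const_mult_single: "const c * single m d = single m (c * d)"
  by (simp add: const_def mult_single)

lemma lookup_const_mult [simp]: "lookup (const c * p) m = c * lookup p m"
proof -
  have "const c * p = Poly_Mapping.map ((*) c) p"
    by (simp add: const_def mult_map_scale_conv_mult)
  then show ?thesis by (simp add: Poly_Mapping.map.rep_eq when_def)
qed

lemma const_eq_0_iff [simp]: "(const c :: ('a, 'k::field) sym) = 0 \<longleftrightarrow> c = 0"
proof
  assume "(const c :: ('a, 'k) sym) = 0"
  then have "lookup (const c :: ('a, 'k) sym) 0 = 0" by simp
  then show "c = 0" by (simp add: const_def)
qed simp

lemma mon_0 [simp]: "mon 0 = 1" by (simp add: mon_def)
lemma mon_add: "mon (a + b) = mon a * mon b" by (simp add: mon_def mult_single)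

lemma mon_single: "mon (single v n) = var v ^ n"
proof (induction n)
  case (Suc n)
  have "single v (Suc n) = single v 1 + single v n" by (simp flip: single_add)
  with Suc show ?case by (simp add: mon_add var_def)
qed simp

lemma sum_lookup_single: "finite S \<Longrightarrow> keys p \<subseteq> S \<Longrightarrow> (\<Sum>m\<in>S. single m (lookup p m)) = p"
  by (rule poly_mapping_eqI) (auto simp: lookup_sum lookup_single when_def in_keys_iff)

lemma mon_prod: "mon m = (\<Prod>i\<in>keys m. var i ^ lookup m i)"
proof -
  have "mon (\<Sum>i\<in>S. single i (lookup m i)) = (\<Prod>i\<in>S. var i ^ lookup m i)" for S
    by (induction S rule: infinite_finite_induct) (simp_all add: mon_add mon_single)
  from this[of "keys m"] show ?thesis by (simp add: sum_lookup_single)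
qed

lemma sum_const_mon: "(\<Sum>m\<in>keys p. const (lookup p m) * mon m) = p"
  using sum_lookup_single[of "keys p" p] by (simp add: mon_def const_mult_single)

lemma keys_const_mult: "keys (const c * p) \<subseteq> keys p"
  by (auto simp: in_keys_iff)

lemma keys_sum_subset: "keys (\<Sum>x\<in>S. f x) \<subseteq> (\<Union>x\<in>S. keys (f x))"
proof
  fix m assume "m \<in> keys (\<Sum>x\<in>S. f x)"
  then have "(\<Sum>x\<in>S. lookup (f x) m) \<noteq> 0" by (simp add: in_keys_iff lookup_sum)
  then obtain x where "x \<in> S" "lookup (f x) m \<noteq> 0" by (meson sum.neutral)
  then show "m \<in> (\<Union>x\<in>S. keys (f x))" by (auto simp: in_keys_iff)
qed

lemma keys_add_nat [simp]: "keys ((a :: 'v \<Rightarrow>\<^sub>0 nat) + b) = keys a \<union> keys b"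
  by (auto simp: in_keys_iff lookup_add)

lemma CHAR_sym [simp]: "CHAR(('v, 'k::field) sym) = CHAR('k)"
proof (rule CHAR_eqI)
  have *: "of_nat n = (0 :: ('v, 'k) sym) \<longleftrightarrow> of_nat n = (0 :: 'k)" for n
    using const_eq_0_iff[of "of_nat n :: 'k", where 'a = 'v]
    unfolding const_of_nat .
  show "of_nat CHAR('k) = (0 :: ('v, 'k) sym)" by (simp add: *)
  show "CHAR('k) dvd n" if "of_nat n = (0 :: ('v, 'k) sym)" for n
    using that * by (simp add: of_nat_eq_0_iff_char_dvd)
qed

subsection \<open>Substitution\<close>

text \<open>Evaluation of a polynomial at \<open>y\<close>, with scalars sent through \<open>\<kappa>\<close>. The target is an arbitrary
  commutative ring because besides the action itself also its deformation with a parameter, with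
  values in univariate polynomials over equations, is of this form.\<close>

definition psubst :: "('k \<Rightarrow> 'a) \<Rightarrow> ('v \<Rightarrow> 'a) \<Rightarrow> ('v, 'k::field) sym \<Rightarrow> 'a::comm_ring_1"
  where "psubst \<kappa> y p = (\<Sum>m\<in>keys p. \<kappa> (lookup p m) * (\<Prod>i\<in>keys m. y i ^ lookup m i))"

locale scalar_hom =
  fixes \<kappa> :: "'k::field \<Rightarrow> 'a::comm_ring_1"
  assumes hom_0: "\<kappa> 0 = 0" and hom_1: "\<kappa> 1 = 1"
    and hom_add: "\<kappa> (a + b) = \<kappa> a + \<kappa> b" and hom_mult: "\<kappa> (a * b) = \<kappa> a * \<kappa> b"
begin

lemma psubst_superset:
  "finite S \<Longrightarrow> keys p \<subseteq> S \<Longrightarrow> psubst \<kappa> y p = (\<Sum>m\<in>S. \<kappa> (lookup p m) * (\<Prod>i\<in>keys m. y i ^ lookup m i))"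
  unfolding psubst_def by (rule sum.mono_neutral_left) (auto simp: in_keys_iff hom_0)

lemma psubst_0 [simp]: "psubst \<kappa> y 0 = 0" by (simp add: psubst_def)

lemma psubst_add: "psubst \<kappa> y (p + q) = psubst \<kappa> y p + psubst \<kappa> y q"
proof -
  let ?S = "keys p \<union> keys q"
  have "psubst \<kappa> y (p + q) = (\<Sum>m\<in>?S. \<kappa> (lookup (p + q) m) * (\<Prod>i\<in>keys m. y i ^ lookup m i))"
    by (rule psubst_superset) (auto simp: keys_add)
  also have "\<dots> = (\<Sum>m\<in>?S. \<kappa> (lookup p m) * (\<Prod>i\<in>keys m. y i ^ lookup m i))
      + (\<Sum>m\<in>?S. \<kappa> (lookup q m) * (\<Prod>i\<in>keys m. y i ^ lookup m i))"
    by (simp add: lookup_add hom_add distrib_right sum.distrib)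
  also have "\<dots> = psubst \<kappa> y p + psubst \<kappa> y q"
    by (simp add: psubst_superset[of ?S p] psubst_superset[of ?S q])
  finally show ?thesis .
qed

lemma psubst_sum: "psubst \<kappa> y (\<Sum>x\<in>S. f x) = (\<Sum>x\<in>S. psubst \<kappa> y (f x))"
  by (induction S rule: infinite_finite_induct) (simp_all add: psubst_add)

lemma psubst_single: "psubst \<kappa> y (single m c) = \<kappa> c * (\<Prod>i\<in>keys m. y i ^ lookup m i)"
  using psubst_superset[of "{m}" "single m c" y] by simp

lemma prod_monomial_add:
  "(\<Prod>i\<in>keys a \<union> keys b. y i ^ lookup (a + b) i)
    = (\<Prod>i\<in>keys a. y i ^ lookup a i) * (\<Prod>i\<in>keys b. y i ^ lookup b i :: 'a)"
proof -
  have "(\<Prod>i\<in>keys a. y i ^ lookup a i) = (\<Prod>i\<in>keys a \<union> keys b. y i ^ lookup a i)"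
    "(\<Prod>i\<in>keys b. y i ^ lookup b i) = (\<Prod>i\<in>keys a \<union> keys b. y i ^ lookup b i)"
    by (rule prod.mono_neutral_left; auto simp: in_keys_iff)+
  then show ?thesis by (simp add: lookup_add power_add prod.distrib)
qed

lemma psubst_mult: "psubst \<kappa> y (p * q) = psubst \<kappa> y p * psubst \<kappa> y q"
proof -
  have "p * q = (\<Sum>a\<in>keys p. \<Sum>b\<in>keys q. single (a + b) (lookup p a * lookup q b))"
    using sum_product[of "\<lambda>a. single a (lookup p a)" "keys p" "\<lambda>b. single b (lookup q b)" "keys q"]
    by (simp add: sum_lookup_single mult_single)
  also have "psubst \<kappa> y \<dots> = (\<Sum>a\<in>keys p. \<Sum>b\<in>keys q.
      (\<kappa> (lookup p a) * (\<Prod>i\<in>keys a. y i ^ lookup a i)) * (\<kappa> (lookup q b) * (\<Prod>i\<in>keys b. y i ^ lookup b i)))"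
    by (simp add: psubst_sum psubst_single prod_monomial_add hom_mult ac_simps)
  also have "\<dots> = psubst \<kappa> y p * psubst \<kappa> y q"
    unfolding psubst_def by (rule sum_product[symmetric])
  finally show ?thesis .
qed

lemma psubst_const [simp]: "psubst \<kappa> y (const c) = \<kappa> c"
  by (simp add: const_def psubst_single)

lemma psubst_1 [simp]: "psubst \<kappa> y 1 = 1"
  using psubst_const[of y 1] by (simp add: hom_1)

lemma psubst_mon: "psubst \<kappa> y (mon m) = (\<Prod>i\<in>keys m. y i ^ lookup m i)"
  by (simp add: mon_def psubst_single hom_1)

lemma psubst_var [simp]: "psubst \<kappa> y (var v) = y v"
  by (simp add: var_def psubst_mon)

lemma psubst_power: "psubst \<kappa> y (p ^ n) = psubst \<kappa> y p ^ n"
  by (induction n) (simp_all add: psubst_mult)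

end

lemma scalar_hom_const: "scalar_hom const" by unfold_locales simp_all

interpretation const: scalar_hom const by (rule scalar_hom_const)

lemma psubst_const_var: "psubst const var p = p"
proof -
  have mon: "psubst const var (mon m) = mon m" for m :: "'a \<Rightarrow>\<^sub>0 nat"
    unfolding const.psubst_mon by (rule mon_prod[symmetric])
  have "psubst const var p = psubst const var (\<Sum>m\<in>keys p. const (lookup p m) * mon m)"
    by (simp only: sum_const_mon)
  also have "\<dots> = (\<Sum>m\<in>keys p. const (lookup p m) * mon m)"
    by (simp only: const.psubst_sum const.psubst_mult const.psubst_const mon)
  finally show ?thesis by (simp only: sum_const_mon)
qed

lemma psubst_compose:
  assumes "\<theta> 0 = 0" "\<theta> 1 = 1" "\<And>x y. \<theta> (x + y) = \<theta> x + \<theta> y" "\<And>x y. \<theta> (x * y) = \<theta> x * \<theta> y"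
  shows "\<theta> (psubst \<kappa> y p) = psubst (\<lambda>c. \<theta> (\<kappa> c)) (\<lambda>i. \<theta> (y i)) p"
proof -
  have sum: "\<theta> (\<Sum>x\<in>S. f x) = (\<Sum>x\<in>S. \<theta> (f x))" for S and f :: "'x \<Rightarrow> _"
    by (induction S rule: infinite_finite_induct) (simp_all add: assms)
  have prod: "\<theta> (\<Prod>x\<in>S. f x) = (\<Prod>x\<in>S. \<theta> (f x))" for S and f :: "'x \<Rightarrow> _"
    by (induction S rule: infinite_finite_induct) (simp_all add: assms)
  have power: "\<theta> (x ^ n) = \<theta> x ^ n" for x n
    by (induction n) (simp_all add: assms)
  show ?thesis by (simp add: psubst_def sum prod power assms)
qed

subsection \<open>Subrings generated by a set of variables\<close>

definition polys_in :: "'v set \<Rightarrow> ('v, 'k::field) sym set"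
  where "polys_in W = {p. \<forall>m\<in>keys p. keys m \<subseteq> W}"

lemma polys_in_zero [simp]: "0 \<in> polys_in W"
  and polys_in_one [simp]: "1 \<in> polys_in W"
  and polys_in_const [simp]: "const c \<in> polys_in W"
  by (auto simp: polys_in_def const_def split: if_splits)

lemma polys_in_mon [simp]: "(mon m :: ('v, 'k::field) sym) \<in> polys_in W \<longleftrightarrow> keys m \<subseteq> W"
  by (simp add: polys_in_def mon_def)

lemma polys_in_var [simp]: "(var v :: ('v, 'k::field) sym) \<in> polys_in W \<longleftrightarrow> v \<in> W"
  by (simp add: var_def)

lemma polys_in_add: "p \<in> polys_in W \<Longrightarrow> q \<in> polys_in W \<Longrightarrow> p + q \<in> polys_in W"
  using keys_add[of p q] by (auto simp: polys_in_def)

lemma polys_in_uminus: "p \<in> polys_in W \<Longrightarrow> - p \<in> polys_in W"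
  by (auto simp: polys_in_def in_keys_iff)

lemma polys_in_mult: "p \<in> polys_in W \<Longrightarrow> q \<in> polys_in W \<Longrightarrow> p * q \<in> polys_in W"
  using keys_mult[of p q] by (fastforce simp: polys_in_def)

lemma polys_in_power: "p \<in> polys_in W \<Longrightarrow> p ^ n \<in> polys_in W"
  by (induction n) (auto intro: polys_in_mult)

lemma polys_in_sum: "(\<And>x. x \<in> S \<Longrightarrow> f x \<in> polys_in W) \<Longrightarrow> (\<Sum>x\<in>S. f x) \<in> polys_in W"
  by (induction S rule: infinite_finite_induct) (auto intro: polys_in_add)

lemma polys_in_prod: "(\<And>x. x \<in> S \<Longrightarrow> f x \<in> polys_in W) \<Longrightarrow> (\<Prod>x\<in>S. f x) \<in> polys_in W"
  by (induction S rule: infinite_finite_induct) (auto intro: polys_in_mult)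

lemma polys_in_mono: "W \<subseteq> W' \<Longrightarrow> polys_in W \<subseteq> polys_in W'"
  by (auto simp: polys_in_def)

lemma polys_in_psubst:
  assumes "p \<in> polys_in W" "\<And>v. v \<in> W \<Longrightarrow> y v \<in> polys_in W'"
  shows "psubst const y p \<in> polys_in W'"
  unfolding psubst_def
proof (intro polys_in_sum polys_in_mult polys_in_prod polys_in_power polys_in_const)
  fix m i assume "m \<in> keys p" "i \<in> keys m"
  then show "y i \<in> polys_in W'" using assms by (auto simp: polys_in_def[of W])
qed

lemma polys_in_induct [consumes 1, case_names const var add mult]:
  assumes "p \<in> polys_in W"
    and "\<And>c. P (const c)" "\<And>v. v \<in> W \<Longrightarrow> P (var v)"
    and add: "\<And>p q. P p \<Longrightarrow> P q \<Longrightarrow> P (p + q)" and mult: "\<And>p q. P p \<Longrightarrow> P q \<Longrightarrow> P (p * q)"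
  shows "P p"
proof -
  have sum: "(\<And>x. x \<in> S \<Longrightarrow> P (f x)) \<Longrightarrow> P (\<Sum>x\<in>S. f x)" for S and f :: "('a \<Rightarrow>\<^sub>0 nat) \<Rightarrow> _"
    using assms(2)[of 0] by (induction S rule: infinite_finite_induct) (simp_all add: add)
  have prod: "(\<And>x. x \<in> S \<Longrightarrow> P (f x)) \<Longrightarrow> P (\<Prod>x\<in>S. f x)" for S and f :: "'a \<Rightarrow> _"
    using assms(2)[of 1] by (induction S rule: infinite_finite_induct) (simp_all add: mult)
  have power: "P x \<Longrightarrow> P (x ^ n)" for x n
    using assms(2)[of 1] by (induction n) (simp_all add: mult)
  have "P (psubst const var p)"
    unfolding psubst_def using assms(1-3)
    by (intro sum mult prod power) (auto simp: polys_in_def)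
  then show ?thesis by (simp add: psubst_const_var)
qed

subsection \<open>Coefficients with respect to some of the variables\<close>

definition pm_restrict :: "'b set \<Rightarrow> ('b \<Rightarrow>\<^sub>0 'c::zero) \<Rightarrow> ('b \<Rightarrow>\<^sub>0 'c)"
  where "pm_restrict S m = Poly_Mapping.mapp (\<lambda>i c. c when i \<in> S) m"

lemma lookup_pm_restrict: "lookup (pm_restrict S m) i = (lookup m i when i \<in> S)"
  by (auto simp: pm_restrict_def lookup_mapp when_def in_keys_iff)

lemma keys_pm_restrict [simp]: "keys (pm_restrict S m) = keys m \<inter> S"
  by (auto simp: in_keys_iff lookup_pm_restrict)

lemma pm_restrict_add:
  "pm_restrict S (a + b) = pm_restrict S a + pm_restrict S (b :: _ \<Rightarrow>\<^sub>0 _::comm_monoid_add)"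
  by (rule poly_mapping_eqI) (simp add: lookup_pm_restrict lookup_add when_def)

lemma pm_restrict_Compl_add:
  "pm_restrict S a + pm_restrict (- S) a = (a :: _ \<Rightarrow>\<^sub>0 _::comm_monoid_add)"
  by (rule poly_mapping_eqI) (simp add: lookup_pm_restrict lookup_add when_def)

lemma pm_restrict_id: "keys m \<subseteq> S \<Longrightarrow> pm_restrict S m = m"
  by (rule poly_mapping_eqI) (auto simp: lookup_pm_restrict when_def in_keys_iff)

lemma pm_restrict_eq_0: "keys m \<inter> S = {} \<Longrightarrow> pm_restrict S m = 0"
  by (rule poly_mapping_eqI) (auto simp: lookup_pm_restrict when_def in_keys_iff)

lemma pm_restrict_restrict: "pm_restrict S (pm_restrict T m) = pm_restrict (S \<inter> T) m"
  by (rule poly_mapping_eqI) (auto simp: lookup_pm_restrict when_def)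

text \<open>The coefficient of the monomial \<open>\<alpha>\<close> when \<open>f\<close> is read as a polynomial in the variables \<open>R\<close> with
  coefficients in the remaining variables.\<close>

definition rcoeff :: "'v set \<Rightarrow> ('v \<Rightarrow>\<^sub>0 nat) \<Rightarrow> ('v, 'k::field) sym \<Rightarrow> ('v, 'k) sym"
  where "rcoeff R \<alpha> f = (\<Sum>m\<in>keys f. single (pm_restrict (- R) m) (lookup f m) when pm_restrict R m = \<alpha>)"

lemma lookup_rcoeff:
  "lookup (rcoeff R \<alpha> f) \<beta> = (lookup f (\<alpha> + \<beta>) when keys \<alpha> \<subseteq> R \<and> keys \<beta> \<inter> R = {})"
proof -
  have eq: "(pm_restrict R m = \<alpha> \<and> pm_restrict (- R) m = \<beta>) \<longleftrightarrow>
      (m = \<alpha> + \<beta> \<and> keys \<alpha> \<subseteq> R \<and> keys \<beta> \<inter> R = {})" for m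
    using pm_restrict_Compl_add[of R m]
    by (auto simp: pm_restrict_add pm_restrict_id pm_restrict_eq_0)
  have "lookup (rcoeff R \<alpha> f) \<beta> =
      (\<Sum>m\<in>keys f. if pm_restrict R m = \<alpha> \<and> pm_restrict (- R) m = \<beta> then lookup f m else 0)"
    unfolding rcoeff_def lookup_sum by (rule sum.cong) (simp_all add: when_def lookup_single)
  also have "\<dots> = (\<Sum>m\<in>keys f. if m = \<alpha> + \<beta> then (lookup f m when keys \<alpha> \<subseteq> R \<and> keys \<beta> \<inter> R = {}) else 0)"
    by (rule sum.cong) (simp_all only: eq when_def if_splits, simp_all)
  also have "\<dots> = (lookup f (\<alpha> + \<beta>) when keys \<alpha> \<subseteq> R \<and> keys \<beta> \<inter> R = {})"
    by (subst sum.delta) (simp_all add: in_keys_iff)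
  finally show ?thesis .
qed

lemma rcoeff_add: "rcoeff R \<alpha> (f + g) = rcoeff R \<alpha> f + rcoeff R \<alpha> g"
  by (rule poly_mapping_eqI) (simp add: lookup_rcoeff lookup_add when_def)

lemma rcoeff_const_mult: "rcoeff R \<alpha> (const c * f) = const c * rcoeff R \<alpha> f"
  by (rule poly_mapping_eqI) (simp add: lookup_rcoeff when_def)

lemma rcoeff_in:
  assumes "f \<in> polys_in W" shows "rcoeff R \<alpha> f \<in> polys_in (W - R)"
  unfolding polys_in_def mem_Collect_eq
proof
  fix m assume "m \<in> keys (rcoeff R \<alpha> f)"
  then have "lookup f (\<alpha> + m) \<noteq> 0" "keys m \<inter> R = {}"
    by (auto simp: in_keys_iff[of _ "rcoeff R \<alpha> f"] lookup_rcoeff when_def split: if_splits)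
  then have "\<alpha> + m \<in> keys f" by (simp add: in_keys_iff)
  then have "keys (\<alpha> + m) \<subseteq> W" using assms unfolding polys_in_def by blast
  with \<open>keys m \<inter> R = {}\<close> show "keys m \<subseteq> W - R" by auto
qed

lemma rcoeff_0: "f \<in> polys_in W \<Longrightarrow> W \<inter> R = {} \<Longrightarrow> rcoeff R 0 f = f"
proof (rule poly_mapping_eqI)
  fix \<beta> assume f: "f \<in> polys_in W" "W \<inter> R = {}"
  have "lookup f \<beta> = 0" if "keys \<beta> \<inter> R \<noteq> {}"
  proof (rule ccontr)
    assume "lookup f \<beta> \<noteq> 0"
    then have "\<beta> \<in> keys f" by (simp add: in_keys_iff)
    then have "keys \<beta> \<subseteq> W" using f(1) by (simp add: polys_in_def)
    with f(2) that show False by blast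
  qed
  then show "lookup (rcoeff R 0 f) \<beta> = lookup f \<beta>"
    by (auto simp: lookup_rcoeff when_def)
qed

text \<open>The expansion of \<open>f\<close> as a polynomial in the variables \<open>R\<close>: group the monomials by their \<open>R\<close>-part.\<close>

lemma sum_rcoeff: "(\<Sum>\<alpha>\<in>pm_restrict R ` keys f. rcoeff R \<alpha> f * mon \<alpha>) = f"
proof -
  have "(\<Sum>\<alpha>\<in>pm_restrict R ` keys f. rcoeff R \<alpha> f * mon \<alpha>)
      = (\<Sum>\<alpha>\<in>pm_restrict R ` keys f. \<Sum>m | m \<in> keys f \<and> pm_restrict R m = \<alpha>. single m (lookup f m))"
  proof (rule sum.cong)
    fix \<alpha>
    have "rcoeff R \<alpha> f = (\<Sum>m | m \<in> keys f \<and> pm_restrict R m = \<alpha>. single (pm_restrict (- R) m) (lookup f m))"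
      unfolding rcoeff_def by (simp add: when_def sum.If_cases Int_def)
    then show "rcoeff R \<alpha> f * mon \<alpha>
        = (\<Sum>m | m \<in> keys f \<and> pm_restrict R m = \<alpha>. single m (lookup f m))"
      by (auto simp: sum_distrib_right mon_def mult_single add.commute pm_restrict_Compl_add
          intro!: sum.cong)
  qed simp
  also have "\<dots> = (\<Sum>m\<in>keys f. single m (lookup f m))"
    by (rule sum.group) auto
  finally show ?thesis by (simp add: sum_lookup_single)
qed

definition total_deg :: "('b \<Rightarrow>\<^sub>0 nat) \<Rightarrow> nat" where "total_deg m = (\<Sum>i\<in>keys m. lookup m i)"

lemma total_deg_superset: "finite S \<Longrightarrow> keys m \<subseteq> S \<Longrightarrow> total_deg m = (\<Sum>i\<in>S. lookup m i)"
  unfolding total_deg_def by (rule sum.mono_neutral_left) (auto simp: in_keys_iff)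

lemma total_deg_add: "total_deg (a + b) = total_deg a + total_deg b"
  using total_deg_superset[of "keys a \<union> keys b" a] total_deg_superset[of "keys a \<union> keys b" b]
  by (simp add: total_deg_def[of "a + b"] lookup_add sum.distrib)

lemma total_deg_single [simp]: "total_deg (single i n) = n"
  by (simp add: total_deg_def)

lemma total_deg_0 [simp]: "total_deg 0 = 0" by (simp add: total_deg_def)

lemma total_deg_eq_0 [simp]: "total_deg m = 0 \<longleftrightarrow> m = 0"
  by (auto simp: total_deg_def in_keys_iff intro!: poly_mapping_eqI)

lemma lookup_le_total_deg: "lookup m i \<le> total_deg m"
proof (cases "i \<in> keys m")
  case True
  then show ?thesis unfolding total_deg_def by (intro member_le_sum) auto
qed (simp add: in_keys_iff)

section \<open>Ingredients from field theory\<close>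

text \<open>Over a finite field the polynomial $1 + \prod_a (x - a)$ would have no root.\<close>

lemma infinite_UNIV_alg_closed_field: "infinite (UNIV :: 'k::alg_closed_field set)"
proof
  assume fin: "finite (UNIV :: 'k set)"
  define p :: "'k poly" where "p = (\<Prod>a\<in>UNIV. [:- a, 1:]) + 1"
  have deg: "degree (\<Prod>a\<in>(UNIV :: 'k set). [:- a, 1:]) = card (UNIV :: 'k set)"
    by (subst degree_prod_eq_sum_degree) auto
  also have "\<dots> > 0" using fin by (simp add: card_gt_0_iff)
  finally have "degree p > 0" unfolding p_def by (subst degree_add_eq_left) auto
  then obtain x where "poly p x = 0" using alg_closed_imp_poly_has_root by blast
  moreover have "poly p x = 1" using fin by (auto simp: p_def poly_prod)
  ultimately show False by simp
qed

definition k_subspace :: "('v, 'k::field) sym set \<Rightarrow> bool"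
  where "k_subspace V \<longleftrightarrow> 0 \<in> V \<and> (\<forall>x\<in>V. \<forall>y\<in>V. x + y \<in> V) \<and> (\<forall>c. \<forall>x\<in>V. const c * x \<in> V)"

lemma k_subspace_diff:
  assumes "k_subspace V" "x \<in> V" "y \<in> V" shows "x - y \<in> V"
proof -
  have "x + const (- 1) * y \<in> V" using assms unfolding k_subspace_def by blast
  then show ?thesis by simp
qed

text \<open>A polynomial with infinitely many values in a subspace has its coefficients there. Dividing by
  \<open>t - c0\<close> lowers the degree, and the quotient still takes values in \<open>V\<close> because nonzero constants
  are invertible.\<close>

lemma coeff_in_subspace_aux:
  fixes P :: "('v, 'k::field) sym poly"
  assumes V: "k_subspace V"
  shows "degree P \<le> n \<Longrightarrow> infinite C \<Longrightarrow> (\<And>c. c \<in> C \<Longrightarrow> poly P (const c) \<in> V) \<Longrightarrow> coeff P j \<in> V"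
proof (induction n arbitrary: P C j)
  case 0
  then obtain a where a: "P = [:a:]" by (metis degree_eq_zeroE le_zero_eq)
  obtain c where "c \<in> C" using 0(2) by (metis ex_in_conv finite.emptyI)
  then have "a \<in> V" using 0(3)[of c] a by simp
  then show ?case using V a by (simp add: coeff_pCons k_subspace_def split: nat.split)
next
  case (Suc n)
  obtain c0 where c0: "c0 \<in> C" using Suc.prems(2) by (metis ex_in_conv finite.emptyI)
  define Q where "Q = synthetic_div P (const c0)"
  have P: "P = [:- const c0, 1:] * Q + [:poly P (const c0):]"
    unfolding Q_def by (rule synthetic_div_correct'[symmetric])
  have Q: "coeff Q i \<in> V" for i
  proof (rule Suc.IH)
    show "degree Q \<le> n" using Suc.prems(1) by (simp add: Q_def degree_synthetic_div)
    show "infinite (C - {c0})" using Suc.prems(2) by simp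
    fix c assume c: "c \<in> C - {c0}"
    have "poly P (const c) = const (c - c0) * poly Q (const c) + poly P (const c0)"
      by (subst P) (simp add: algebra_simps)
    then have "const (c - c0) * poly Q (const c) = poly P (const c) - poly P (const c0)"
      by simp
    then have "const (c - c0) * poly Q (const c) \<in> V"
      using k_subspace_diff[OF V Suc.prems(3) Suc.prems(3)] c c0 by auto
    then have "const (inverse (c - c0)) * (const (c - c0) * poly Q (const c)) \<in> V"
      using V unfolding k_subspace_def by blast
    then show "poly Q (const c) \<in> V" using c by (simp add: mult.assoc[symmetric] const_simps(4)[symmetric] del: const_simps(3-6))
  qed
  have "coeff P j = coeff (pCons 0 Q) j - const c0 * coeff Q j + coeff [:poly P (const c0):] j"
    by (subst P) (simp add: algebra_simps coeff_pCons split: nat.split)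
  moreover have "coeff (pCons 0 Q) j \<in> V" "coeff [:poly P (const c0):] j \<in> V" "const c0 * coeff Q j \<in> V"
    using Q Suc.prems(3)[OF c0] V by (auto simp: coeff_pCons k_subspace_def split: nat.split)
  ultimately show ?case
    using k_subspace_diff[OF V] V by (simp add: k_subspace_def)
qed

text \<open>This replaces the differentiation of one-parameter groups, which would lose information in positive
  characteristic.\<close>

lemma coeff_in_subspace:
  fixes P :: "('v, 'k::field) sym poly"
  assumes "infinite (UNIV :: 'k set)" "k_subspace V" "\<And>c. poly P (const c) \<in> V"
  shows "coeff P j \<in> V"
  using coeff_in_subspace_aux[OF assms(2) order_refl assms(1)] assms(3) by blast

text \<open>Powers of the characteristic, with the convention that only \<open>q = 1\<close> is admitted in characteristic 0
  (there \<open>p ^ 0 = 1\<close> and \<open>p ^ j = 0\<close> for \<open>j > 0\<close>).\<close>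

definition frob_exponent :: "nat \<Rightarrow> nat \<Rightarrow> bool"
  where "frob_exponent p q \<longleftrightarrow> q > 0 \<and> (\<exists>j. q = p ^ j)"

lemma frob_exponent_add:
  fixes x y :: "'a::comm_ring_1"
  assumes "frob_exponent CHAR('k::field) q" "CHAR('a) = CHAR('k)"
  shows "(x + y) ^ q = x ^ q + y ^ q"
proof (cases "CHAR('k) = 0")
  case True
  then have "q = 1" using assms(1) by (auto simp: frob_exponent_def power_0_left split: if_splits)
  then show ?thesis by simp
next
  case False
  then have "prime CHAR('a)" using assms(2) prime_CHAR_semidom[where ?'a = 'k] by simp
  moreover obtain j where "q = CHAR('a) ^ j" using assms by (auto simp: frob_exponent_def)
  ultimately show ?thesis by (intro freshmans_dream')
qed

text \<open>Applied to the exponents of the variables of interest in \<open>f\<close>: after passing to \<open>q\<close>-th powers of these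
  variables, some partial derivative is nonzero. As long as all exponents vanish in the field they
  can be divided by the characteristic, and this must stop since one of them is positive.\<close>

lemma frob_exponent_exists:
  fixes E :: "nat set"
  assumes "x \<in> E" "x > 0"
  shows "\<exists>q. frob_exponent CHAR('k::field) q \<and> (\<forall>e\<in>E. q dvd e) \<and> (\<exists>e\<in>E. of_nat (e div q) \<noteq> (0 :: 'k))"
  using assms
proof (induction x arbitrary: E rule: less_induct)
  case (less x)
  let ?p = "CHAR('k)"
  show ?case
  proof (cases "\<exists>e\<in>E. of_nat e \<noteq> (0 :: 'k)")
    case True
    then show ?thesis by (intro exI[of _ 1]) (auto simp: frob_exponent_def intro: exI[of _ 0])
  next
    case False
    then have dvd: "?p dvd e" if "e \<in> E" for e
      using that by (auto simp: of_nat_eq_0_iff_char_dvd)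
    have p: "?p > 0" using dvd[OF less.prems(1)] less.prems(2) by (auto intro: Nat.gr0I)
    have p1: "?p > 1" using prime_CHAR_semidom[where ?'a = 'k] p by (auto dest: prime_gt_1_nat)
    have "x div ?p < x" using less.prems(2) p1 by simp
    moreover have "x div ?p \<in> (\<lambda>e. e div ?p) ` E" using less.prems by auto
    moreover have "x div ?p > 0"
      using dvd[OF less.prems(1)] less.prems(2) dvd_div_eq_0_iff by blast
    ultimately obtain q where q: "frob_exponent ?p q" "\<forall>e\<in>E. q dvd e div ?p"
      "\<exists>e\<in>E. of_nat (e div ?p div q) \<noteq> (0 :: 'k)"
      using less.IH[of "x div ?p" "(\<lambda>e. e div ?p) ` E"] by auto
    obtain j where j: "q = ?p ^ j" "q > 0" using q(1) by (auto simp: frob_exponent_def)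
    have "?p * q dvd e" if "e \<in> E" for e
      using mult_dvd_mono[OF dvd_refl[of ?p], of q "e div ?p"] q(2) dvd[OF that] that by auto
    moreover have "frob_exponent ?p (?p * q)"
      using p j by (auto simp: frob_exponent_def intro: exI[of _ "Suc j"])
    ultimately show ?thesis
      using q(3) by (intro exI[of _ "?p * q"]) (auto simp: div_mult2_eq)
  qed
qed

section \<open>Differentiation with respect to powers of a variable\<close>

text \<open>The partial derivative of \<open>f\<close> with respect to $x_v^q$, meaningful if \<open>f\<close> involves $x_v$ only through
  $x_v^q$. Truncated subtraction is harmless: a monomial without \<open>v\<close> gets the coefficient \<open>0\<close>.\<close>

definition frob_deriv :: "nat \<Rightarrow> 'v \<Rightarrow> ('v, 'k::field) sym \<Rightarrow> ('v, 'k) sym"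
  where "frob_deriv q v f =
    (\<Sum>m\<in>keys f. single (m - single v q) (of_nat (lookup m v div q) * lookup f m))"

lemma lookup_frob_deriv:
  assumes "\<forall>m\<in>keys f. q dvd lookup m v" "q > 0"
  shows "lookup (frob_deriv q v f) n = of_nat ((lookup n v + q) div q) * lookup f (n + single v q)"
proof -
  have "lookup (frob_deriv q v f) n =
      (\<Sum>m\<in>keys f. if m - single v q = n then of_nat (lookup m v div q) * lookup f m else 0)"
    unfolding frob_deriv_def lookup_sum by (rule sum.cong) (simp_all add: lookup_single when_def)
  also have "\<dots> = (\<Sum>m\<in>keys f. if m = n + single v q then of_nat (lookup m v div q) * lookup f m else 0)"
  proof (rule sum.cong)
    fix m assume m: "m \<in> keys f"
    show "(if m - single v q = n then of_nat (lookup m v div q) * lookup f m else 0)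
        = (if m = n + single v q then of_nat (lookup m v div q) * lookup f m else 0)"
    proof (cases "lookup m v = 0")
      case True
      then show ?thesis by simp
    next
      case False
      then have "q \<le> lookup m v" using assms(1) m by (simp add: dvd_imp_le)
      then have "m - single v q + single v q = m"
        by (intro poly_mapping_eqI) (auto simp: lookup_add lookup_minus lookup_single when_def)
      then have "m - single v q = n \<longleftrightarrow> m = n + single v q" by auto
      then show ?thesis by simp
    qed
  qed simp
  also have "\<dots> = of_nat ((lookup n v + q) div q) * lookup f (n + single v q)"
    by (subst sum.delta) (simp_all add: lookup_add in_keys_iff)
  finally show ?thesis .
qed

lemma keys_frob_deriv:
  assumes "\<forall>m\<in>keys f. q dvd lookup m v" "q > 0" "n \<in> keys (frob_deriv q v f)"
  shows "n + single v q \<in> keys f"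
  using assms(3) by (auto simp: in_keys_iff lookup_frob_deriv[OF assms(1,2)])

lemma rcoeff_frob_deriv:
  assumes "\<forall>m\<in>keys f. q dvd lookup m v" "q > 0" "v \<in> R"
  shows "rcoeff R \<alpha> (frob_deriv q v f)
    = const (of_nat ((lookup \<alpha> v + q) div q)) * rcoeff R (\<alpha> + single v q) f"
proof (rule poly_mapping_eqI)
  fix \<beta> :: "'a \<Rightarrow>\<^sub>0 nat"
  show "lookup (rcoeff R \<alpha> (frob_deriv q v f)) \<beta>
      = lookup (const (of_nat ((lookup \<alpha> v + q) div q)) * rcoeff R (\<alpha> + single v q) f) \<beta>"
  proof (cases "keys \<alpha> \<subseteq> R \<and> keys \<beta> \<inter> R = {}")
    case True
    then have "lookup \<beta> v = 0" using assms(3) by (auto simp: in_keys_iff)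
    moreover have "keys (single v q) \<subseteq> R" using assms by simp
    moreover have "\<alpha> + single v q + \<beta> = \<alpha> + \<beta> + single v q" by (simp add: ac_simps)
    ultimately show ?thesis
      using True by (simp add: lookup_rcoeff lookup_frob_deriv[OF assms(1,2)] lookup_add)
  qed (simp add: lookup_rcoeff)
qed

section \<open>Ideals and coefficients\<close>

lemma acted_ring_trivial: "acted_ring {} (polys_in W)"
  by unfold_locales (auto intro: polys_in_add polys_in_mult)

lemma rcoeff_mult_mon: "rcoeff R \<alpha> f * mon \<alpha> = pm_restrict {m. pm_restrict R m = \<alpha>} f"
proof -
  have "rcoeff R \<alpha> f * mon \<alpha>
      = (\<Sum>m\<in>keys f. if pm_restrict R m = \<alpha> then single m (lookup f m) else 0)"
    unfolding rcoeff_def sum_distrib_right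
    by (rule sum.cong) (auto simp: when_def mon_def mult_single add.commute pm_restrict_Compl_add)
  also have "\<dots> = (\<Sum>m\<in>keys f. single m (lookup (pm_restrict {m. pm_restrict R m = \<alpha>} f) m))"
    by (rule sum.cong) (simp_all add: lookup_pm_restrict)
  also have "\<dots> = pm_restrict {m. pm_restrict R m = \<alpha>} f"
    by (rule sum_lookup_single) auto
  finally show ?thesis .
qed

definition deg_lt :: "'v set \<Rightarrow> nat \<Rightarrow> ('v, 'k::field) sym \<Rightarrow> bool"
  where "deg_lt R N f \<longleftrightarrow> (\<forall>m\<in>keys f. total_deg (pm_restrict R m) < N)"

lemma deg_lt_diff: "deg_lt R N f \<Longrightarrow> deg_lt R N g \<Longrightarrow> deg_lt R N (f - g)"
  unfolding deg_lt_def
proof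
  fix m assume fg: "\<forall>m\<in>keys f. total_deg (pm_restrict R m) < N" "\<forall>m\<in>keys g. total_deg (pm_restrict R m) < N"
    and "m \<in> keys (f - g)"
  then have "m \<in> keys f \<or> m \<in> keys g" by (auto simp: in_keys_iff lookup_minus)
  with fg show "total_deg (pm_restrict R m) < N" by blast
qed

lemma deg_lt_mult:
  assumes "deg_lt R (Suc a) f" "deg_lt R b g" shows "deg_lt R (a + b) (f * g)"
  unfolding deg_lt_def
proof
  fix m assume "m \<in> keys (f * g)"
  then obtain m1 m2 where "m = m1 + m2" "m1 \<in> keys f" "m2 \<in> keys g"
    using keys_mult[of f g] by blast
  then have "m = m1 + m2" "total_deg (pm_restrict R m1) < Suc a" "total_deg (pm_restrict R m2) < b"
    using assms by (auto simp: deg_lt_def)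
  then show "total_deg (pm_restrict R m) < a + b" by (simp add: pm_restrict_add total_deg_add)
qed

lemma deg_lt_disjoint: "f \<in> polys_in (W - R) \<Longrightarrow> deg_lt R 1 f"
proof -
  assume f: "f \<in> polys_in (W - R)"
  have "pm_restrict R m = 0" if "m \<in> keys f" for m
  proof (rule pm_restrict_eq_0)
    have "keys m \<subseteq> W - R" using f that by (simp add: polys_in_def)
    then show "keys m \<inter> R = {}" by auto
  qed
  then show ?thesis by (auto simp: deg_lt_def)
qed

lemma radical_closure_sum:
  assumes "\<And>x. x \<in> S \<Longrightarrow> f x \<in> radical_closure G A F"
  shows "(\<Sum>x\<in>S. f x) \<in> radical_closure G A F"
  using assms by (induction S rule: infinite_finite_induct) (simp_all add: radical_closure.intros)

lemma stable_radical_ideal_diff: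
  assumes "stable_radical_ideal G (polys_in W) I" "x \<in> I" "y \<in> I" shows "x - y \<in> I"
proof -
  have "const (- 1) * y \<in> I" by (rule stable_radical_ideal_mult[OF assms(1) _ assms(3)]) (rule polys_in_const)
  from stable_radical_ideal_add[OF assms(1,2) this] show ?thesis by simp
qed

lemma mon_restrict_in: "f \<in> polys_in W \<Longrightarrow> m \<in> keys f \<Longrightarrow> mon (pm_restrict R m) \<in> polys_in W"
  by (auto simp: polys_in_def mon_def)

text \<open>An element whose coefficients lie in \<open>J\<close> is a combination of them with monomials.\<close>

lemma in_ideal_if_coefficients:
  assumes J: "J \<subseteq> radical_closure G (polys_in W) F" and f: "f \<in> polys_in W"
    and c: "\<And>\<alpha>. rcoeff R \<alpha> f \<in> J"
  shows "f \<in> radical_closure G (polys_in W) F"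
proof -
  have "mon \<alpha> * rcoeff R \<alpha> f \<in> radical_closure G (polys_in W) F" if "\<alpha> \<in> pm_restrict R ` keys f" for \<alpha>
    using that J c mon_restrict_in[OF f] by (auto intro!: radical_closure.mult)
  then have "(\<Sum>\<alpha>\<in>pm_restrict R ` keys f. mon \<alpha> * rcoeff R \<alpha> f) \<in> radical_closure G (polys_in W) F"
    by (rule radical_closure_sum)
  then show ?thesis using sum_rcoeff[of R f] by (simp add: mult.commute)
qed

lemma stable_radical_ideal_contract:
  assumes I: "stable_radical_ideal G A I" and B: "acted_ring G' B" "B \<subseteq> A" "G' \<subseteq> G"
  shows "stable_radical_ideal G' B (I \<inter> B)"
proof -
  interpret acted_ring G' B by fact
  show ?thesis
  proof (rule stable_radical_idealI)
    show "x + y \<in> I \<inter> B" if "x \<in> I \<inter> B" "y \<in> I \<inter> B" for x y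
      using that stable_radical_ideal_add[OF I] add_closed by auto
    show "a * x \<in> I \<inter> B" if "a \<in> B" "x \<in> I \<inter> B" for a x
      using that stable_radical_ideal_mult[OF I] mult_closed B(2) by auto
    show "g x \<in> I \<inter> B" if "g \<in> G'" "x \<in> I \<inter> B" for g x
      using that stable_radical_ideal_act[OF I, of g x] act_closed[of g x] B(3) by auto
    show "x \<in> I \<inter> B" if "x \<in> B" "x ^ n \<in> I \<inter> B" for x n
      using that stable_radical_ideal_root[OF I, of x n] B(2) by auto
  qed (auto simp: stable_radical_ideal_zero[OF I] zero_closed)
qed

text \<open>Start with an element of least degree in \<open>R\<close> having some coefficient outside \<open>I\<close> and delete all terms
  whose coefficient lies in \<open>I\<close>. The deleted part lies in \<open>I\<close>, so the rest does; afterwards every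
  coefficient that occurs is outside \<open>I\<close>, which keeps derivatives outside \<open>I\<close> as well. The degree is
  positive because an element of degree zero in \<open>R\<close> is its own coefficient, and it lies in \<open>I\<close>.\<close>

lemma minimal_degree_element:
  assumes I: "stable_radical_ideal G (polys_in W) I"
    and not: "\<not> (\<forall>f\<in>I. \<forall>\<alpha>. rcoeff R \<alpha> f \<in> I)"
  obtains f D where "f \<in> I" "\<And>m. m \<in> keys f \<Longrightarrow> rcoeff R (pm_restrict R m) f \<notin> I"
    "deg_lt R (Suc D) f" "\<exists>m\<in>keys f. total_deg (pm_restrict R m) = D" "D > 0"
    "\<And>g \<alpha>. g \<in> I \<Longrightarrow> deg_lt R D g \<Longrightarrow> rcoeff R \<alpha> g \<in> I"
proof -
  let ?P = "\<lambda>N. \<exists>f\<in>I. deg_lt R N f \<and> (\<exists>\<alpha>. rcoeff R \<alpha> f \<notin> I)"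
  obtain f1 \<alpha>1 where f1: "f1 \<in> I" "rcoeff R \<alpha>1 f1 \<notin> I" using not by blast
  have "\<exists>N. deg_lt R N f1"
    by (rule exI[of _ "Suc (\<Sum>m\<in>keys f1. total_deg (pm_restrict R m))"])
      (auto simp: deg_lt_def less_Suc_eq_le intro!: member_le_sum)
  then have ex: "\<exists>N. ?P N" using f1 by blast
  define N where "N = (LEAST N. ?P N)"
  have "?P N" unfolding N_def by (rule LeastI_ex[OF ex])
  then obtain f0 \<alpha>0 where f0: "f0 \<in> I" "deg_lt R N f0" "rcoeff R \<alpha>0 f0 \<notin> I" by blast
  have min: "rcoeff R \<alpha> g \<in> I" if "g \<in> I" "deg_lt R M g" "M < N" for g \<alpha> M
    using not_less_Least[of M ?P] that unfolding N_def by blast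
  \<comment> \<open>the monomials that survive the deletion; membership depends only on the \<open>R\<close>-part\<close>
  define S where "S = {m. rcoeff R (pm_restrict R m) f0 \<notin> I}"
  define f where "f = pm_restrict S f0"
  have zero: "0 \<in> I" by (rule stable_radical_ideal_zero[OF I])
  have rc: "rcoeff R \<alpha> (pm_restrict T f0) = (if \<exists>m\<in>T. pm_restrict R m = \<alpha> then rcoeff R \<alpha> f0 else 0)"
    if T: "\<And>m m'. pm_restrict R m = pm_restrict R m' \<Longrightarrow> m \<in> T \<longleftrightarrow> m' \<in> T" for \<alpha> T
  proof (rule poly_mapping_eqI)
    fix \<beta>
    have "\<alpha> + \<beta> \<in> T \<longleftrightarrow> (\<exists>m\<in>T. pm_restrict R m = \<alpha>)" if "keys \<alpha> \<subseteq> R" "keys \<beta> \<inter> R = {}"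
    proof -
      have "pm_restrict R (\<alpha> + \<beta>) = \<alpha>"
        using that by (simp add: pm_restrict_add pm_restrict_id pm_restrict_eq_0)
      then show ?thesis using T by metis
    qed
    then show "lookup (rcoeff R \<alpha> (pm_restrict T f0)) \<beta>
        = lookup (if \<exists>m\<in>T. pm_restrict R m = \<alpha> then rcoeff R \<alpha> f0 else 0) \<beta>"
      by (auto simp: lookup_rcoeff lookup_pm_restrict when_def)
  qed
  have rcf: "rcoeff R \<alpha> f = (if \<exists>m\<in>S. pm_restrict R m = \<alpha> then rcoeff R \<alpha> f0 else 0)" for \<alpha>
    unfolding f_def by (rule rc) (simp add: S_def)
  have rcg: "rcoeff R \<alpha> (pm_restrict (- S) f0) \<in> I" for \<alpha>
    using zero by (subst rc) (auto simp: S_def)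
  have f0W: "f0 \<in> polys_in W" using f0(1) stable_radical_ideal_subset[OF I] by blast
  have "pm_restrict (- S) f0 \<in> polys_in W" using f0W by (auto simp: polys_in_def)
  then have "pm_restrict (- S) f0 \<in> radical_closure G (polys_in W) I"
    using radical_closure_gens rcg by (intro in_ideal_if_coefficients[of I])
  then have "pm_restrict (- S) f0 \<in> I" using stable_radical_ideal_closure[OF I] by blast
  moreover have "f = f0 - pm_restrict (- S) f0"
    using pm_restrict_Compl_add[of S f0] unfolding f_def by (simp add: algebra_simps)
  ultimately have f: "f \<in> I" using stable_radical_ideal_diff[OF I f0(1)] by simp
  have kf: "rcoeff R (pm_restrict R m) f \<notin> I" if "m \<in> keys f" for m
    using that unfolding rcf by (auto simp: f_def S_def)
  have degf: "deg_lt R N f" using f0(2) by (auto simp: deg_lt_def f_def)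
  have \<alpha>0: "rcoeff R \<alpha>0 f \<notin> I"
  proof -
    have "rcoeff R \<alpha>0 f0 \<noteq> 0" using f0(3) zero by metis
    then obtain \<beta> where "lookup (rcoeff R \<alpha>0 f0) \<beta> \<noteq> 0" by (metis poly_mapping_eqI lookup_zero)
    then have "keys \<alpha>0 \<subseteq> R" by (auto simp: lookup_rcoeff when_def split: if_splits)
    then have "pm_restrict R \<alpha>0 = \<alpha>0" by (rule pm_restrict_id)
    then have "\<alpha>0 \<in> S" using f0(3) by (simp add: S_def)
    with \<open>pm_restrict R \<alpha>0 = \<alpha>0\<close> f0(3) show ?thesis unfolding rcf by auto
  qed
  have "N > 1"
  proof (rule ccontr)
    assume "\<not> N > 1"
    then have *: "pm_restrict R m = 0" if "m \<in> keys f" for m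
      using degf that by (fastforce simp: deg_lt_def simp flip: total_deg_eq_0)
    have "f = rcoeff R 0 f"
    proof (rule rcoeff_0[symmetric])
      have "keys m \<inter> R = {}" if "m \<in> keys f" for m
        using arg_cong[OF *[OF that], of keys] by simp
      then show "f \<in> polys_in (- R)" by (auto simp: polys_in_def)
    qed simp
    moreover have "keys f \<noteq> {}" using \<alpha>0 zero by (auto simp: rcoeff_def)
    then obtain m where "m \<in> keys f" by blast
    then have "rcoeff R 0 f \<notin> I" using kf * by metis
    ultimately show False using f by simp
  qed
  then obtain D where D: "N = Suc D" "D > 0" by (cases N) auto
  show ?thesis
  proof (rule that[of f D])
    show "\<exists>m\<in>keys f. total_deg (pm_restrict R m) = D"
    proof (rule ccontr)
      assume "\<not> ?thesis"
      then have "deg_lt R D f" using degf by (auto simp: deg_lt_def D(1) less_Suc_eq)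
      then show False using min[OF f, of D] \<alpha>0 D by blast
    qed
  qed (use f kf degf D min in auto)
qed

section \<open>Finitely many variables\<close>

text \<open>A version of Hilbert's basis theorem up to radicals, by the same scheme as the induction step: here the
  role of \<open>h\<close> is played by the leading coefficient in \<open>x\<close> of an element \<open>f\<close> of least degree, and
  pseudo-division by \<open>f\<close> reduces every element of \<open>I\<close> times a power of \<open>h\<close> to elements of lower degree,
  whose coefficients lie in \<open>I\<close>.\<close>

theorem topologically_noetherian_finite:
  fixes W :: "'v set"
  assumes "finite W"
  shows "topologically_noetherian {} (polys_in W :: ('v, 'k::field) sym set)"
  using assms
proof (induction W)
  case empty
  show ?case unfolding topologically_noetherian_def
  proof (intro allI impI)
    fix I :: "('v, 'k) sym set" assume I: "stable_radical_ideal {} (polys_in {}) I"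
    have const: "p = const (lookup p 0)" if "p \<in> I" for p
    proof -
      have "keys p \<subseteq> {0}" using that stable_radical_ideal_subset[OF I] by (auto simp: polys_in_def)
      then show ?thesis
        by (intro poly_mapping_eqI) (auto simp: const_def lookup_single when_def in_keys_iff)
    qed
    show "finitely_cut {} (polys_in {}) I"
    proof (cases "I \<subseteq> {0}")
      case True
      then show ?thesis by (auto simp: finitely_cut_def intro!: exI[of _ "{}"] radical_closure.zero)
    next
      case False
      then obtain x where x: "x \<in> I" "x \<noteq> 0" by auto
      let ?K = "radical_closure {} (polys_in {}) {x}"
      obtain c where c: "x = const c" "c \<noteq> 0" using const[OF x(1)] x(2) by force
      have "y \<in> ?K" if y: "y \<in> I" for y
      proof -
        have "const (lookup y 0 / c) * x \<in> ?K"
          by (intro radical_closure.mult radical_closure.gen) auto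
        moreover have "const (lookup y 0 / c) * x = const (lookup y 0)"
          unfolding c(1) using c(2) by (simp add: const_simps(4)[symmetric] del: const_simps(3-6))
        ultimately show ?thesis using const[OF y] by simp
      qed
      with x(1) show ?thesis unfolding finitely_cut_def by (intro exI[of _ "{x}"]) auto
    qed
  qed
next
  case (insert x W0)
  let ?W = "insert x W0" and ?R = "{x}"
  have WR: "?W - ?R = W0" using insert.hyps by auto
  interpret acted_ring "{}" "polys_in ?W :: ('v, 'k) sym set" by (rule acted_ring_trivial)
  show ?case
  proof (rule topologically_noetherian_by_localization)
    fix I :: "('v, 'k) sym set" assume I: "stable_radical_ideal {} (polys_in ?W) I"
    have IW: "I \<subseteq> polys_in ?W" by (rule stable_radical_ideal_subset[OF I])
    have sub: "polys_in W0 \<subseteq> polys_in ?W" by (rule polys_in_mono) auto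
    have "stable_radical_ideal {} (polys_in W0) (I \<inter> polys_in W0)"
      by (rule stable_radical_ideal_contract[OF I acted_ring_trivial sub order_refl])
    then obtain F where F: "finite F" "F \<subseteq> I \<inter> polys_in W0"
      "I \<inter> polys_in W0 \<subseteq> radical_closure {} (polys_in W0) F"
      using insert.IH unfolding topologically_noetherian_def finitely_cut_def by meson
    have F3: "I \<inter> polys_in W0 \<subseteq> radical_closure {} (polys_in ?W) F"
      using F(3) radical_closure_mono[OF order_refl sub radical_closure_gens] by (rule order_trans)
    have coeffs: "b \<in> radical_closure {} (polys_in ?W) F" if "b \<in> I" "\<And>\<alpha>. rcoeff ?R \<alpha> b \<in> I" for b
    proof (rule in_ideal_if_coefficients[OF F3])
      show "b \<in> polys_in ?W" using that(1) IW by blast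
      then show "rcoeff ?R \<alpha> b \<in> I \<inter> polys_in W0" for \<alpha>
        using that(2)[of \<alpha>] rcoeff_in[of b ?W ?R \<alpha>] WR by simp
    qed
    show "finitely_cut {} (polys_in ?W) I \<or> (\<exists>h\<in>polys_in ?W - I. \<exists>F. finite F \<and> F \<subseteq> I \<and>
        (\<forall>b\<in>I. b * h \<in> radical_closure {} (polys_in ?W) F))"
    proof (cases "\<forall>f\<in>I. \<forall>\<alpha>. rcoeff ?R \<alpha> f \<in> I")
      case True
      then have "I \<subseteq> radical_closure {} (polys_in ?W) F" using coeffs by blast
      then have "finitely_cut {} (polys_in ?W) I"
        unfolding finitely_cut_def using F(1,2) by (intro exI[of _ F]) auto
      then show ?thesis ..
    next
      case False
      obtain f D where f: "f \<in> I" "\<And>m. m \<in> keys f \<Longrightarrow> rcoeff ?R (pm_restrict ?R m) f \<notin> I"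
        "deg_lt ?R (Suc D) f" "\<exists>m\<in>keys f. total_deg (pm_restrict ?R m) = D" "D > 0"
        "\<And>g \<alpha>. g \<in> I \<Longrightarrow> deg_lt ?R D g \<Longrightarrow> rcoeff ?R \<alpha> g \<in> I"
        using minimal_degree_element[OF I False] by blast
      define lc where "lc N b = rcoeff ?R (single x N) b" for N and b :: "('v, 'k) sym"
      define h where "h = lc D f"
      have restr: "pm_restrict ?R m = single x (total_deg (pm_restrict ?R m))" for m :: "'v \<Rightarrow>\<^sub>0 nat"
      proof -
        have "pm_restrict ?R m = single x (lookup m x)"
          by (rule poly_mapping_eqI) (auto simp: lookup_pm_restrict lookup_single when_def)
        then show ?thesis by simp
      qed
      have hI: "h \<notin> I" using f(2,4) restr unfolding h_def lc_def by metis
      have lcW: "lc N b \<in> polys_in W0" if "b \<in> I" for N b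
        using rcoeff_in[of b ?W ?R] WR that IW unfolding lc_def by auto
      have hW: "h \<in> polys_in ?W" using lcW[OF f(1)] sub unfolding h_def by blast
      have low: "deg_lt ?R N (b - lc N b * var x ^ N)" if "deg_lt ?R (Suc N) b" for N and b :: "('v, 'k) sym"
      proof -
        have "b - lc N b * var x ^ N = pm_restrict (- {m. pm_restrict ?R m = single x N}) b"
          using pm_restrict_Compl_add[of "{m. pm_restrict ?R m = single x N}" b]
          unfolding lc_def by (simp add: rcoeff_mult_mon flip: mon_single) (metis add_diff_cancel_left')
        then show ?thesis
          using that restr by (fastforce simp: deg_lt_def less_Suc_eq)
      qed
      let ?K = "radical_closure {} (polys_in ?W) (insert f F)"
      have K: "stable_radical_ideal {} (polys_in ?W) ?K"
        using f(1) F IW by (intro stable_radical_ideal_radical_closure) auto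
      have "b * h \<in> ?K" if "b \<in> I" "deg_lt ?R N b" for b N
        using that
      proof (induction N arbitrary: b)
        case 0
        then have "b = 0" by (simp add: deg_lt_def flip: keys_eq_empty) 
        then show ?case using stable_radical_ideal_zero[OF K] by simp
      next
        case (Suc M)
        have bW: "b \<in> polys_in ?W" using Suc.prems IW by blast
        show ?case
        proof (cases "M < D")
          case True
          then have "deg_lt ?R D b" using Suc.prems(2) by (auto simp: deg_lt_def)
          then have "b \<in> radical_closure {} (polys_in ?W) F" using coeffs f(6) Suc.prems(1) by blast
          then have "b \<in> ?K" using radical_closure_mono_gens[of F "insert f F"] by blast
          then show ?thesis using stable_radical_ideal_mult[OF K hW] by (simp add: mult.commute)
        next
          case False
          \<comment> \<open>one step of pseudo-division: the leading terms in \<open>x\<close> cancel\<close>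
          define b' where "b' = h * b - (lc M b * var x ^ (M - D)) * f"
          have cW: "lc M b * var x ^ (M - D) \<in> polys_in ?W"
            using lcW[OF Suc.prems(1)] sub by (intro polys_in_mult polys_in_power) auto
          have "b' \<in> I" unfolding b'_def
            by (intro stable_radical_ideal_diff[OF I] stable_radical_ideal_mult[OF I] hW cW f(1) Suc.prems(1))
          moreover have "deg_lt ?R M b'"
          proof -
            have h1: "deg_lt ?R (Suc 0) h" and l1: "deg_lt ?R (Suc 0) (lc M b)"
              using deg_lt_disjoint[of _ ?W ?R] lcW Suc.prems(1) f(1) unfolding WR h_def by auto
            have x1: "deg_lt ?R (Suc (M - D)) (var x ^ (M - D))"
              by (simp add: deg_lt_def mon_def pm_restrict_id flip: mon_single)
            have "(var x :: ('v, 'k) sym) ^ M = var x ^ (M - D) * var x ^ D" using False by (simp flip: power_add)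
            then have "b' = h * (b - lc M b * var x ^ M) - lc M b * var x ^ (M - D) * (f - h * var x ^ D)"
              unfolding b'_def by (simp add: algebra_simps)
            moreover have "deg_lt ?R (0 + M) (h * (b - lc M b * var x ^ M))"
              by (rule deg_lt_mult[OF h1 low[OF Suc.prems(2)]])
            moreover have "deg_lt ?R (M - D + D) (lc M b * var x ^ (M - D) * (f - h * var x ^ D))"
            proof (rule deg_lt_mult)
              show "deg_lt ?R (Suc (M - D)) (lc M b * var x ^ (M - D))"
                using deg_lt_mult[OF l1 x1] by simp
              show "deg_lt ?R D (f - h * var x ^ D)" unfolding h_def by (rule low[OF f(3)])
            qed
            ultimately show ?thesis using False deg_lt_diff by simp
          qed
          ultimately have "b' * h \<in> ?K" by (rule Suc.IH)
          moreover have "f \<in> ?K" by (rule radical_closure.gen) simp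
          then have "(h * (lc M b * var x ^ (M - D))) * f \<in> ?K"
            by (rule stable_radical_ideal_mult[OF K mult_closed[OF hW cW]])
          ultimately have "b' * h + (h * (lc M b * var x ^ (M - D))) * f \<in> ?K"
            by (rule stable_radical_ideal_add[OF K])
          then have "b * (b' * h + (h * (lc M b * var x ^ (M - D))) * f) \<in> ?K"
            by (rule stable_radical_ideal_mult[OF K bW])
          then have "(b * h) ^ 2 \<in> ?K"
            unfolding b'_def by (simp add: algebra_simps power2_eq_square)
          then show ?thesis by (rule stable_radical_ideal_root[OF K mult_closed[OF bW hW]])
        qed
      qed
      moreover have "\<exists>N. deg_lt ?R N b" for b :: "('v, 'k) sym"
        by (rule exI[of _ "Suc (\<Sum>m\<in>keys b. total_deg (pm_restrict ?R m))"])
          (auto simp: deg_lt_def less_Suc_eq_le intro!: member_le_sum)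
      ultimately have "\<forall>b\<in>I. b * h \<in> ?K" by blast
      moreover have "finite (insert f F)" "insert f F \<subseteq> I" using F f(1) by auto
      ultimately show ?thesis using hI hW by blast
    qed
  qed
qed

section \<open>The action of the general linear group\<close>

lemma monomial_induct [case_names zero add]:
  fixes m :: "'b \<Rightarrow>\<^sub>0 nat"
  assumes "P 0" "\<And>m i. P m \<Longrightarrow> P (m + single i (Suc 0))"
  shows "P m"
proof (induction "total_deg m" arbitrary: m)
  case 0
  then show ?case using assms(1) by simp
next
  case (Suc d)
  then have "m \<noteq> 0" by auto
  then obtain i where i: "lookup m i \<noteq> 0" by (metis poly_mapping_eqI lookup_zero)
  define m' where "m' = m - single i 1"
  have m: "m = m' + single i (Suc 0)"
    using i by (intro poly_mapping_eqI) (auto simp: m'_def lookup_add lookup_minus lookup_single when_def)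
  then have "d = total_deg m'" using Suc.hyps(2) by (simp add: total_deg_add)
  then have "P m'" by (rule Suc.hyps(1))
  then show ?case unfolding m by (rule assms(2))
qed

lemma mon_Suc0: "mon (single v (Suc 0)) = var v"
  by (simp add: var_def)

lemma sym_map_eq_psubst: "sym_map \<phi> = psubst const (\<lambda>i. sym_incl (\<phi> (single i 1)))"
  by (rule ext) (simp add: sym_map_def psubst_def const_def)

lemma sym_incl_superset:
  "finite S \<Longrightarrow> keys v \<subseteq> S \<Longrightarrow> sym_incl v = (\<Sum>i\<in>S. const (lookup v i) * var i)"
proof -
  assume S: "finite S" "keys v \<subseteq> S"
  have "sym_incl v = (\<Sum>i\<in>keys v. const (lookup v i) * var i)"
    by (simp add: sym_incl_def var_def mon_def const_mult_single)
  also have "\<dots> = (\<Sum>i\<in>S. const (lookup v i) * var i)"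
    by (rule sum.mono_neutral_left) (use S in \<open>auto simp: in_keys_iff\<close>)
  finally show ?thesis .
qed

lemma sym_incl_zero [simp]: "sym_incl 0 = 0" by (simp add: sym_incl_def)

lemma sym_incl_single [simp]: "sym_incl (single i c) = const c * var i"
  using sym_incl_superset[of "{i}" "single i c"] by simp

lemma sym_incl_add: "sym_incl (v + w) = sym_incl v + sym_incl w"
  using sym_incl_superset[of "keys v \<union> keys w" v] sym_incl_superset[of "keys v \<union> keys w" w]
    sym_incl_superset[of "keys v \<union> keys w" "v + w"] keys_add[of v w]
  by (simp add: lookup_add distrib_right sum.distrib)

lemma sym_incl_smult: "sym_incl (smult_vec c v) = const c * sym_incl v"
proof -
  have "keys (smult_vec c v) \<subseteq> keys v" by (auto simp: in_keys_iff)
  then show ?thesis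
    using sym_incl_superset[of "keys v" v] sym_incl_superset[of "keys v" "smult_vec c v"]
    by (simp add: sum_distrib_left ac_simps)
qed

lemma sym_incl_sum: "sym_incl (\<Sum>x\<in>S. f x) = (\<Sum>x\<in>S. sym_incl (f x))"
  by (induction S rule: infinite_finite_induct) (simp_all add: sym_incl_add)

lemma keys_sym_incl: "m \<in> keys (sym_incl v) \<Longrightarrow> \<exists>i\<in>keys v. m = single i 1"
  using subsetD[OF keys_sum_subset[of "\<lambda>i. single (single i 1) (lookup v i)" "keys v"], of m]
  by (auto simp: sym_incl_def split: if_splits)

text \<open>The linear equation belonging to an element of $\mathrm{Sym}^3$; components of other degrees are dropped.\<close>

definition lin3 :: "(nat, 'k::field) sym \<Rightarrow> 'k equation"
  where "lin3 p = sym_incl (sym3_proj p)"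

lemma inj_Rep_cubic_monom: "inj Rep_cubic_monom"
  by (meson Rep_cubic_monom_inject injI)

lemma lookup_sym3_proj: "lookup (sym3_proj p) M = lookup p (Rep_cubic_monom M)"
  by (simp add: sym3_proj_def map_key.rep_eq[OF inj_Rep_cubic_monom])

lemma lin3_add: "lin3 (p + q) = lin3 p + lin3 q"
proof -
  have "sym3_proj (p + q) = sym3_proj p + sym3_proj q"
    by (rule poly_mapping_eqI) (simp add: lookup_sym3_proj lookup_add)
  then show ?thesis by (simp add: lin3_def sym_incl_add)
qed

lemma lin3_const_mult: "lin3 (const c * p) = const c * lin3 p"
proof -
  have "sym3_proj (const c * p) = smult_vec c (sym3_proj p)"
    by (rule poly_mapping_eqI) (simp add: lookup_sym3_proj)
  then show ?thesis by (simp add: lin3_def sym_incl_smult)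
qed

lemma lin3_zero [simp]: "lin3 0 = 0"
  using lin3_const_mult[of 0 0] by simp

lemma lin3_sum: "lin3 (\<Sum>x\<in>S. f x) = (\<Sum>x\<in>S. lin3 (f x))"
  by (induction S rule: infinite_finite_induct) (simp_all add: lin3_add)

text \<open>So the variables of the ring of equations are the images of the cubic monomials.\<close>

lemma lin3_mon: "lin3 (mon (Rep_cubic_monom M)) = var M"
proof -
  have "sym3_proj (mon (Rep_cubic_monom M)) = single M (1 :: 'a)"
    by (rule poly_mapping_eqI)
      (auto simp: lookup_sym3_proj mon_def lookup_single when_def Rep_cubic_monom_inject)
  then show ?thesis by (simp add: lin3_def)
qed

lemma lin3_in:
  assumes "\<And>M. Rep_cubic_monom M \<in> keys p \<Longrightarrow> M \<in> W" shows "lin3 p \<in> polys_in W"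
proof -
  have "M \<in> W" if "M \<in> keys (sym3_proj p)" for M
    using that assms by (simp add: in_keys_iff lookup_sym3_proj)
  then show ?thesis
    unfolding lin3_def by (subst sym_incl_superset[OF finite_keys order_refl])
      (auto intro!: polys_in_sum polys_in_mult)
qed

lemma total_deg_Rep_cubic_monom [simp]: "total_deg (Rep_cubic_monom M) = 3"
  using Rep_cubic_monom[of M] by (simp add: total_deg_def)

lemma ex_cubic_monom: "total_deg m = 3 \<Longrightarrow> \<exists>M. m = Rep_cubic_monom M"
  using Rep_cubic_monom_cases[of m] by (auto simp: total_deg_def)

lemma act_eq_psubst:
  "act g = psubst const (\<lambda>M. lin3 (sym_map g (mon (Rep_cubic_monom M))))"
proof -
  have "sym3_incl (single M (1 :: 'a)) = mon (Rep_cubic_monom M)" for M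
    by (simp add: sym3_incl_def mon_def)
  then show ?thesis
    by (simp add: act_def sym_map_eq_psubst[of "sym3_map g"] sym3_map_def lin3_def)
qed

lemma act_var: "act g (var M) = lin3 (sym_map g (mon (Rep_cubic_monom M)))"
  by (simp add: act_eq_psubst)

lemma act_mult: "act g (p * q) = act g p * act g q"
  and act_add: "act g (p + q) = act g p + act g q"
  and act_zero: "act g 0 = 0" and act_one: "act g 1 = 1" and act_const: "act g (const c) = const c"
  and act_power: "act g (p ^ n) = act g p ^ n"
  by (simp_all add: act_eq_psubst const.psubst_mult const.psubst_add const.psubst_power)

lemma sym_map_mult: "sym_map g (p * q) = sym_map g p * sym_map g q"
  and sym_map_add: "sym_map g (p + q) = sym_map g p + sym_map g q"
  and sym_map_zero: "sym_map g 0 = 0" and sym_map_one: "sym_map g 1 = 1"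
  and sym_map_const: "sym_map g (const c) = const c"
  and sym_map_var: "sym_map g (var i) = sym_incl (g (single i 1))"
  and sym_map_sum: "sym_map g (\<Sum>x\<in>S. f x) = (\<Sum>x\<in>S. sym_map g (f x))"
  by (simp_all add: sym_map_eq_psubst const.psubst_mult const.psubst_add const.psubst_sum)

abbreviation "vlinear \<equiv> Vector_Spaces.linear smult_vec smult_vec"

lemma vlinearD:
  assumes "vlinear g"
  shows vlinear_add: "g (v + w) = g v + g w" and vlinear_smult: "g (smult_vec c v) = smult_vec c (g v)"
proof -
  interpret Vector_Spaces.linear smult_vec smult_vec g by fact
  show "g (v + w) = g v + g w" by (rule add)
  show "g (smult_vec c v) = smult_vec c (g v)" by (rule scale)
qed

lemma vlinearI:
  assumes "\<And>v w. g (v + w) = g v + g w" "\<And>c v. g (smult_vec c v) = smult_vec c (g v)"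
  shows "vlinear g"
proof -
  interpret V: vector_space smult_vec by (rule vector_space_smult_vec)
  show ?thesis by unfold_locales (rule assms)+
qed

lemma smult_vec_0 [simp]: "smult_vec 0 v = 0"
  by (rule poly_mapping_eqI) simp

lemma vlinear_sum:
  assumes "vlinear g" shows "g (\<Sum>x\<in>S. f x) = (\<Sum>x\<in>S. g (f x))"
proof -
  have "g 0 = 0" using vlinear_smult[OF assms, of 0 0] by simp
  then show ?thesis
    by (induction S rule: infinite_finite_induct) (simp_all add: vlinear_add[OF assms])
qed

lemma smult_single: "smult_vec c (single i d) = single i (c * d)"
  by (rule poly_mapping_eqI) (simp add: lookup_single when_def)

lemma sym_map_sym_incl:
  assumes "vlinear g" shows "sym_map g (sym_incl v) = sym_incl (g v)"
proof -
  have v: "v = (\<Sum>i\<in>keys v. smult_vec (lookup v i) (single i 1))"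
    by (simp add: smult_single sum_lookup_single)
  have "sym_map g (sym_incl v) = (\<Sum>i\<in>keys v. sym_incl (g (smult_vec (lookup v i) (single i 1))))"
    by (subst v) (simp add: sym_incl_sum sym_map_sum sym_incl_smult sym_map_mult sym_map_const sym_map_var
        vlinear_smult[OF assms])
  also have "\<dots> = sym_incl (g v)"
    by (subst (3) v) (simp add: vlinear_sum[OF assms] sym_incl_sum)
  finally show ?thesis .
qed

lemma sym_map_comp:
  assumes "vlinear g" shows "sym_map g (sym_map g' p) = sym_map (g \<circ> g') p"
proof -
  have "sym_map g (psubst const (\<lambda>i. sym_incl (g' (single i 1))) p)
      = psubst (\<lambda>c. sym_map g (const c)) (\<lambda>i. sym_map g (sym_incl (g' (single i 1)))) p"
    by (rule psubst_compose) (simp_all add: sym_map_zero sym_map_one sym_map_add sym_map_mult)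
  also have "\<dots> = psubst const (\<lambda>i. sym_incl (g (g' (single i 1)))) p"
    by (simp add: sym_map_const sym_map_sym_incl[OF assms])
  finally show ?thesis by (simp add: sym_map_eq_psubst)
qed

definition homogeneous :: "nat \<Rightarrow> ('v, 'k::field) sym \<Rightarrow> bool"
  where "homogeneous d p \<longleftrightarrow> (\<forall>m\<in>keys p. total_deg m = d)"

lemma homogeneous_sym_map: "homogeneous (total_deg m) (sym_map g (mon m))"
proof (induction m rule: monomial_induct)
  case zero
  then show ?case by (simp add: sym_map_one homogeneous_def)
next
  case (add m i)
  show ?case unfolding homogeneous_def
  proof
    fix \<mu> assume "\<mu> \<in> keys (sym_map g (mon (m + single i (Suc 0))))"
    then have "\<mu> \<in> keys (sym_map g (mon m) * sym_incl (g (single i 1)))"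
      by (simp add: mon_add sym_map_mult sym_map_var mon_Suc0)
    then obtain \<mu>1 \<mu>2 where "\<mu> = \<mu>1 + \<mu>2" "\<mu>1 \<in> keys (sym_map g (mon m))" "\<mu>2 \<in> keys (sym_incl (g (single i 1)))"
      using keys_mult by blast
    moreover from this obtain j where "\<mu>2 = single j 1" using keys_sym_incl by blast
    ultimately show "total_deg \<mu> = total_deg (m + single i (Suc 0))"
      using add by (simp add: homogeneous_def total_deg_add)
  qed
qed

text \<open>On linear equations the action is $\mathrm{Sym}^3(g)$. Homogeneity matters because \<open>lin3\<close> forgets
  the other components.\<close>

lemma act_lin3:
  assumes "homogeneous 3 p" shows "act g (lin3 p) = lin3 (sym_map g p)"
proof -
  have "act g (\<Sum>x\<in>S. f x) = (\<Sum>x\<in>S. act g (f x))" for S :: "(nat \<Rightarrow>\<^sub>0 nat) set" and f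
    by (induction S rule: infinite_finite_induct) (simp_all add: act_add act_zero)
  then have "act g (lin3 (\<Sum>m\<in>keys p. const (lookup p m) * mon m))
      = (\<Sum>m\<in>keys p. const (lookup p m) * act g (lin3 (mon m)))"
    by (simp add: lin3_sum lin3_const_mult act_mult act_const)
  also have "\<dots> = (\<Sum>m\<in>keys p. const (lookup p m) * lin3 (sym_map g (mon m)))"
  proof (rule sum.cong)
    fix m assume "m \<in> keys p"
    then obtain M where "m = Rep_cubic_monom M" using assms ex_cubic_monom by (auto simp: homogeneous_def)
    then show "const (lookup p m) * act g (lin3 (mon m)) = const (lookup p m) * lin3 (sym_map g (mon m))"
      by (simp add: lin3_mon act_var)
  qed simp
  also have "\<dots> = lin3 (sym_map g (\<Sum>m\<in>keys p. const (lookup p m) * mon m))"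
    by (simp add: sym_map_sum sym_map_mult sym_map_const lin3_sum lin3_const_mult)
  finally show ?thesis by (simp only: sum_const_mon)
qed

lemma act_comp:
  assumes "vlinear g" shows "act g (act g' p) = act (g \<circ> g') p"
proof -
  have "act g (psubst const (\<lambda>M. lin3 (sym_map g' (mon (Rep_cubic_monom M)))) p)
      = psubst (\<lambda>c. act g (const c)) (\<lambda>M. act g (lin3 (sym_map g' (mon (Rep_cubic_monom M))))) p"
    by (rule psubst_compose) (simp_all add: act_zero act_one act_add act_mult)
  also have "\<dots> = psubst const (\<lambda>M. lin3 (sym_map (g \<circ> g') (mon (Rep_cubic_monom M)))) p"
  proof -
    have "homogeneous 3 (sym_map g' (mon (Rep_cubic_monom M)))" for M
      using homogeneous_sym_map[of "Rep_cubic_monom M" g'] by simp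
    then show ?thesis by (simp add: act_const act_lin3 sym_map_comp[OF assms])
  qed
  finally show ?thesis by (simp add: act_eq_psubst)
qed

lemma act_id: "act id p = (p :: 'k::field equation)"
proof -
  have "sym_map id q = q" for q :: "(nat, 'k) sym" by (simp add: sym_map_eq_psubst psubst_const_var)
  then show ?thesis by (simp add: act_eq_psubst lin3_mon psubst_const_var)
qed

definition block :: "nat \<Rightarrow> ((nat \<Rightarrow>\<^sub>0 'k::field) \<Rightarrow> (nat \<Rightarrow>\<^sub>0 'k)) \<Rightarrow> bool"
  where "block n g \<longleftrightarrow> (\<forall>i<n. g (single i 1) = single i 1) \<and> (\<forall>j\<ge>n. \<forall>i<n. lookup (g (single j 1)) i = 0)"

text \<open>The inverse is required to be of the same block shape, which makes closure under inverses immediate.\<close>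

definition GL_block :: "nat \<Rightarrow> ((nat \<Rightarrow>\<^sub>0 'k::field) \<Rightarrow> (nat \<Rightarrow>\<^sub>0 'k)) set"
  where "GL_block n = {g. vlinear g \<and> block n g \<and>
    (\<exists>g'. vlinear g' \<and> block n g' \<and> g \<circ> g' = id \<and> g' \<circ> g = id)}"

lemma GL_block_subset_GL_infty: "GL_block n \<subseteq> GL_infty"
  by (auto simp: GL_block_def GL_infty_def intro: o_bij)

lemma GL_block_inverse: "g \<in> GL_block n \<Longrightarrow> \<exists>g'\<in>GL_block n. g \<circ> g' = id \<and> g' \<circ> g = id"
  by (auto simp: GL_block_def)

lemma GL_block_antimono:
  assumes "n \<le> n'" shows "GL_block n' \<subseteq> GL_block n"
proof -
  have "block n g" if g: "block n' g" for g :: "(nat \<Rightarrow>\<^sub>0 'a) \<Rightarrow> _"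
    unfolding block_def
  proof (intro conjI allI impI)
    fix j i assume "n \<le> j" "i < n"
    then show "lookup (g (single j 1)) i = 0"
      using g assms by (cases "j < n'") (auto simp: block_def lookup_single)
  qed (use g assms in \<open>auto simp: block_def\<close>)
  then show ?thesis by (auto simp: GL_block_def)
qed

lemma GL_block_0_comp: "g \<in> GL_block 0 \<Longrightarrow> g' \<in> GL_block 0 \<Longrightarrow> g \<circ> g' \<in> GL_block 0"
proof -
  have lin: "vlinear (f \<circ> f')" if "vlinear f" "vlinear f'" for f f' :: "(nat \<Rightarrow>\<^sub>0 'a) \<Rightarrow> (nat \<Rightarrow>\<^sub>0 'a)"
    by (rule vlinearI) (simp_all add: vlinear_add[OF that(1)] vlinear_add[OF that(2)]
        vlinear_smult[OF that(1)] vlinear_smult[OF that(2)])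
  assume "g \<in> GL_block 0" "g' \<in> GL_block 0"
  then obtain h h' where "vlinear g" "vlinear g'" "vlinear h" "vlinear h'"
    and inv: "g \<circ> h = id" "h \<circ> g = id" "g' \<circ> h' = id" "h' \<circ> g' = id"
    by (auto simp: GL_block_def)
  moreover have "(g \<circ> g') \<circ> (h' \<circ> h) = id" "(h' \<circ> h) \<circ> (g \<circ> g') = id"
    using inv by (simp_all add: fun_eq_iff)
  ultimately show ?thesis
    by (auto simp: GL_block_def block_def intro!: lin exI[of _ "h' \<circ> h"])
qed

abbreviation "front n m \<equiv> pm_restrict {..<n} (m :: nat \<Rightarrow>\<^sub>0 nat)"

text \<open>The coordinates on a sum of symmetric powers of the span of the basis vectors from \<open>n\<close> on, one
  summand of degree \<open>3 - deg l\<close> for each front \<open>l\<close>.\<close>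

definition vars_with_front :: "nat \<Rightarrow> (nat \<Rightarrow>\<^sub>0 nat) set \<Rightarrow> cubic_monom set"
  where "vars_with_front n L = {M. front n (Rep_cubic_monom M) \<in> L}"

text \<open>Each factor of the monomial is either one of the fixed basis vectors or is replaced by a combination of
  basis vectors that do not contribute to the front.\<close>

lemma front_sym_map:
  assumes "block n g" "\<mu> \<in> keys (sym_map g (mon m))" shows "front n \<mu> = front n m"
  using assms(2)
proof (induction m arbitrary: \<mu> rule: monomial_induct)
  case zero
  then show ?case by (simp add: sym_map_one)
next
  case (add m i)
  then have "\<mu> \<in> keys (sym_map g (mon m) * sym_incl (g (single i 1)))"
    by (simp add: mon_add sym_map_mult sym_map_var mon_Suc0)
  then obtain \<mu>1 \<mu>2 where \<mu>: "\<mu> = \<mu>1 + \<mu>2" "\<mu>1 \<in> keys (sym_map g (mon m))"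
    "\<mu>2 \<in> keys (sym_incl (g (single i 1)))"
    using keys_mult by blast
  obtain j where j: "j \<in> keys (g (single i 1))" "\<mu>2 = single j 1"
    using keys_sym_incl[OF \<mu>(3)] by auto
  have "front n (single j 1) = front n (single i 1)"
  proof (cases "i < n")
    case True
    then have "g (single i 1) = single i 1" using assms(1) by (simp add: block_def)
    then show ?thesis using j(1) by simp
  next
    case False
    then have "\<not> j < n" using assms(1) j(1) by (auto simp: block_def in_keys_iff)
    then show ?thesis using False by (simp add: pm_restrict_eq_0)
  qed
  then show ?case using \<mu> j add.IH by (simp add: pm_restrict_add)
qed

lemma act_in_vars_with_front:
  assumes "block n g" "p \<in> polys_in (vars_with_front n L)"
  shows "act g p \<in> polys_in (vars_with_front n L)"
  unfolding act_eq_psubst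
  by (rule polys_in_psubst[OF assms(2)], rule lin3_in)
    (auto simp: vars_with_front_def dest: front_sym_map[OF assms(1)])

lemma acted_ring_GL_block: "acted_ring (act ` GL_block n) (polys_in (vars_with_front n L))"
proof
  fix g :: "'a equation \<Rightarrow> 'a equation" assume "g \<in> act ` GL_block n"
  then obtain g0 where g0: "g0 \<in> GL_block n" "g = act g0" by auto
  show "g x \<in> polys_in (vars_with_front n L)" if "x \<in> polys_in (vars_with_front n L)" for x
    using g0 that by (auto simp: GL_block_def intro: act_in_vars_with_front)
  show "g (x * y) = g x * g y" for x y using g0 by (simp add: act_mult)
  obtain g0' where g0': "g0' \<in> GL_block n" "g0 \<circ> g0' = id" using GL_block_inverse[OF g0(1)] by blast
  have "vlinear g0" using g0(1) by (simp add: GL_block_def)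
  then have "act g0 (act g0' x) = x" for x by (simp add: act_comp g0'(2) act_id)
  then show "\<exists>g'\<in>act ` GL_block n. \<forall>x\<in>polys_in (vars_with_front n L). g (g' x) = x"
    using g0(2) g0'(1) by blast
qed (auto intro: polys_in_add polys_in_mult)

section \<open>One-parameter families of shears\<close>

definition pairing :: "(nat \<Rightarrow> 'k) \<Rightarrow> (nat \<Rightarrow>\<^sub>0 'k::field) \<Rightarrow> 'k"
  where "pairing a v = (\<Sum>i\<in>keys v. a i * lookup v i)"

lemma pairing_superset: "finite S \<Longrightarrow> keys v \<subseteq> S \<Longrightarrow> pairing a v = (\<Sum>i\<in>S. a i * lookup v i)"
  unfolding pairing_def by (rule sum.mono_neutral_left) (auto simp: in_keys_iff)

lemma pairing_add: "pairing a (v + w) = pairing a v + pairing a w"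
  using pairing_superset[of "keys v \<union> keys w" v a] pairing_superset[of "keys v \<union> keys w" w a]
    pairing_superset[of "keys v \<union> keys w" "v + w" a] keys_add[of v w]
  by (simp add: lookup_add distrib_left sum.distrib)

lemma pairing_smult: "pairing a (smult_vec c v) = c * pairing a v"
proof -
  have "keys (smult_vec c v) \<subseteq> keys v" by (auto simp: in_keys_iff)
  then show ?thesis
    using pairing_superset[of "keys v" "smult_vec c v" a]
    by (simp add: pairing_def[of a v] sum_distrib_left ac_simps)
qed

lemma pairing_single [simp]: "pairing a (single i c) = a i * c"
  using pairing_superset[of "{i}" "single i c" a] by simp

text \<open>The substitution $e_i \mapsto e_i + c\,a_i\,\ell$; it is a one-parameter group in \<open>c\<close> when the pairing of
  \<open>a\<close> and \<open>l\<close> vanishes.\<close>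

definition shear :: "(nat \<Rightarrow> 'k) \<Rightarrow> (nat \<Rightarrow>\<^sub>0 'k::field) \<Rightarrow> 'k \<Rightarrow> (nat \<Rightarrow>\<^sub>0 'k) \<Rightarrow> (nat \<Rightarrow>\<^sub>0 'k)"
  where "shear a l c v = v + smult_vec (c * pairing a v) l"

lemma vlinear_shear: "vlinear (shear a l c)"
  by (rule vlinearI; rule poly_mapping_eqI)
    (simp_all add: shear_def pairing_add pairing_smult lookup_add algebra_simps)

lemma shear_comp:
  assumes "pairing a l = 0" shows "shear a l c \<circ> shear a l c' = shear a l (c + c')"
  by (rule ext, rule poly_mapping_eqI)
    (simp add: shear_def pairing_add pairing_smult assms lookup_add algebra_simps)

lemma shear_0: "shear a l 0 = id"
  by (rule ext, rule poly_mapping_eqI) (simp add: shear_def lookup_add)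

lemma shear_GL_block:
  assumes a: "\<And>i. i < n \<or> i \<ge> n' \<Longrightarrow> a i = 0" and l: "keys l \<subseteq> {n'..}" and n: "n \<le> n'"
  shows "shear a l c \<in> GL_block n"
proof -
  have "pairing a l = 0" unfolding pairing_def using a l by (intro sum.neutral) auto
  then have inv: "shear a l c \<circ> shear a l (- c) = id" "shear a l (- c) \<circ> shear a l c = id"
    by (simp_all add: shear_comp shear_0)
  have "lookup l i = 0" if "i < n" for i using l n that by (auto simp: in_keys_iff)
  then have "block n (shear a l c)" for c
    unfolding block_def using a
    by (auto simp: shear_def lookup_add lookup_single intro!: poly_mapping_eqI)
  then show ?thesis using inv vlinear_shear by (auto simp: GL_block_def intro!: exI[of _ "shear a l (- c)"])
qed

lemma scalar_hom_poly: "scalar_hom (\<lambda>c. [:const c:])" by unfold_locales simp_all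

interpretation cpoly: scalar_hom "\<lambda>c. [:const c:]" by (rule scalar_hom_poly)

text \<open>The shear with an indeterminate in place of \<open>c\<close>, on the symmetric algebra and on equations.\<close>

definition shear_sym :: "(nat \<Rightarrow> 'k) \<Rightarrow> (nat \<Rightarrow>\<^sub>0 'k::field) \<Rightarrow> (nat, 'k) sym \<Rightarrow> (nat, 'k) sym poly"
  where "shear_sym a l = psubst (\<lambda>c. [:const c:]) (\<lambda>i. [:var i, const (a i) * sym_incl l:])"

definition shear_eqn :: "(nat \<Rightarrow> 'k) \<Rightarrow> (nat \<Rightarrow>\<^sub>0 'k::field) \<Rightarrow> 'k equation \<Rightarrow> 'k equation poly"
  where "shear_eqn a l =
    psubst (\<lambda>c. [:const c:]) (\<lambda>M. map_poly lin3 (shear_sym a l (mon (Rep_cubic_monom M))))"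

lemma poly_shear_sym: "poly (shear_sym a l p) (const c) = sym_map (shear a l c) p"
proof -
  have "poly (shear_sym a l p) (const c)
      = psubst (\<lambda>d. poly [:const d:] (const c)) (\<lambda>i. poly [:var i, const (a i) * sym_incl l:] (const c)) p"
    unfolding shear_sym_def by (rule psubst_compose[where \<theta> = "\<lambda>q. poly q (const c)"]) simp_all
  also have "\<dots> = sym_map (shear a l c) p"
    by (simp add: sym_map_eq_psubst shear_def sym_incl_add sym_incl_smult mult.assoc)
  finally show ?thesis .
qed

lemma poly_map_poly_lin3: "poly (map_poly lin3 P) (const c) = lin3 (poly P (const c))"
  by (induction P) (simp_all add: map_poly_pCons lin3_add lin3_const_mult)

lemma poly_shear_eqn: "poly (shear_eqn a l f) (const c) = act (shear a l c) f"
proof -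
  have "poly (shear_eqn a l f) (const c)
      = psubst (\<lambda>d. poly [:const d:] (const c))
          (\<lambda>M. poly (map_poly lin3 (shear_sym a l (mon (Rep_cubic_monom M)))) (const c)) f"
    unfolding shear_eqn_def by (rule psubst_compose[where \<theta> = "\<lambda>q. poly q (const c)"]) simp_all
  also have "\<dots> = act (shear a l c) f"
    by (simp add: poly_map_poly_lin3 poly_shear_sym act_eq_psubst)
  finally show ?thesis .
qed

lemma shear_sym_step:
  "shear_sym a l (mon m * var i) = shear_sym a l (mon m) * [:var i, const (a i) * sym_incl l:]"
  by (simp add: shear_sym_def mon_add cpoly.psubst_mult mon_Suc0)

lemma coeff_shear_sym_step:
  "coeff (shear_sym a l (mon m * var i)) j = coeff (shear_sym a l (mon m)) j * var i
    + (case j of 0 \<Rightarrow> 0 | Suc j' \<Rightarrow> coeff (shear_sym a l (mon m)) j' * (const (a i) * sym_incl l))"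
proof -
  have "shear_sym a l (mon m) * [:var i, const (a i) * sym_incl l:]
      = smult (var i) (shear_sym a l (mon m))
        + pCons 0 (smult (const (a i) * sym_incl l) (shear_sym a l (mon m)))"
    by (simp add: mult.commute[of "shear_sym a l (mon m)"])
  then show ?thesis unfolding shear_sym_step
    by (simp add: coeff_pCons ac_simps split: nat.split)
qed

lemma shear_sym_one [simp]: "shear_sym a l 1 = 1" by (simp add: shear_sym_def)

text \<open>Each power of the indeterminate comes with one factor $\ell$, which contributes one index from \<open>n'\<close> on.\<close>

lemma keys_coeff_shear_sym:
  assumes l: "keys l \<subseteq> {n'..}" and n: "n \<le> n'" and a: "\<And>i. i < n \<Longrightarrow> a i = 0"
    and m: "keys m \<subseteq> {..<n'}" and \<mu>: "\<mu> \<in> keys (coeff (shear_sym a l (mon m)) j)"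
  shows "front n \<mu> = front n m \<and> total_deg (pm_restrict {n'..} \<mu>) = j"
  using m \<mu>
proof (induction m arbitrary: \<mu> j rule: monomial_induct)
  case zero
  then have "j = 0" "\<mu> = 0" by (auto simp: of_bool_def split: if_splits)
  then show ?case by (simp add: pm_restrict_eq_0)
next
  case (add m i)
  have m: "keys m \<subseteq> {..<n'}" and i: "i < n'" using add.prems(1) by auto
  let ?c = "\<lambda>j. coeff (shear_sym a l (mon m)) j"
  from add.prems(2)[unfolded mon_add mon_Suc0 coeff_shear_sym_step]
  consider "\<mu> \<in> keys (?c j * var i)"
    | j' where "j = Suc j'" "\<mu> \<in> keys (?c j' * (const (a i) * sym_incl l))"
    using keys_add by (fastforce split: nat.splits)
  then show ?case
  proof cases
    case 1
    then obtain \<mu>1 where "\<mu>1 \<in> keys (?c j)" "\<mu> = \<mu>1 + single i 1"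
      using keys_mult[of "?c j" "var i"] by (auto simp: var_def mon_def)
    with add.IH[OF m] i show ?thesis by (auto simp: pm_restrict_add pm_restrict_eq_0)
  next
    case 2
    then obtain \<mu>1 \<mu>2 where \<mu>: "\<mu>1 \<in> keys (?c j')" "\<mu> = \<mu>1 + \<mu>2" "\<mu>2 \<in> keys (const (a i) * sym_incl l)"
      using keys_mult by blast
    then have "a i \<noteq> 0" by auto
    then have "\<not> i < n" using a by auto
    moreover have "\<mu>2 \<in> keys (sym_incl l)" using \<mu>(3) keys_const_mult by blast
    then obtain k where "k \<in> keys l" "\<mu>2 = single k 1" using keys_sym_incl by blast
    moreover from this have "k \<ge> n'" "\<not> k < n" using l n by auto
    ultimately show ?thesis using add.IH[OF m \<mu>(1)] \<mu>(2) 2(1)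
      by (auto simp: pm_restrict_add pm_restrict_eq_0 pm_restrict_id total_deg_add)
  qed
qed

lemma coeff_0_shear_sym: "coeff (shear_sym a l (mon m)) 0 = mon m"
  by (induction m rule: monomial_induct) (simp_all add: coeff_shear_sym_step mon_add mon_Suc0)

definition weight :: "(nat \<Rightarrow> 'k::field) \<Rightarrow> (nat \<Rightarrow>\<^sub>0 nat) \<Rightarrow> 'k"
  where "weight a m = (\<Prod>i\<in>keys m. a i ^ lookup m i)"

lemma weight_add_single: "weight a (m + single i (Suc 0)) = weight a m * a i"
proof -
  interpret scalar_hom "\<lambda>c::'a. c" by unfold_locales auto
  have "weight a (m + single i (Suc 0)) = weight a m * weight a (single i 1)"
    using prod_monomial_add[of a m "single i 1"] by (simp add: weight_def)
  then show ?thesis by (simp add: weight_def)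
qed

text \<open>In the highest power of the indeterminate all factors outside the front have been replaced by
  $\ell$; the scalar is the product of the corresponding \<open>a i\<close>.\<close>

lemma top_coeff_shear_sym:
  assumes a: "\<And>i. i < n \<Longrightarrow> a i = 0"
  shows "coeff (shear_sym a l (mon m)) (total_deg (pm_restrict {n..} m))
      = const (weight a (pm_restrict {n..} m)) * (mon (front n m) * sym_incl l ^ total_deg (pm_restrict {n..} m))
    \<and> (\<forall>j > total_deg (pm_restrict {n..} m). coeff (shear_sym a l (mon m)) j = 0)"
proof (induction m rule: monomial_induct)
  case zero
  then show ?case by (simp add: pm_restrict_eq_0 weight_def)
next
  case (add m i)
  show ?case
  proof (cases "i < n")
    case True
    then have "pm_restrict {n..} (m + single i (Suc 0)) = pm_restrict {n..} m"
      "front n (m + single i (Suc 0)) = front n m + single i (Suc 0)"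
      by (simp_all add: pm_restrict_add pm_restrict_eq_0 pm_restrict_id)
    then show ?thesis using add.IH a[OF True]
      by (auto simp: coeff_shear_sym_step mon_add mult_ac mon_Suc0 split: nat.split)
  next
    case False
    then have "pm_restrict {n..} (m + single i (Suc 0)) = pm_restrict {n..} m + single i (Suc 0)"
      "front n (m + single i (Suc 0)) = front n m"
      by (simp_all add: pm_restrict_add pm_restrict_eq_0 pm_restrict_id)
    then show ?thesis using add.IH
      by (auto simp: coeff_shear_sym_step mon_add mon_Suc0 weight_add_single total_deg_add mult_ac split: nat.split)
  qed
qed

text \<open>Exponents in a cubic monomial are at most 3, so base 4 separates cubic monomials.\<close>

lemma base_4_inject:
  fixes u v :: "nat \<Rightarrow> nat"
  assumes "(\<Sum>i<N. u i * 4 ^ i) = (\<Sum>i<N. v i * 4 ^ i)" "\<And>i. u i < 4" "\<And>i. v i < 4" "i < N"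
  shows "u i = v i"
  using assms
proof (induction N arbitrary: u v i)
  case (Suc N)
  have split: "(\<Sum>i<Suc N. w i * 4 ^ i) = w 0 + 4 * (\<Sum>i<N. w (Suc i) * 4 ^ i)" for w :: "nat \<Rightarrow> nat"
    by (subst sum.lessThan_Suc_shift) (simp add: sum_distrib_left ac_simps)
  let ?U = "\<Sum>i<N. u (Suc i) * 4 ^ i" and ?V = "\<Sum>i<N. v (Suc i) * 4 ^ i"
  have "u 0 + 4 * ?U = v 0 + 4 * ?V" using Suc.prems(1) by (simp only: split)
  moreover have "u 0 < 4" "v 0 < 4" using Suc.prems by auto
  ultimately have "u 0 = v 0" "?U = ?V" by presburger+
  then show ?case using Suc.IH[of "\<lambda>i. u (Suc i)" "\<lambda>i. v (Suc i)"] Suc.prems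
    by (cases i) auto
qed simp

section \<open>The relation obtained from an equation\<close>

lemma front_front: "n \<le> n' \<Longrightarrow> front n (front n' m) = front n m"
  by (simp add: pm_restrict_restrict Int_absorb2 flip: lessThan_subset_iff)

lemma total_deg_front_add: "total_deg (front n m) + total_deg (pm_restrict {n..} m) = total_deg m"
proof -
  have "- {..<n} = {n..}" by auto
  then show ?thesis using pm_restrict_Compl_add[of "{..<n}" m] by (simp flip: total_deg_add)
qed

lemma front_add_tail: "front n m + pm_restrict {n..} m = m"
proof -
  have "- {..<n} = {n..}" by auto
  then show ?thesis using pm_restrict_Compl_add[of "{..<n}" m] by simp
qed

lemma coeff_poly_power_in:
  assumes "\<And>j. coeff P j \<in> polys_in W" shows "coeff (P ^ k) j \<in> polys_in W"
proof (induction k arbitrary: j)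
  case 0
  then show ?case by (simp add: of_bool_def)
next
  case (Suc k)
  then show ?case using assms by (auto simp: coeff_mult intro!: polys_in_sum polys_in_mult)
qed

text \<open>The data of one induction step: fronts \<open>L\<close> at level \<open>n\<close>, a front \<open>l0\<close> whose summand has positive
  degree \<open>d\<close>, a level \<open>n'\<close> that will exceed all indices of a chosen equation, and the exponent \<open>q\<close>.
  The parameter \<open>field_type\<close> only ties the characteristic in the last assumption to the field. Below,
  \<open>W\<close> is the set of all variables, \<open>R\<close> those of the chosen summand, \<open>U\<close> those with indices below \<open>n'\<close>,
  and \<open>W'\<close> those that remain once the summand of \<open>l0\<close> at level \<open>n'\<close> is dropped.\<close>

locale shear_setting =
  fixes n n' :: nat and L :: "(nat \<Rightarrow>\<^sub>0 nat) set" and l0 :: "nat \<Rightarrow>\<^sub>0 nat" and d q :: nat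
    and field_type :: "'k::field itself"
  assumes n: "n \<le> n'"
    and front_L: "\<And>l. l \<in> L \<Longrightarrow> keys l \<subseteq> {..<n}" and l0: "l0 \<in> L"
    and d: "total_deg l0 + d = 3" "d > 0" and q: "frob_exponent CHAR('k) q"
begin

definition W where "W = vars_with_front n L"
definition R where "R = {M. front n (Rep_cubic_monom M) = l0}"
definition W' where "W' = {M \<in> W. front n' (Rep_cubic_monom M) \<noteq> l0}"
definition U where "U = {M \<in> W. keys (Rep_cubic_monom M) \<subseteq> {..<n'}}"
abbreviation B :: "'k equation set" where "B \<equiv> polys_in W'"

lemma q_pos: "q > 0" using q by (simp add: frob_exponent_def)

lemma front_l0: "front n l0 = l0" by (rule pm_restrict_id[OF front_L[OF l0]])

text \<open>A cubic monomial with all indices below \<open>n'\<close> is its own front, of degree 3, whereas \<open>l0\<close> has smaller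
  degree.\<close>

lemma U_subset: "U \<subseteq> W'"
proof
  fix M assume M: "M \<in> U"
  then have "front n' (Rep_cubic_monom M) = Rep_cubic_monom M" by (simp add: U_def pm_restrict_id)
  then have "front n' (Rep_cubic_monom M) \<noteq> l0" using d by (metis add_cancel_right_right less_numeral_extra(3) total_deg_Rep_cubic_monom)
  then show "M \<in> W'" using M by (simp add: U_def W'_def)
qed

lemma W'_subset: "W' \<subseteq> W" by (auto simp: W'_def)

lemma B_subset: "B \<subseteq> polys_in W" by (rule polys_in_mono[OF W'_subset])

lemma total_deg_tail: "M \<in> R \<Longrightarrow> total_deg (pm_restrict {n..} (Rep_cubic_monom M)) = d"
  using total_deg_front_add[of n "Rep_cubic_monom M"] d by (simp add: R_def)

end

locale shear_family = shear_setting n n' L l0 d q "TYPE('k::field)" for n n' L l0 d q +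
  fixes a :: "nat \<Rightarrow> 'k::field" and l :: "nat \<Rightarrow>\<^sub>0 'k"
  assumes a: "\<And>i. i < n \<or> i \<ge> n' \<Longrightarrow> a i = 0" and l: "keys l \<subseteq> {n'..}"
begin

abbreviation \<Phi> where "\<Phi> \<equiv> shear_eqn a l"
definition top_form where "top_form = lin3 (mon l0 * sym_incl l ^ d)"
definition \<omega> where "\<omega> M = weight a (pm_restrict {n..} (Rep_cubic_monom M))"

lemma \<Phi>_var: "\<Phi> (var M) = map_poly lin3 (shear_sym a l (mon (Rep_cubic_monom M)))"
  by (simp add: shear_eqn_def)

lemma \<Phi>_mult: "\<Phi> (f * g) = \<Phi> f * \<Phi> g" and \<Phi>_add: "\<Phi> (f + g) = \<Phi> f + \<Phi> g"
  and \<Phi>_const: "\<Phi> (const c) = [:const c:]" and \<Phi>_power: "\<Phi> (f ^ k) = \<Phi> f ^ k"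
  by (simp_all add: shear_eqn_def cpoly.psubst_mult cpoly.psubst_add cpoly.psubst_power)

lemma coeff_\<Phi>_var: "coeff (\<Phi> (var M)) j = lin3 (coeff (shear_sym a l (mon (Rep_cubic_monom M))) j)"
  by (simp add: \<Phi>_var coeff_map_poly)

lemma coeff_0_\<Phi>_var: "coeff (\<Phi> (var M)) 0 = var M"
  by (simp add: coeff_\<Phi>_var coeff_0_shear_sym lin3_mon)

text \<open>The front \<open>l0\<close> at level \<open>n'\<close> can appear only if the front at level \<open>n\<close> was already \<open>l0\<close> and all other
  \<open>d\<close> factors have been replaced by $\ell$.\<close>

lemma coeff_\<Phi>_var_in:
  assumes M: "M \<in> U" and j: "M \<notin> R \<or> j < d"
  shows "coeff (\<Phi> (var M)) j \<in> B"
  unfolding coeff_\<Phi>_var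
proof (rule lin3_in)
  fix M' assume M': "Rep_cubic_monom M' \<in> keys (coeff (shear_sym a l (mon (Rep_cubic_monom M))) j)"
  have "keys (Rep_cubic_monom M) \<subseteq> {..<n'}" using M by (simp add: U_def)
  then have fr: "front n (Rep_cubic_monom M') = front n (Rep_cubic_monom M)"
    and wd: "total_deg (pm_restrict {n'..} (Rep_cubic_monom M')) = j"
    using keys_coeff_shear_sym[OF l n _ _ M'] a by blast+
  have "M' \<in> W" using M fr by (simp add: U_def W_def vars_with_front_def)
  moreover have "front n' (Rep_cubic_monom M') \<noteq> l0"
  proof
    assume eq: "front n' (Rep_cubic_monom M') = l0"
    then have "front n (Rep_cubic_monom M') = l0" using front_front[OF n] front_l0 by metis
    then have "M \<in> R" using fr by (simp add: R_def)
    moreover have "j = d" using total_deg_front_add[of n' "Rep_cubic_monom M'"] eq wd d by simp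
    ultimately show False using j by simp
  qed
  ultimately show "M' \<in> W'" by (simp add: W'_def)
qed

lemma \<Phi>_var_R:
  assumes M: "M \<in> U" "M \<in> R"
  obtains b where "\<Phi> (var M) = b + monom (const (\<omega> M) * top_form) d" "\<And>j. coeff b j \<in> B" "coeff b 0 = var M"
proof (rule that)
  let ?b = "\<Phi> (var M) - monom (const (\<omega> M) * top_form) d"
  have top: "coeff (\<Phi> (var M)) d = const (\<omega> M) * top_form" and high: "j > d \<Longrightarrow> coeff (\<Phi> (var M)) j = 0" for j
    using top_coeff_shear_sym[of n a l "Rep_cubic_monom M"] a M(2) total_deg_tail[OF M(2)]
    by (auto simp: coeff_\<Phi>_var top_form_def \<omega>_def R_def lin3_const_mult)
  show "\<Phi> (var M) = ?b + monom (const (\<omega> M) * top_form) d" by simp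
  show "coeff ?b j \<in> B" for j
    using coeff_\<Phi>_var_in[OF M(1), of j] top high[of j]
    by (cases "j < d"; cases "j = d") auto
  show "coeff ?b 0 = var M" using d(2) by (simp add: coeff_0_\<Phi>_var)
qed

text \<open>The equation \<open>h\<close> is the first-order change of \<open>f\<close> under the shear, measured modulo \<open>B\<close>: the
  cofactor of \<open>top_form ^ q\<close> at $t^{dq}$, the lowest power that can lead out of \<open>B\<close>.
  The pairs with this property behave like elements with a derivation: they are closed under sums and under products by the Leibniz rule, so it is enough to exhibit them for
  constants, for variables outside \<open>R\<close>, and for \<open>q\<close>-th powers of variables in \<open>R\<close>.\<close>

definition tangent :: "'k equation \<Rightarrow> 'k equation \<Rightarrow> bool"
  where "tangent f h \<longleftrightarrow> (\<forall>j<d * q. coeff (\<Phi> f) j \<in> B) \<and> coeff (\<Phi> f) 0 = f \<and>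
    coeff (\<Phi> f) (d * q) - top_form ^ q * h \<in> B"

lemma dq_pos: "0 < d * q" using d(2) q_pos by simp

lemma tangent_in: "tangent f h \<Longrightarrow> f \<in> B"
  using dq_pos unfolding tangent_def by metis

lemma tangent_const: "tangent (const c) 0"
  using dq_pos by (auto simp: tangent_def \<Phi>_const coeff_pCons split: nat.split)

lemma tangent_add: "tangent f h \<Longrightarrow> tangent f' h' \<Longrightarrow> tangent (f + f') (h + h')"
proof -
  assume t: "tangent f h" "tangent f' h'"
  have "coeff (\<Phi> (f + f')) (d * q) - top_form ^ q * (h + h')
      = (coeff (\<Phi> f) (d * q) - top_form ^ q * h) + (coeff (\<Phi> f') (d * q) - top_form ^ q * h')"
    by (simp add: \<Phi>_add algebra_simps)
  also have "\<dots> \<in> B" using t by (intro polys_in_add) (auto simp: tangent_def)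
  finally show ?thesis using t by (simp add: tangent_def \<Phi>_add polys_in_add)
qed

lemma tangent_mult:
  assumes t: "tangent f h" "tangent f' h'" shows "tangent (f * f') (f * h' + h * f')"
proof -
  let ?N = "d * q"
  let ?F = "coeff (\<Phi> f)" and ?G = "coeff (\<Phi> f')"
  have F: "?F j \<in> B" and G: "?G j \<in> B" if "j < ?N" for j using t that by (auto simp: tangent_def)
  have F0: "?F 0 = f" and G0: "?G 0 = f'" using t by (auto simp: tangent_def)
  have low: "coeff (\<Phi> (f * f')) j \<in> B" if "j < ?N" for j
    unfolding \<Phi>_mult coeff_mult using that F G by (intro polys_in_sum polys_in_mult) auto
  \<comment> \<open>Only the two extreme terms of the convolution can leave \<open>B\<close>.\<close>
  have "{..?N} = insert 0 (insert ?N {0<..<?N})" using dq_pos by auto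
  then have "coeff (\<Phi> (f * f')) ?N = f * ?G ?N + (?F ?N * f' + (\<Sum>i\<in>{0<..<?N}. ?F i * ?G (?N - i)))"
    unfolding \<Phi>_mult coeff_mult using dq_pos by (simp add: F0 G0)
  then have "coeff (\<Phi> (f * f')) ?N - top_form ^ q * (f * h' + h * f')
      = f * (?G ?N - top_form ^ q * h') + ((?F ?N - top_form ^ q * h) * f' + (\<Sum>i\<in>{0<..<?N}. ?F i * ?G (?N - i)))"
    by (simp add: algebra_simps)
  also have "\<dots> \<in> B"
  proof (intro polys_in_add polys_in_mult polys_in_sum)
    show "f \<in> B" "f' \<in> B" using t tangent_in by auto
    show "?G ?N - top_form ^ q * h' \<in> B" "?F ?N - top_form ^ q * h \<in> B" using t by (auto simp: tangent_def)
  qed (auto intro: F G)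
  finally show ?thesis using low F0 G0 unfolding tangent_def \<Phi>_mult by (simp add: coeff_mult)
qed

lemma tangent_var: "M \<in> U \<Longrightarrow> M \<notin> R \<Longrightarrow> tangent (var M) 0"
  using coeff_\<Phi>_var_in by (simp add: tangent_def coeff_0_\<Phi>_var)

text \<open>The Frobenius power separates the part in \<open>B\<close> from the top coefficient.\<close>

lemma tangent_var_power:
  assumes "M \<in> U" "M \<in> R" shows "tangent (var M ^ q) (const (\<omega> M ^ q))"
proof -
  obtain b where b: "\<Phi> (var M) = b + monom (const (\<omega> M) * top_form) d" "\<And>j. coeff b j \<in> B" "coeff b 0 = var M"
    using \<Phi>_var_R[OF assms] by blast
  have "\<Phi> (var M ^ q) = b ^ q + monom (const (\<omega> M) * top_form) d ^ q"
    unfolding \<Phi>_power b(1) by (rule frob_exponent_add[OF q]) simp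
  then have eq: "\<Phi> (var M ^ q) = b ^ q + monom (top_form ^ q * const (\<omega> M ^ q)) (d * q)"
    by (simp add: monom_power power_mult_distrib const_power mult.commute)
  have "coeff (b ^ q) j \<in> B" for j by (rule coeff_poly_power_in[OF b(2)])
  moreover have "coeff (b ^ q) 0 = var M ^ q" using b(3) by (simp add: coeff_0_power)
  ultimately show ?thesis using dq_pos d(2) q_pos by (auto simp: tangent_def eq)
qed

lemma tangent_sum: "(\<And>x. x \<in> S \<Longrightarrow> tangent (f x) (h x)) \<Longrightarrow> tangent (\<Sum>x\<in>S. f x) (\<Sum>x\<in>S. h x)"
  using tangent_const[of 0] by (induction S rule: infinite_finite_induct) (simp_all add: tangent_add)

text \<open>Leibniz rule for monomials, peeling off one variable outside \<open>R\<close> or one \<open>q\<close>-th power of a variable in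
  \<open>R\<close> at a time.\<close>

lemma tangent_mon:
  assumes "finite R0" "R0 \<subseteq> R" "keys m \<subseteq> U" "keys m \<inter> R \<subseteq> R0" "\<And>v. v \<in> R \<Longrightarrow> q dvd lookup m v"
  shows "tangent (mon m) (\<Sum>v\<in>R0. const (\<omega> v ^ q) * (of_nat (lookup m v div q) * mon (m - single v q)))"
  using assms(3-5)
proof (induction "total_deg m" arbitrary: m rule: less_induct)
  case less
  show ?case
  proof (cases "m = 0")
    case True
    then show ?thesis using tangent_const[of 1] by simp
  next
    case False
    then obtain i where i: "i \<in> keys m" by (metis keys_eq_empty ex_in_conv)
    show ?thesis
    proof (cases "i \<in> R")
      case iR: False
      define m' where "m' = m - single i 1"
      have m: "m = m' + single i 1"
        using i by (intro poly_mapping_eqI) (auto simp: m'_def lookup_add lookup_minus lookup_single when_def in_keys_iff)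
      have lk: "lookup m v = lookup m' v" if "v \<in> R" for v
        using that iR by (auto simp: m lookup_add lookup_single when_def)
      have sh: "m - single v q = (m' - single v q) + single i 1" if "v \<in> R" for v
        using that iR by (intro poly_mapping_eqI) (auto simp: m lookup_add lookup_minus lookup_single when_def)
      have "tangent (mon m') (\<Sum>v\<in>R0. const (\<omega> v ^ q) * (of_nat (lookup m' v div q) * mon (m' - single v q)))"
      proof (rule less.hyps)
        show "total_deg m' < total_deg m" by (simp add: m total_deg_add)
        show "keys m' \<subseteq> U" "keys m' \<inter> R \<subseteq> R0" using less.prems(1,2) unfolding m keys_add_nat by auto
        show "q dvd lookup m' v" if "v \<in> R" for v using less.prems(3)[OF that] lk[OF that] by simp
      qed
      from tangent_mult[OF this tangent_var[OF _ iR]] i less.prems(1)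
      have "tangent (mon m' * var i)
          ((\<Sum>v\<in>R0. const (\<omega> v ^ q) * (of_nat (lookup m' v div q) * mon (m' - single v q))) * var i)"
        by auto
      moreover have "(\<Sum>v\<in>R0. const (\<omega> v ^ q) * (of_nat (lookup m' v div q) * mon (m' - single v q))) * var i
          = (\<Sum>v\<in>R0. const (\<omega> v ^ q) * (of_nat (lookup m v div q) * mon (m - single v q)))"
        unfolding sum_distrib_right
      proof (rule sum.cong)
        fix v assume "v \<in> R0"
        then have "v \<in> R" using assms(2) by auto
        then show "const (\<omega> v ^ q) * (of_nat (lookup m' v div q) * mon (m' - single v q)) * var i
            = const (\<omega> v ^ q) * (of_nat (lookup m v div q) * mon (m - single v q))"
          by (simp add: lk sh mon_add mon_Suc0)
      qed simp
      moreover have "(mon m :: 'k equation) = mon m' * var i" by (simp add: m mon_add mon_Suc0)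
      ultimately show ?thesis by simp
    next
      case iR: True
      define m' where "m' = m - single i q"
      have iR0: "i \<in> R0" and iU: "i \<in> U" using less.prems(1,2) i iR by auto
      have "q \<le> lookup m i" using less.prems(3)[OF iR] i by (auto simp: in_keys_iff dvd_imp_le)
      then have m: "m = m' + single i q"
        by (intro poly_mapping_eqI) (auto simp: m'_def lookup_add lookup_minus lookup_single when_def)
      let ?t = "\<lambda>m v. const (\<omega> v ^ q) * (of_nat (lookup m v div q) * mon (m - single v q)) :: 'k equation"
      have "tangent (mon m') (\<Sum>v\<in>R0. ?t m' v)"
      proof (rule less.hyps)
        show "total_deg m' < total_deg m" using q_pos by (simp add: m total_deg_add)
        show "keys m' \<subseteq> U" "keys m' \<inter> R \<subseteq> R0" using less.prems(1,2) unfolding m keys_add_nat by auto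
        show "q dvd lookup m' v" if "v \<in> R" for v
          using less.prems(3)[OF that] by (auto simp: m lookup_add lookup_single when_def split: if_splits)
      qed
      from tangent_mult[OF this tangent_var_power[OF iU iR]]
      have "tangent (mon m) (mon m' * const (\<omega> i ^ q) + (\<Sum>v\<in>R0. ?t m' v) * var i ^ q)"
        by (simp add: m mon_add mon_single)
      moreover have "mon m' * const (\<omega> i ^ q) + (\<Sum>v\<in>R0. ?t m' v) * var i ^ q = (\<Sum>v\<in>R0. ?t m v)"
      proof -
        have other: "?t m' v * var i ^ q = ?t m v" if "v \<noteq> i" for v
        proof -
          have "m - single v q = (m' - single v q) + single i q"
            using that by (intro poly_mapping_eqI) (auto simp: m lookup_add lookup_minus lookup_single when_def)
          moreover have "lookup m v = lookup m' v" using that by (simp add: m lookup_add lookup_single when_def)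
          ultimately show ?thesis by (simp add: mon_add mon_single)
        qed
        have same: "mon m' * const (\<omega> i ^ q) + ?t m' i * var i ^ q = ?t m i"
        proof -
          have k: "lookup m i div q = Suc (lookup m' i div q)" using q_pos by (simp add: m lookup_add)
          have mm: "m - single i q = m'" by (simp add: m'_def)
          have "of_nat (lookup m' i div q) * mon (m' - single i q) * var i ^ q = of_nat (lookup m' i div q) * (mon m' :: 'k equation)"
          proof (cases "lookup m' i div q = 0")
            case False
            then have "q \<le> lookup m' i" by (metis div_less not_le)
            then have "m' = (m' - single i q) + single i q"
              by (intro poly_mapping_eqI) (auto simp: lookup_add lookup_minus lookup_single when_def)
            then have "mon (m' - single i q) * var i ^ q = (mon m' :: 'k equation)"
              by (metis mon_add mon_single)
            then show ?thesis by (simp add: mult.assoc)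
          qed simp
          moreover have "?t m' i * var i ^ q
              = const (\<omega> i ^ q) * (of_nat (lookup m' i div q) * mon (m' - single i q) * var i ^ q)"
            by (simp only: mult.assoc)
          ultimately have "?t m' i * var i ^ q = const (\<omega> i ^ q) * (of_nat (lookup m' i div q) * mon m')"
            by simp
          then show ?thesis unfolding k mm by (simp add: algebra_simps)
        qed
        have "(\<Sum>v\<in>R0. ?t m' v) * var i ^ q = ?t m' i * var i ^ q + (\<Sum>v\<in>R0 - {i}. ?t m' v * var i ^ q)"
          using sum.remove[OF assms(1) iR0, of "?t m'"] by (simp add: distrib_right sum_distrib_right)
        also have "(\<Sum>v\<in>R0 - {i}. ?t m' v * var i ^ q) = (\<Sum>v\<in>R0 - {i}. ?t m v)"
          by (rule sum.cong) (use other in auto)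
        finally show ?thesis
          using sum.remove[OF assms(1) iR0, of "?t m"] same by (simp add: add.assoc[symmetric])
      qed
      ultimately show ?thesis by simp
    qed
  qed
qed

text \<open>Hence \<open>h\<close> is the derivative of \<open>f\<close> in the direction with components \<open>\<omega> v ^ q\<close>. It does not depend on
  $\ell$, which is what allows polarization afterwards.\<close>

lemma tangent_equation:
  assumes "finite R0" "R0 \<subseteq> R" and f: "f \<in> polys_in U" "\<And>m. m \<in> keys f \<Longrightarrow> keys m \<inter> R \<subseteq> R0"
    "\<And>m v. m \<in> keys f \<Longrightarrow> v \<in> R \<Longrightarrow> q dvd lookup m v"
  shows "tangent f (\<Sum>v\<in>R0. const (\<omega> v ^ q) * frob_deriv q v f)"
proof -
  let ?h = "\<lambda>m. \<Sum>v\<in>R0. const (\<omega> v ^ q) * (of_nat (lookup m v div q) * mon (m - single v q)) :: 'k equation"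
  have "tangent (const (lookup f m) * mon m) (const (lookup f m) * ?h m)" if m: "m \<in> keys f" for m
  proof -
    have "keys m \<subseteq> U" using f(1) m by (simp add: polys_in_def)
    from tangent_mult[OF tangent_const tangent_mon[OF assms(1,2) this f(2)[OF m] f(3)[OF m]]]
    show ?thesis by simp
  qed
  then have "tangent (\<Sum>m\<in>keys f. const (lookup f m) * mon m) (\<Sum>m\<in>keys f. const (lookup f m) * ?h m)"
    by (rule tangent_sum)
  moreover have "(\<Sum>m\<in>keys f. const (lookup f m) * ?h m) = (\<Sum>v\<in>R0. const (\<omega> v ^ q) * frob_deriv q v f)"
  proof -
    have fd: "frob_deriv q v f = (\<Sum>m\<in>keys f. const (lookup f m) * (of_nat (lookup m v div q) * mon (m - single v q)))" for v
      unfolding frob_deriv_def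
      by (rule sum.cong) (simp_all add: mon_def const_mult_single flip: const_of_nat, simp add: mult.commute)
    show ?thesis unfolding fd sum_distrib_left
      by (subst sum.swap) (simp add: ac_simps)
  qed
  ultimately show ?thesis by (simp only: sum_const_mon)
qed

end

context shear_setting
begin

text \<open>For an ideal \<open>K\<close> this is a subring, the preimage of the image of \<open>B\<close> in the quotient by \<open>K\<close>.\<close>

definition eliminated :: "'k equation set \<Rightarrow> 'k equation set"
  where "eliminated K = {x + b | x b. x \<in> K \<and> b \<in> B}"

context
  fixes G and K :: "'k equation set"
  assumes K: "stable_radical_ideal G (polys_in W) K"
begin

lemma eliminatedI: "x \<in> K \<Longrightarrow> b \<in> B \<Longrightarrow> x + b \<in> eliminated K"
  by (auto simp: eliminated_def)

lemma eliminated_B: "b \<in> B \<Longrightarrow> b \<in> eliminated K"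
  using eliminatedI[OF stable_radical_ideal_zero[OF K]] by fastforce

lemma eliminated_add: "x \<in> eliminated K \<Longrightarrow> y \<in> eliminated K \<Longrightarrow> x + y \<in> eliminated K"
proof -
  assume "x \<in> eliminated K" "y \<in> eliminated K"
  then obtain k b k' b' where *: "x = k + b" "y = k' + b'" "k \<in> K" "k' \<in> K" "b \<in> B" "b' \<in> B"
    by (auto simp: eliminated_def)
  have "x + y = (k + k') + (b + b')" using * by simp
  then show ?thesis
    using eliminatedI[OF stable_radical_ideal_add[OF K *(3,4)] polys_in_add[OF *(5,6)]] by simp
qed

lemma eliminated_mult: "x \<in> eliminated K \<Longrightarrow> y \<in> eliminated K \<Longrightarrow> x * y \<in> eliminated K"
proof -
  assume "x \<in> eliminated K" "y \<in> eliminated K"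
  then obtain k b k' b' where *: "x = k + b" "y = k' + b'" "k \<in> K" "k' \<in> K" "b \<in> B" "b' \<in> B"
    by (auto simp: eliminated_def)
  have "k' \<in> polys_in W" "b \<in> polys_in W" "b' \<in> polys_in W"
    using * stable_radical_ideal_subset[OF K] B_subset by auto
  then have "k' * k \<in> K" "b * k' \<in> K" "b' * k \<in> K"
    using stable_radical_ideal_mult[OF K] * by auto
  then have "(k' * k + b * k') + b' * k \<in> K" by (intro stable_radical_ideal_add[OF K])
  then have "(k' * k + b * k') + b' * k + b * b' \<in> eliminated K"
    using * by (intro eliminatedI polys_in_mult)
  then show ?thesis using * by (simp add: algebra_simps)
qed

text \<open>The forms \<open>p\<close> for which the relation holds make up a subspace, since taking \<open>q\<close>-th powers is additive.
  It contains all $\ell^d$. Replacing $\ell$ by $\ell + s\,e_i$ and taking the coefficient of \<open>s\<close>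
  turns one factor $\ell$ into $e_i$, at the price of a factor between 1 and 3, which is
  invertible by the assumption on the characteristic; after \<open>d\<close> rounds all monomials are reached.\<close>

lemma polarization:
  fixes h :: "'k equation"
  assumes inf: "infinite (UNIV :: 'k set)" and char: "CHAR('k) \<noteq> 2" "CHAR('k) \<noteq> 3"
    and pow: "\<And>l. keys l \<subseteq> {n'..} \<Longrightarrow> h * lin3 (mon l0 * sym_incl l ^ d) ^ q \<in> eliminated K"
    and M: "front n' (Rep_cubic_monom M) = l0"
  shows "h * var M ^ q \<in> eliminated K"
proof -
  define S where "S = {p. h * lin3 (mon l0 * p) ^ q \<in> eliminated K}"
  have S: "k_subspace S"
    unfolding k_subspace_def
  proof (intro conjI ballI allI)
    show "0 \<in> S" using q_pos eliminated_B[of 0] by (simp add: S_def zero_power)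
    show "x + y \<in> S" if "x \<in> S" "y \<in> S" for x y
    proof -
      have "lin3 (mon l0 * (x + y)) ^ q = lin3 (mon l0 * x) ^ q + lin3 (mon l0 * y) ^ q"
        by (simp add: distrib_left lin3_add frob_exponent_add[OF q])
      then show ?thesis using that eliminated_add by (simp add: S_def distrib_left)
    qed
    show "const c * x \<in> S" if "x \<in> S" for c x
    proof -
      have "lin3 (mon l0 * (const c * x)) = const c * lin3 (mon l0 * x)"
        by (simp add: mult.left_commute flip: lin3_const_mult)
      then have "h * lin3 (mon l0 * (const c * x)) ^ q = const (c ^ q) * (h * lin3 (mon l0 * x) ^ q)"
        by (simp add: power_mult_distrib const_power mult.left_commute)
      then show ?thesis using that eliminated_mult[OF eliminated_B[OF polys_in_const]] by (simp add: S_def)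
    qed
  qed
  have linear_coeff: "coeff ([:y, z:] ^ k) (Suc 0) = of_nat k * (z * y ^ (k - 1))"
    for y z :: "(nat, 'k) sym" and k
  proof (induction k)
    case (Suc k)
    have "coeff ([:y, z:] ^ Suc k) (Suc 0) = y * coeff ([:y, z:] ^ k) (Suc 0) + z * coeff ([:y, z:] ^ k) 0"
      by (simp add: coeff_pCons)
    also have "\<dots> = y * (of_nat k * (z * y ^ (k - 1))) + z * y ^ k"
      unfolding Suc.IH by (simp add: coeff_0_power)
    also have "\<dots> = of_nat (Suc k) * (z * y ^ (Suc k - 1))"
      by (cases k) (simp_all add: algebra_simps)
    finally show ?case .
  qed simp
  have claim: "total_deg m \<le> d \<Longrightarrow> keys m \<subseteq> {n'..} \<Longrightarrow> keys l \<subseteq> {n'..} \<Longrightarrow> mon m * sym_incl l ^ (d - total_deg m) \<in> S"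
    for m and l :: "nat \<Rightarrow>\<^sub>0 'k"
  proof (induction m arbitrary: l rule: monomial_induct)
    case zero
    then show ?case using pow by (simp add: S_def)
  next
    case (add m i)
    then have m: "total_deg m < d" "keys m \<subseteq> {n'..}" and i: "i \<ge> n'" by (auto simp: total_deg_add)
    define k where "k = d - total_deg m - 1"
    have k: "d - total_deg m = Suc k" "d - total_deg (m + single i (Suc 0)) = k" using m(1) by (auto simp: k_def total_deg_add)
    define Q where "Q = smult (mon m) ([:sym_incl l, var i:] ^ Suc k)"
    have "coeff Q 1 \<in> S"
    proof (rule coeff_in_subspace[OF inf S])
      fix c :: 'k
      have "keys (l + single i c) \<subseteq> {n'..}"
        using keys_add[of l "single i c"] add.prems(3) i by (auto split: if_splits)
      then have "mon m * sym_incl (l + single i c) ^ (d - total_deg m) \<in> S" using add.IH m by simp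
      then show "poly Q (const c) \<in> S" by (simp add: Q_def k sym_incl_add distrib_right mult.assoc)
    qed
    then have "of_nat (Suc k) * (mon m * var i * sym_incl l ^ k) \<in> S"
      using linear_coeff[of "sym_incl l" "var i" "Suc k"] by (simp add: Q_def ac_simps del: of_nat_Suc power_Suc)
    then have "const (inverse (of_nat (Suc k))) * (const (of_nat (Suc k)) * (mon m * var i * sym_incl l ^ k)) \<in> S"
      using S unfolding k_subspace_def const_of_nat by blast
    moreover have "(of_nat (Suc k) :: 'k) \<noteq> 0"
    proof -
      have "Suc k \<in> {1, 2, 3}" using k(1) d(1) by auto
      moreover have "\<not> CHAR('k) dvd 1" by simp
      moreover have "\<not> CHAR('k) dvd 2" "\<not> CHAR('k) dvd 3"
      proof -
        have 2: "p = 1 \<or> p = 2" if "p dvd 2" for p :: nat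
          using that dvd_imp_le[OF that] by (cases "p = 0") auto
        show "\<not> CHAR('k) dvd 2" using 2[of "CHAR('k)"] char by auto
        have 3: "p = 1 \<or> p = 3" if "p dvd 3" for p :: nat
        proof -
          have "p \<in> {0, 1, 2, 3}" using dvd_imp_le[OF that] by auto
          with that show ?thesis by auto
        qed
        show "\<not> CHAR('k) dvd 3" using 3[of "CHAR('k)"] char by auto
      qed
      ultimately have "\<not> CHAR('k) dvd Suc k" by (metis insertE singletonD)
      then show ?thesis unfolding of_nat_eq_0_iff_char_dvd .
    qed
    ultimately have "mon m * var i * sym_incl l ^ k \<in> S"
      by (simp add: mult.assoc[symmetric] const_simps(4)[symmetric] del: const_simps(3-) of_nat_Suc)
    then show ?case by (simp add: k mon_add mon_Suc0)
  qed
  define m where "m = pm_restrict {n'..} (Rep_cubic_monom M)"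
  have "total_deg m = d" using total_deg_front_add[of n' "Rep_cubic_monom M"] M d by (simp add: m_def)
  moreover have "keys m \<subseteq> {n'..}" by (auto simp: m_def)
  ultimately have "mon m \<in> S" using claim[of m 0] by simp
  moreover have "mon l0 * mon m = (mon (Rep_cubic_monom M) :: (nat, 'k) sym)"
    using front_add_tail[of n' "Rep_cubic_monom M"] M by (simp add: m_def flip: mon_add)
  ultimately show ?thesis by (simp add: S_def lin3_mon)
qed

text \<open>Taking \<open>q\<close>-th powers is additive and multiplicative, so the relations for the variables extend to all
  polynomials after multiplication by some power of \<open>h\<close>.\<close>

lemma elimination:
  fixes h :: "'k equation"
  assumes h: "h \<in> B" and var: "\<And>M. front n' (Rep_cubic_monom M) = l0 \<Longrightarrow> h * var M ^ q \<in> eliminated K"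
    and b: "b \<in> polys_in W"
  shows "\<exists>N. h ^ N * b ^ q \<in> eliminated K"
  using b
proof (induction rule: polys_in_induct)
  case (const c)
  have "h ^ 0 * const c ^ q \<in> eliminated K" by (intro eliminated_B) (simp add: polys_in_power)
  then show ?case by blast
next
  case (var M)
  show ?case
  proof (cases "M \<in> W'")
    case True
    then have "h ^ 0 * var M ^ q \<in> eliminated K" by (intro eliminated_B) (simp add: polys_in_power)
    then show ?thesis by blast
  next
    case False
    then have "h ^ 1 * var M ^ q \<in> eliminated K" using assms(2) var by (simp add: W'_def)
    then show ?thesis by blast
  qed
next
  case (add x y)
  then obtain N1 N2 where N: "h ^ N1 * x ^ q \<in> eliminated K" "h ^ N2 * y ^ q \<in> eliminated K" by blast
  have "h ^ (N1 + N2) * (x + y) ^ q = h ^ N2 * (h ^ N1 * x ^ q) + h ^ N1 * (h ^ N2 * y ^ q)"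
    by (simp add: frob_exponent_add[OF q] power_add algebra_simps)
  moreover have "h ^ k \<in> eliminated K" for k using h by (intro eliminated_B polys_in_power)
  ultimately have "h ^ (N1 + N2) * (x + y) ^ q \<in> eliminated K"
    using N by (simp add: eliminated_add eliminated_mult)
  then show ?case by blast
next
  case (mult x y)
  then obtain N1 N2 where N: "h ^ N1 * x ^ q \<in> eliminated K" "h ^ N2 * y ^ q \<in> eliminated K" by blast
  have "h ^ (N1 + N2) * (x * y) ^ q = (h ^ N1 * x ^ q) * (h ^ N2 * y ^ q)"
    by (simp add: power_add power_mult_distrib ac_simps)
  then have "h ^ (N1 + N2) * (x * y) ^ q \<in> eliminated K" using N by (simp add: eliminated_mult)
  then show ?case by blast
qed

end

end

section \<open>Induction on the type of a polynomial functor\<close>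

lemma finite_bounded_total_deg:
  assumes "finite S" shows "finite {m :: nat \<Rightarrow>\<^sub>0 nat. keys m \<subseteq> S \<and> total_deg m \<le> k}"
proof (induction k)
  case 0
  have "{m :: nat \<Rightarrow>\<^sub>0 nat. keys m \<subseteq> S \<and> total_deg m \<le> 0} \<subseteq> {0}" by auto
  then show ?case using finite_subset by blast
next
  case (Suc k)
  have "{m :: nat \<Rightarrow>\<^sub>0 nat. keys m \<subseteq> S \<and> total_deg m \<le> Suc k}
      \<subseteq> insert 0 ((\<lambda>(m, i). m + single i 1) ` ({m. keys m \<subseteq> S \<and> total_deg m \<le> k} \<times> S))"
  proof
    fix m :: "nat \<Rightarrow>\<^sub>0 nat" assume m: "m \<in> {m. keys m \<subseteq> S \<and> total_deg m \<le> Suc k}"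
    show "m \<in> insert 0 ((\<lambda>(m, i). m + single i 1) ` ({m. keys m \<subseteq> S \<and> total_deg m \<le> k} \<times> S))"
    proof (cases "m = 0")
      case False
      then obtain i where i: "i \<in> keys m" by (metis keys_eq_empty ex_in_conv)
      define m' where "m' = m - single i 1"
      have mm: "m = m' + single i 1"
        using i by (intro poly_mapping_eqI) (auto simp: m'_def lookup_add lookup_minus lookup_single when_def in_keys_iff)
      have "keys m \<subseteq> S" "total_deg m \<le> Suc k" using m by auto
      then have "keys m' \<subseteq> S" "total_deg m' \<le> k" "i \<in> S" unfolding mm keys_add_nat total_deg_add by auto
      then show ?thesis using mm by (auto intro!: image_eqI[of _ _ "(m', i)"])
    qed simp
  qed
  moreover have "finite (insert 0 ((\<lambda>(m, i). m + single i 1) ` ({m :: nat \<Rightarrow>\<^sub>0 nat. keys m \<subseteq> S \<and> total_deg m \<le> k} \<times> S)))"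
    using Suc assms by auto
  ultimately show ?case by (rule finite_subset)
qed

lemma k_subspace_ideal: "stable_radical_ideal G (polys_in W) I \<Longrightarrow> k_subspace I"
  unfolding k_subspace_def
  by (auto intro: stable_radical_ideal_zero stable_radical_ideal_add stable_radical_ideal_mult)

context shear_setting
begin

definition base_4_code :: "cubic_monom \<Rightarrow> nat"
  where "base_4_code M = (\<Sum>i<n'. lookup (pm_restrict {n..} (Rep_cubic_monom M)) i * 4 ^ i)"

text \<open>A variable of \<open>R\<close> is determined by the part of its monomial outside the front.\<close>

lemma base_4_code_inject:
  assumes "v \<in> R" "v' \<in> R" "v \<in> U" "v' \<in> U" "base_4_code v = base_4_code v'"
  shows "v = v'"
proof -
  let ?t = "\<lambda>v. pm_restrict {n..} (Rep_cubic_monom v)"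
  have small: "lookup (?t v) i < 4" for v i
    using lookup_le_total_deg[of "Rep_cubic_monom v" i] by (auto simp: lookup_pm_restrict when_def)
  have "lookup (?t v) i = lookup (?t v') i" for i
  proof (cases "i < n'")
    case True
    show ?thesis by (rule base_4_inject[OF assms(5)[unfolded base_4_code_def] small small True])
  next
    case False
    then have "i \<notin> keys (Rep_cubic_monom v)" "i \<notin> keys (Rep_cubic_monom v')" using assms(3,4) by (auto simp: U_def)
    then show ?thesis by (simp add: lookup_pm_restrict in_keys_iff)
  qed
  then have "?t v = ?t v'" by (rule poly_mapping_eqI)
  then have "Rep_cubic_monom v = Rep_cubic_monom v'"
    using front_add_tail[of n "Rep_cubic_monom v"] front_add_tail[of n "Rep_cubic_monom v'"] assms(1,2)
    by (simp add: R_def)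
  then show ?thesis by (simp add: Rep_cubic_monom_inject)
qed

text \<open>The derivative with respect to the single variable \<open>v0\<close> has a coefficient outside \<open>I\<close>. A suitable
  combination of derivatives inherits this: with \<open>a i = c ^ 4 ^ i\<close> the weights of the variables are
  distinct powers of \<open>c\<close>, so if all combinations had their coefficients in \<open>I\<close>, then by
  \<open>coeff_in_subspace\<close> every single derivative would. Since differentiation lowers the degree
  in \<open>R\<close>, minimality of \<open>f\<close> shows that the combination is not in \<open>I\<close>.\<close>

lemma ex_derivative_not_in_ideal:
  assumes inf: "infinite (UNIV :: 'k set)"
    and I: "stable_radical_ideal G (polys_in W) I"
    and f: "f \<in> I" "f \<in> polys_in U" "\<And>m. m \<in> keys f \<Longrightarrow> rcoeff R (pm_restrict R m) f \<notin> I"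
      "deg_lt R (Suc D) f" "\<And>g \<alpha>. g \<in> I \<Longrightarrow> deg_lt R D g \<Longrightarrow> rcoeff R \<alpha> g \<in> I"
    and qdvd: "\<And>m v. m \<in> keys f \<Longrightarrow> v \<in> R \<Longrightarrow> q dvd lookup m v"
    and v0: "m0 \<in> keys f" "v0 \<in> R" "of_nat (lookup m0 v0 div q) \<noteq> (0 :: 'k)"
    and R0: "finite R0" "R0 \<subseteq> R \<inter> U" "v0 \<in> R0"
  shows "\<exists>a :: nat \<Rightarrow> 'k. (\<forall>i. i < n \<or> i \<ge> n' \<longrightarrow> a i = 0) \<and>
    (\<Sum>v\<in>R0. const (weight a (pm_restrict {n..} (Rep_cubic_monom v)) ^ q) * frob_deriv q v f) \<notin> I"
proof -
  define C where "C = {g. \<forall>\<alpha>. rcoeff R \<alpha> g \<in> I}"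
  have Isub: "k_subspace I" by (rule k_subspace_ideal[OF I])
  have C: "k_subspace C"
    using Isub unfolding k_subspace_def C_def
    by (auto simp: rcoeff_add rcoeff_const_mult) (simp add: rcoeff_def)
  have dvd: "\<forall>m\<in>keys f. q dvd lookup m v" if "v \<in> R" for v using qdvd that by blast
  have nC: "frob_deriv q v0 f \<notin> C"
  proof
    assume "frob_deriv q v0 f \<in> C"
    define \<alpha> where "\<alpha> = pm_restrict R m0 - single v0 q"
    let ?c = "of_nat (lookup m0 v0 div q) :: 'k"
    have "lookup m0 v0 div q \<noteq> 0" using v0(3) by (metis of_nat_0)
    then have "q \<le> lookup m0 v0" by (metis div_less not_le)
    then have add: "\<alpha> + single v0 q = pm_restrict R m0" and lk: "lookup \<alpha> v0 + q = lookup m0 v0"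
      using v0(2) by (auto simp: \<alpha>_def lookup_add lookup_minus lookup_single lookup_pm_restrict when_def
          intro!: poly_mapping_eqI)
    have "rcoeff R \<alpha> (frob_deriv q v0 f) \<in> I" using \<open>frob_deriv q v0 f \<in> C\<close> by (simp add: C_def)
    then have "const ?c * rcoeff R (pm_restrict R m0) f \<in> I"
      by (simp only: rcoeff_frob_deriv[OF dvd[OF v0(2)] q_pos v0(2)] add lk)
    then have "const (inverse ?c) * (const ?c * rcoeff R (pm_restrict R m0) f) \<in> I"
      using Isub unfolding k_subspace_def by blast
    then have "rcoeff R (pm_restrict R m0) f \<in> I"
      using v0(3) by (simp add: mult.assoc[symmetric] const_simps(4)[symmetric] del: const_simps(3-))
    then show False using f(3)[OF v0(1)] by contradiction
  qed
  define P where "P = (\<Sum>v\<in>R0. monom (frob_deriv q v f) (q * base_4_code v))"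
  have "coeff P (q * base_4_code v0) = (\<Sum>v\<in>R0. if v = v0 then frob_deriv q v f else 0)"
    unfolding P_def coeff_sum
  proof (rule sum.cong)
    fix v assume v: "v \<in> R0"
    have "base_4_code v = base_4_code v0 \<longleftrightarrow> v = v0" using base_4_code_inject[of v v0] v R0 by auto
    then show "coeff (monom (frob_deriv q v f) (q * base_4_code v)) (q * base_4_code v0) = (if v = v0 then frob_deriv q v f else 0)"
      using q_pos by simp
  qed simp
  also have "\<dots> = frob_deriv q v0 f" using R0 by simp
  finally have "coeff P (q * base_4_code v0) \<notin> C" using nC by simp
  then obtain c where c: "poly P (const c) \<notin> C" using coeff_in_subspace[OF inf C] by blast
  define a where "a i = (if n \<le> i \<and> i < n' then c ^ (4 ^ i) else 0)" for i
  have w: "weight a (pm_restrict {n..} (Rep_cubic_monom v)) = c ^ base_4_code v" if v: "v \<in> R0" for v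
  proof -
    let ?t = "pm_restrict {n..} (Rep_cubic_monom v)"
    have sub: "keys ?t \<subseteq> {..<n'}" using v R0(2) by (auto simp: U_def)
    have "weight a ?t = (\<Prod>i\<in>keys ?t. c ^ (lookup ?t i * 4 ^ i))"
      unfolding weight_def
    proof (rule prod.cong)
      fix i assume "i \<in> keys ?t"
      then have "n \<le> i" "i < n'" using sub by auto
      then show "a i ^ lookup ?t i = c ^ (lookup ?t i * 4 ^ i)"
        by (simp add: a_def mult.commute flip: power_mult)
    qed simp
    also have "\<dots> = c ^ (\<Sum>i\<in>keys ?t. lookup ?t i * 4 ^ i)" by (simp add: power_sum)
    also have "(\<Sum>i\<in>keys ?t. lookup ?t i * 4 ^ i) = base_4_code v"
      unfolding base_4_code_def by (rule sum.mono_neutral_left) (use sub in \<open>auto simp: in_keys_iff simp del: keys_pm_restrict\<close>)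
    finally show ?thesis .
  qed
  define h where "h = (\<Sum>v\<in>R0. const (weight a (pm_restrict {n..} (Rep_cubic_monom v)) ^ q) * frob_deriv q v f)"
  have cq: "const ((c ^ k) ^ q) = const c ^ (q * k)" for k
    by (simp add: mult.commute flip: power_mult const_power)
  have "h = poly P (const c)"
    unfolding h_def P_def poly_sum poly_monom
    by (rule sum.cong) (simp_all only: w cq mult.commute)
  then have hC: "h \<notin> C" using c by simp
  have "deg_lt R D h"
    unfolding deg_lt_def
  proof
    fix m assume "m \<in> keys h"
    then obtain v where v: "v \<in> R0" "m \<in> keys (frob_deriv q v f)"
      unfolding h_def using keys_sum_subset keys_const_mult by fast
    then have "m + single v q \<in> keys f" using keys_frob_deriv[OF dvd q_pos] R0(2) by blast
    then have "total_deg (pm_restrict R (m + single v q)) < Suc D" using f(4) by (simp add: deg_lt_def)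
    moreover have "pm_restrict R (single v q) = single v q" using v(1) R0(2) by (intro pm_restrict_id) auto
    ultimately show "total_deg (pm_restrict R m) < D" using q_pos by (simp add: pm_restrict_add total_deg_add)
  qed
  then have "h \<notin> I" using f(5)[of h] hC by (auto simp: C_def)
  then show ?thesis by (intro exI[of _ a]) (auto simp: h_def a_def)
qed

text \<open>Off the zeros of \<open>h\<close>, the ideal \<open>I\<close> is cut out by \<open>f\<close> and \<open>I \<inter> B\<close>: for \<open>b \<in> I\<close>, some
  \<open>h ^ N * b ^ q\<close> is the sum of an element of the closure of \<open>f\<close> and an element of \<open>B\<close>, and the latter
  lies in \<open>I\<close> again. The ideal \<open>I \<inter> B\<close> is stable under the smaller group at level \<open>n'\<close> and is finitely
  cut out there by hypothesis.\<close>

lemma localization_step: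
  assumes inf: "infinite (UNIV :: 'k set)" and char: "CHAR('k) \<noteq> 2" "CHAR('k) \<noteq> 3"
    and I: "stable_radical_ideal (act ` GL_block n) (polys_in W) I"
    and W': "W' = vars_with_front n' L'"
    and noeth: "topologically_noetherian (act ` GL_block n') B"
    and f: "f \<in> I" "f \<in> polys_in U" "\<And>m v. m \<in> keys f \<Longrightarrow> v \<in> R \<Longrightarrow> q dvd lookup m v"
    and R0: "finite R0" "R0 \<subseteq> R \<inter> U" "\<And>m. m \<in> keys f \<Longrightarrow> keys m \<inter> R \<subseteq> R0"
    and a: "\<And>i. i < n \<or> i \<ge> n' \<Longrightarrow> a i = (0 :: 'k)"
    and h: "h = (\<Sum>v\<in>R0. const (weight a (pm_restrict {n..} (Rep_cubic_monom v)) ^ q) * frob_deriv q v f)"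
  shows "h \<in> polys_in W \<and> (\<exists>F. finite F \<and> F \<subseteq> I \<and>
    (\<forall>b\<in>I. b * h \<in> radical_closure (act ` GL_block n) (polys_in W) F))"
proof -
  let ?G = "act ` GL_block n" and ?A = "polys_in W"
  interpret acted_ring ?G ?A unfolding W_def by (rule acted_ring_GL_block)
  interpret B: acted_ring "act ` GL_block n'" B unfolding W' by (rule acted_ring_GL_block)
  have IA: "I \<subseteq> ?A" by (rule stable_radical_ideal_subset[OF I])
  have GG: "act ` GL_block n' \<subseteq> ?G" using GL_block_antimono[OF n] by auto
  have hU: "h \<in> polys_in U"
    unfolding h
  proof (intro polys_in_sum polys_in_mult polys_in_const)
    fix v assume "v \<in> R0"
    then have dvd: "\<forall>m\<in>keys f. q dvd lookup m v" using f(3) R0(2) by blast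
    have "keys m \<subseteq> U" if "m \<in> keys (frob_deriv q v f)" for m
    proof -
      have "m + single v q \<in> keys f" by (rule keys_frob_deriv[OF dvd q_pos that])
      then have "keys (m + single v q) \<subseteq> U" using f(2) unfolding polys_in_def by blast
      then show ?thesis by simp
    qed
    then show "frob_deriv q v f \<in> polys_in U" by (simp add: polys_in_def)
  qed
  have hB: "h \<in> B" using polys_in_mono[OF U_subset] hU by blast
  then have hA: "h \<in> ?A" using B_subset by blast
  define K1 where "K1 = radical_closure ?G ?A {f}"
  have fA: "{f} \<subseteq> ?A" using f(1) IA by auto
  have K1: "stable_radical_ideal ?G ?A K1"
    unfolding K1_def by (rule stable_radical_ideal_radical_closure[OF fA])
  have relation: "h * lin3 (mon l0 * sym_incl l ^ d) ^ q \<in> eliminated K1"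
    if l: "keys l \<subseteq> {n'..}" for l :: "nat \<Rightarrow>\<^sub>0 'k"
  proof -
    interpret F: shear_family n n' L l0 d q a l
      by unfold_locales (use a l in auto)
    have "F.tangent f h"
      unfolding h F.\<omega>_def[symmetric] using R0 f by (intro F.tangent_equation) auto
    then have t: "coeff (shear_eqn a l f) (d * q) - F.top_form ^ q * h \<in> B" by (simp add: F.tangent_def)
    \<comment> \<open>The values of the deformation at constants are translates of \<open>f\<close>.\<close>
    have "coeff (shear_eqn a l f) (d * q) \<in> K1"
    proof (rule coeff_in_subspace[OF inf k_subspace_ideal[OF K1]])
      fix c
      have "act (shear a l c) \<in> ?G" using shear_GL_block[OF a l n] by auto
      moreover have "f \<in> K1" unfolding K1_def by (rule radical_closure.gen) simp
      ultimately show "poly (shear_eqn a l f) (const c) \<in> K1"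
        unfolding poly_shear_eqn by (rule stable_radical_ideal_act[OF K1])
    qed
    moreover have "- (coeff (shear_eqn a l f) (d * q) - F.top_form ^ q * h) \<in> B"
      using t by (rule polys_in_uminus)
    ultimately have "coeff (shear_eqn a l f) (d * q) + - (coeff (shear_eqn a l f) (d * q) - F.top_form ^ q * h) \<in> eliminated K1"
      by (rule eliminatedI[OF K1])
    then show ?thesis by (simp add: F.top_form_def mult.commute)
  qed
  have elim: "\<exists>N. h ^ N * b ^ q \<in> eliminated K1" if "b \<in> ?A" for b
    using elimination[OF K1 hB polarization[OF K1 inf char relation] that] by blast
  have "stable_radical_ideal (act ` GL_block n') B (I \<inter> B)"
    by (rule stable_radical_ideal_contract[OF I B.acted_ring_axioms B_subset GG])
  then obtain F where F: "finite F" "F \<subseteq> I \<inter> B" "I \<inter> B \<subseteq> radical_closure (act ` GL_block n') B F"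
    using noeth unfolding topologically_noetherian_def finitely_cut_def by meson
  let ?K = "radical_closure ?G ?A (insert f F)"
  have K: "stable_radical_ideal ?G ?A ?K"
    using f(1) F(2) IA by (intro stable_radical_ideal_radical_closure) auto
  have K1K: "K1 \<subseteq> ?K" unfolding K1_def by (rule radical_closure_mono_gens) auto
  have "F \<subseteq> ?K" using radical_closure_gens by (rule order_trans[rotated]) auto
  then have IBK: "I \<inter> B \<subseteq> ?K"
    using F(3) radical_closure_mono[OF GG B_subset] by (meson order_trans)
  have K1I: "K1 \<subseteq> I"
    using radical_closure_mono[OF order_refl order_refl, of "{f}" ?G ?A I] f(1) radical_closure_gens[of I ?G ?A]
      stable_radical_ideal_closure[OF I] unfolding K1_def by blast
  have "b * h \<in> ?K" if b: "b \<in> I" for b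
  proof -
    have bA: "b \<in> ?A" using b IA by blast
    obtain N where "h ^ N * b ^ q \<in> eliminated K1" using elim[OF bA] by blast
    then obtain k \<beta> where k: "h ^ N * b ^ q = k + \<beta>" "k \<in> K1" "\<beta> \<in> B" by (auto simp: eliminated_def)
    have "b ^ (q - 1) * b \<in> I" by (rule stable_radical_ideal_mult[OF I polys_in_power[OF bA] b])
    then have "b ^ q \<in> I" by (simp only: power_minus_mult[OF q_pos])
    then have "h ^ N * b ^ q \<in> I" by (rule stable_radical_ideal_mult[OF I polys_in_power[OF hA]])
    then have "h ^ N * b ^ q - k \<in> I" using k(2) K1I by (intro stable_radical_ideal_diff[OF I]) auto
    then have "\<beta> \<in> ?K" using k(1,3) IBK by auto
    then have "h ^ N * b ^ q \<in> ?K" unfolding k(1) using k(2) K1K by (intro stable_radical_ideal_add[OF K]) auto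
    then have "(h ^ q * b ^ N) * (h ^ N * b ^ q) \<in> ?K"
      by (rule stable_radical_ideal_mult[OF K polys_in_mult[OF polys_in_power[OF hA] polys_in_power[OF bA]]])
    then have "(b * h) ^ (N + q) \<in> ?K" by (simp add: power_mult_distrib power_add ac_simps)
    then show ?thesis by (rule stable_radical_ideal_root[OF K mult_closed[OF bA hA]])
  qed
  moreover have "finite (insert f F)" "insert f F \<subseteq> I" using F f(1) by auto
  ultimately show ?thesis using hA by blast
qed

end

text \<open>The degrees of the summands. Fronts have degree at most 3 wherever this is used, so the subtraction
  is exact.\<close>

definition functor_type :: "(nat \<Rightarrow>\<^sub>0 nat) set \<Rightarrow> nat multiset"
  where "functor_type L = image_mset (\<lambda>l. 3 - total_deg l) (mset_set L)"

text \<open>One occurrence of the degree of \<open>l0\<close> is traded for finitely many smaller ones; some of the other fronts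
  may disappear as well.\<close>

lemma functor_type_less:
  assumes "finite L" "l0 \<in> L" "finite L'" "\<And>l. l \<in> L' \<Longrightarrow> l \<in> L - {l0} \<or> 3 - total_deg l < 3 - total_deg l0"
  shows "(functor_type L', functor_type L) \<in> mult less_than"
proof -
  let ?t = "\<lambda>S. image_mset (\<lambda>l. 3 - total_deg l) (mset_set S)"
  let ?L0 = "L - {l0}"
  have "mset_set ((L' \<inter> ?L0) \<union> (L' - ?L0)) = mset_set (L' \<inter> ?L0) + mset_set (L' - ?L0)"
    using assms(3) by (intro mset_set_Union) auto
  moreover have "(L' \<inter> ?L0) \<union> (L' - ?L0) = L'" by auto
  ultimately have 1: "functor_type L' = ?t (L' \<inter> ?L0) + ?t (L' - ?L0)" by (simp add: functor_type_def)
  have "mset_set ((L' \<inter> ?L0) \<union> (?L0 - L')) = mset_set (L' \<inter> ?L0) + mset_set (?L0 - L')"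
    using assms(1) by (intro mset_set_Union) auto
  moreover have "(L' \<inter> ?L0) \<union> (?L0 - L') = ?L0" by auto
  ultimately have "mset_set ?L0 = mset_set (L' \<inter> ?L0) + mset_set (?L0 - L')" by simp
  moreover have "mset_set L = mset_set ?L0 + {#l0#}" using assms(1,2) by (simp add: mset_set.remove)
  ultimately have 2: "functor_type L = ?t (L' \<inter> ?L0) + (?t (?L0 - L') + {#3 - total_deg l0#})"
    by (simp add: functor_type_def)
  have "(?t (L' \<inter> ?L0) + ?t (L' - ?L0), ?t (L' \<inter> ?L0) + (?t (?L0 - L') + {#3 - total_deg l0#})) \<in> mult less_than"
  proof (rule one_step_implies_mult)
    show "\<forall>k\<in>set_mset (?t (L' - ?L0)). \<exists>j\<in>set_mset (?t (?L0 - L') + {#3 - total_deg l0#}). (k, j) \<in> less_than"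
      using assms(3,4) by auto
  qed simp
  then show ?thesis by (simp only: 1 2)
qed

text \<open>Induction on the degrees of the summands in the multiset order. The summand to be dropped has maximal
  degree, so that the new fronts of level \<open>n'\<close>, which properly extend fronts in \<open>L\<close>, have summands of
  degree less than that of \<open>l0\<close>.\<close>

theorem topologically_noetherian_vars_with_front:
  fixes L :: "(nat \<Rightarrow>\<^sub>0 nat) set"
  assumes inf: "infinite (UNIV :: 'k::field set)" and char: "CHAR('k) \<noteq> 2" "CHAR('k) \<noteq> 3"
    and "finite L" "\<And>l. l \<in> L \<Longrightarrow> keys l \<subseteq> {..<n} \<and> total_deg l \<le> 3"
  shows "topologically_noetherian (act ` GL_block n) (polys_in (vars_with_front n L) :: 'k equation set)"
  using assms(4,5)
proof (induction "functor_type L" arbitrary: L n rule: wf_induct_rule[OF wf_mult[OF wf_less_than]])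
  case (1 L n)
  note IH = 1(1) and fin = 1(2) and L = 1(3)
  let ?G = "act ` GL_block n" and ?W = "vars_with_front n L"
  let ?A = "polys_in ?W :: 'k equation set"
  interpret acted_ring ?G ?A by (rule acted_ring_GL_block)
  show ?case
  proof (cases "\<forall>l\<in>L. total_deg l = 3")
    case True
    have "?W \<subseteq> Rep_cubic_monom -` L"
    proof
      fix M assume "M \<in> ?W"
      then have fr: "front n (Rep_cubic_monom M) \<in> L" by (simp add: vars_with_front_def)
      then have "pm_restrict {n..} (Rep_cubic_monom M) = 0"
        using True total_deg_front_add[of n "Rep_cubic_monom M"] by simp
      then show "M \<in> Rep_cubic_monom -` L" using front_add_tail[of n "Rep_cubic_monom M"] fr by simp
    qed
    then have "finite ?W" using finite_vimageI[OF fin inj_Rep_cubic_monom] finite_subset by blast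
    then have noeth: "topologically_noetherian {} ?A" by (rule topologically_noetherian_finite)
    show ?thesis unfolding topologically_noetherian_def
    proof (intro allI impI)
      fix I assume I: "stable_radical_ideal ?G ?A I"
      have "stable_radical_ideal {} ?A (I \<inter> ?A)"
        by (rule stable_radical_ideal_contract[OF I acted_ring_trivial]) auto
      moreover have "I \<inter> ?A = I" using stable_radical_ideal_subset[OF I] by blast
      ultimately have "finitely_cut {} ?A I" using noeth unfolding topologically_noetherian_def by metis
      then show "finitely_cut ?G ?A I" by (rule finitely_cut_mono) (simp_all add: radical_closure_gens)
    qed
  next
    case False
    then obtain l1 where "l1 \<in> L" "total_deg l1 \<noteq> 3" by blast
    \<comment> \<open>least degree of the front means greatest degree of the summand\<close>
    define l0 where "l0 = arg_min_on total_deg L"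
    have l0: "l0 \<in> L" and min: "\<And>l. l \<in> L \<Longrightarrow> total_deg l0 \<le> total_deg l"
      using arg_min_if_finite(1)[OF fin, of total_deg] arg_min_least[OF fin, of _ total_deg] \<open>l1 \<in> L\<close>
      unfolding l0_def by auto
    define d where "d = 3 - total_deg l0"
    have d: "total_deg l0 + d = 3" "d > 0"
      using min[OF \<open>l1 \<in> L\<close>] L[OF \<open>l1 \<in> L\<close>] \<open>total_deg l1 \<noteq> 3\<close> by (auto simp: d_def)
    define R where "R = {M. front n (Rep_cubic_monom M) = l0}"
    have WR: "?W - R = vars_with_front n (L - {l0})" by (auto simp: R_def vars_with_front_def)
    have "(functor_type (L - {l0}), functor_type L) \<in> mult less_than"
      using fin l0 by (intro functor_type_less) auto
    then have noethR: "topologically_noetherian ?G (polys_in (?W - R) :: 'k equation set)"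
      unfolding WR using fin L by (intro IH) auto
    show ?thesis
    proof (rule topologically_noetherian_by_localization)
      fix I assume I: "stable_radical_ideal ?G ?A I"
      have IA: "I \<subseteq> ?A" by (rule stable_radical_ideal_subset[OF I])
      show "finitely_cut ?G ?A I \<or> (\<exists>h\<in>?A - I. \<exists>F. finite F \<and> F \<subseteq> I \<and> (\<forall>b\<in>I. b * h \<in> radical_closure ?G ?A F))"
      proof (cases "\<forall>f\<in>I. \<forall>\<alpha>. rcoeff R \<alpha> f \<in> I")
        case True
        let ?Q = "polys_in (?W - R) :: 'k equation set"
        have A0: "acted_ring ?G ?Q" unfolding WR by (rule acted_ring_GL_block)
        have sub: "?Q \<subseteq> ?A" by (rule polys_in_mono) auto
        have "stable_radical_ideal ?G ?Q (I \<inter> ?Q)"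
          by (rule stable_radical_ideal_contract[OF I A0 sub order_refl])
        then have "finitely_cut ?G ?Q (I \<inter> ?Q)" using noethR by (simp add: topologically_noetherian_def)
        then have "finitely_cut ?G ?A I"
        proof (rule finitely_cut_mono)
          show "I \<subseteq> radical_closure ?G ?A (I \<inter> ?Q)"
          proof
            fix f assume f: "f \<in> I"
            then have fA: "f \<in> ?A" using IA by blast
            show "f \<in> radical_closure ?G ?A (I \<inter> ?Q)"
              by (rule in_ideal_if_coefficients[OF radical_closure_gens fA, of R])
                (use True f rcoeff_in[OF fA] in auto)
          qed
        qed (use sub in auto)
        then show ?thesis ..
      next
        case False
        obtain f D where f: "f \<in> I" "\<And>m. m \<in> keys f \<Longrightarrow> rcoeff R (pm_restrict R m) f \<notin> I"
          "deg_lt R (Suc D) f" "\<exists>m\<in>keys f. total_deg (pm_restrict R m) = D" "D > 0"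
          "\<And>g \<alpha>. g \<in> I \<Longrightarrow> deg_lt R D g \<Longrightarrow> rcoeff R \<alpha> g \<in> I"
          using minimal_degree_element[OF I False] by blast
        have fA: "f \<in> ?A" using f(1) IA by blast
        define Vars where "Vars = (\<Union>m\<in>keys f. keys m)"
        have finV: "finite Vars" by (simp add: Vars_def)
        have VW: "Vars \<subseteq> ?W" using fA by (auto simp: Vars_def polys_in_def)
        have "finite (insert n (\<Union>M\<in>Vars. Suc ` keys (Rep_cubic_monom M)))" using finV by simp
        \<comment> \<open>\<open>n'\<close> exceeds every index that occurs in \<open>f\<close>\<close>
        then obtain n' where n': "\<forall>x\<in>insert n (\<Union>M\<in>Vars. Suc ` keys (Rep_cubic_monom M)). x \<le> n'"
          using Max_ge by blast
        then have nn': "n \<le> n'" and bound: "\<And>M. M \<in> Vars \<Longrightarrow> keys (Rep_cubic_monom M) \<subseteq> {..<n'}"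
          by (auto simp: Suc_le_eq)
        define E where "E = {lookup m v | m v. m \<in> keys f \<and> v \<in> R}"
        obtain x where x: "x \<in> E" "x > 0"
        proof -
          obtain m where m: "m \<in> keys f" "total_deg (pm_restrict R m) > 0" using f(4,5) by auto
          then have "pm_restrict R m \<noteq> 0" by auto
          then obtain v where "v \<in> keys (pm_restrict R m)" by (metis keys_eq_empty ex_in_conv)
          then have "v \<in> R" "lookup m v > 0" by (auto simp: in_keys_iff)
          then show ?thesis using m(1) by (intro that[of "lookup m v"]) (auto simp: E_def)
        qed
        obtain q where q: "frob_exponent CHAR('k) q" "\<forall>e\<in>E. q dvd e" "\<exists>e\<in>E. of_nat (e div q) \<noteq> (0 :: 'k)"
          using frob_exponent_exists[OF x, where ?'k = 'k] by blast
        obtain m0 v0 where v0: "m0 \<in> keys f" "v0 \<in> R" "of_nat (lookup m0 v0 div q) \<noteq> (0 :: 'k)"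
          using q(3) by (auto simp: E_def)
        have qdvd: "q dvd lookup m v" if "m \<in> keys f" "v \<in> R" for m v using q(2) that by (auto simp: E_def)
        interpret S: shear_setting n n' L l0 d q "TYPE('k)"
          by unfold_locales (use nn' L l0 d q in auto)
        have Reqs: "S.R = R" and Weqs: "S.W = ?W" by (simp_all add: R_def S.R_def S.W_def)
        have VU: "Vars \<subseteq> S.U" using VW bound by (auto simp: S.U_def S.W_def)
        have fU: "f \<in> polys_in S.U" using VU by (auto simp: polys_in_def Vars_def)
        define R0 where "R0 = Vars \<inter> R"
        have "lookup m0 v0 \<noteq> 0" using v0(3) by (metis div_0 of_nat_0)
        then have v0R0: "v0 \<in> R0" using v0 by (auto simp: R0_def Vars_def in_keys_iff)
        have R0: "finite R0" "R0 \<subseteq> R \<inter> S.U" "\<And>m. m \<in> keys f \<Longrightarrow> keys m \<inter> R \<subseteq> R0"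
          using finV VU by (auto simp: R0_def Vars_def)
        obtain a :: "nat \<Rightarrow> 'k" where a: "\<And>i. i < n \<or> i \<ge> n' \<Longrightarrow> a i = 0"
          and notin: "(\<Sum>v\<in>R0. const (weight a (pm_restrict {n..} (Rep_cubic_monom v)) ^ q) * frob_deriv q v f) \<notin> I"
          using S.ex_derivative_not_in_ideal[unfolded Reqs Weqs, OF inf I f(1) fU f(2,3,6) qdvd v0 R0(1,2) v0R0] by blast
        define L' where "L' = (\<lambda>M. front n' (Rep_cubic_monom M)) ` ?W - {l0}"
        have W': "S.W' = vars_with_front n' L'"
        proof
          show "S.W' \<subseteq> vars_with_front n' L'"
            by (auto simp: vars_with_front_def[of n'] L'_def S.W'_def S.W_def)
          show "vars_with_front n' L' \<subseteq> S.W'"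
          proof
            fix M assume "M \<in> vars_with_front n' L'"
            then obtain M' where M': "M' \<in> ?W" "front n' (Rep_cubic_monom M) = front n' (Rep_cubic_monom M')"
              "front n' (Rep_cubic_monom M) \<noteq> l0"
              by (auto simp: vars_with_front_def[of n'] L'_def)
            then have "front n (Rep_cubic_monom M) = front n (Rep_cubic_monom M')" using front_front[OF nn'] by metis
            then show "M \<in> S.W'" using M' by (simp add: S.W'_def S.W_def vars_with_front_def)
          qed
        qed
        have keysL': "keys l \<subseteq> {..<n'} \<and> total_deg l \<le> 3" if "l \<in> L'" for l
        proof -
          obtain M where "l = front n' (Rep_cubic_monom M)" using \<open>l \<in> L'\<close> by (auto simp: L'_def)
          then show ?thesis using total_deg_front_add[of n' "Rep_cubic_monom M"] by auto
        qed
        have finL': "finite L'"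
          by (rule finite_subset[OF _ finite_bounded_total_deg[of "{..<n'}" 3]]) (use keysL' in auto)
        have "(functor_type L', functor_type L) \<in> mult less_than"
        proof (rule functor_type_less[OF fin l0 finL'])
          fix l assume l: "l \<in> L'"
          then obtain M where M: "M \<in> ?W" "l = front n' (Rep_cubic_monom M)" "l \<noteq> l0" by (auto simp: L'_def)
          have fl: "front n l = front n (Rep_cubic_monom M)" using M(2) front_front[OF nn'] by simp
          then have "front n l \<in> L" using M(1) by (simp add: vars_with_front_def)
          show "l \<in> L - {l0} \<or> 3 - total_deg l < 3 - total_deg l0"
          proof (cases "pm_restrict {n..} l = 0")
            case True
            then have "l = front n l" using front_add_tail[of n l] by simp
            then show ?thesis using \<open>front n l \<in> L\<close> M(3) by simp
          next
            case False
            then have "total_deg (pm_restrict {n..} l) > 0" by (simp add: total_deg_eq_0[symmetric] del: total_deg_eq_0)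
            then have "total_deg l > total_deg l0" using total_deg_front_add[of n l] min[OF \<open>front n l \<in> L\<close>] by linarith
            then show ?thesis using d by linarith
          qed
        qed
        then have noeth': "topologically_noetherian (act ` GL_block n') (polys_in S.W' :: 'k equation set)"
          unfolding W' using finL' keysL' by (intro IH) auto
        define h where
          "h = (\<Sum>v\<in>R0. const (weight a (pm_restrict {n..} (Rep_cubic_monom v)) ^ q) * frob_deriv q v f)"
        have "h \<in> ?A \<and> (\<exists>F. finite F \<and> F \<subseteq> I \<and> (\<forall>b\<in>I. b * h \<in> radical_closure ?G ?A F))"
        proof (rule S.localization_step[unfolded Reqs Weqs, OF inf char I W' noeth' f(1) fU _ R0(1,2) _ _ h_def])
          show "q dvd lookup m v" if "m \<in> keys f" "v \<in> R" for m v using that by (rule qdvd)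
          show "keys m \<inter> R \<subseteq> R0" if "m \<in> keys f" for m using that by (rule R0(3))
          show "a i = 0" if "i < n \<or> n' \<le> i" for i using that by (rule a)
        qed
        moreover have "h \<notin> I" using notin by (simp add: h_def)
        ultimately show ?thesis by (intro disjI2 bexI[of _ h]) simp_all
      qed
    qed
  qed
qed

section \<open>Cubic forms\<close>

lemma
  assumes "primeideal \<pp> (ring_of_type_algebra :: 'a::comm_ring_1 ring)"
  shows primeideal_zero: "0 \<in> \<pp>" and primeideal_add: "x \<in> \<pp> \<Longrightarrow> y \<in> \<pp> \<Longrightarrow> x + y \<in> \<pp>"
    and primeideal_mult: "y \<in> \<pp> \<Longrightarrow> x * y \<in> \<pp>" and primeideal_root: "x ^ k \<in> \<pp> \<Longrightarrow> x \<in> \<pp>"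
proof -
  interpret primeideal \<pp> "ring_of_type_algebra :: 'a ring" by fact
  show "0 \<in> \<pp>" using additive_subgroup.zero_closed[OF is_additive_subgroup] by (simp add: ring_of_type_algebra_def)
  show "x + y \<in> \<pp>" if "x \<in> \<pp>" "y \<in> \<pp>" using additive_subgroup.a_closed[OF is_additive_subgroup that]
    by (simp add: ring_of_type_algebra_def)
  show mult: "x * y \<in> \<pp>" if "y \<in> \<pp>" for x y using I_l_closed[OF that, of x] by (simp add: ring_of_type_algebra_def)
  have prime: "x \<in> \<pp> \<or> y \<in> \<pp>" if "x * y \<in> \<pp>" for x y
    using I_prime[of x y] that by (simp add: ring_of_type_algebra_def)
  show "x ^ k \<in> \<pp> \<Longrightarrow> x \<in> \<pp>"
  proof (induction k)
    case 0
    then show ?case using mult[of 1 x] by simp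
  next
    case (Suc k)
    then show ?case using prime[of x "x ^ k"] by auto
  qed
qed

text \<open>The ideal \<open>I\<close> of a stable closed set is finitely cut out by some \<open>F\<close>. If a prime contains the orbits of
  \<open>F\<close>, then the equations all of whose translates lie in the prime form a stable radical ideal containing
  \<open>F\<close>, hence containing \<open>I\<close>, and the prime is a point of the closed set.\<close>

theorem theorem1p2:
  fixes Z :: "'k::alg_closed_field equation set set"
  assumes "CHAR('k) \<noteq> 2" and "CHAR('k) \<noteq> 3"
    and "Zariski_closed Z" and "GL_stable Z"
  shows "\<exists>F :: 'k equation set. finite F \<and> Z = zero_locus (\<Union>f\<in>F. GL_orbit f)"
proof -
  let ?G = "act ` GL_block 0 :: ('k equation \<Rightarrow> 'k equation) set"
  have A: "polys_in (vars_with_front 0 {0}) = (UNIV :: 'k equation set)"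
    by (auto simp: polys_in_def vars_with_front_def pm_restrict_eq_0)
  have noeth: "topologically_noetherian ?G (UNIV :: 'k equation set)"
    unfolding A[symmetric]
    by (rule topologically_noetherian_vars_with_front[OF infinite_UNIV_alg_closed_field assms(1,2)]) auto
  obtain S where S: "Z = zero_locus S" using assms(3) by (auto simp: Zariski_closed_def)
  define I where "I = Inter Z"
  have prime: "primeideal \<pp> (ring_of_type_algebra :: 'k equation ring)" if "\<pp> \<in> Z" for \<pp>
    using that S by (auto simp: zero_locus_def P3_def)
  have "stable_radical_ideal ?G UNIV I"
  proof (rule stable_radical_idealI)
    fix g x assume "g \<in> ?G" "x \<in> I"
    then obtain g0 where g0: "g0 \<in> GL_block 0" "g = act g0" by auto
    obtain g' where g': "g' \<in> GL_block 0" "g0 \<circ> g' = id" "g' \<circ> g0 = id" using GL_block_inverse[OF g0(1)] by blast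
    have lin: "vlinear g0" "vlinear g'" using g0 g' by (auto simp: GL_block_def)
    show "g x \<in> I" unfolding I_def
    proof
      fix \<pp> assume \<pp>: "\<pp> \<in> Z"
      have "act g' ` \<pp> \<in> Z" using assms(4) g'(1) \<pp> GL_block_subset_GL_infty unfolding GL_stable_def by blast
      then have "x \<in> act g' ` \<pp>" using \<open>x \<in> I\<close> by (auto simp: I_def)
      then obtain y where "y \<in> \<pp>" "x = act g' y" by auto
      then show "g x \<in> \<pp>" using g0(2) act_comp[OF lin(1), of g' y] g'(2) by (simp add: act_id)
    qed
  next
    show "x \<in> I" if "x ^ k \<in> I" for x k
      using that primeideal_root[OF prime] unfolding I_def by blast
  qed (auto simp: I_def primeideal_zero[OF prime] primeideal_add[OF prime] primeideal_mult[OF prime])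
  then obtain F where F: "finite F" "F \<subseteq> I" "I \<subseteq> radical_closure ?G UNIV F"
    using noeth unfolding topologically_noetherian_def finitely_cut_def by meson
  have "Z = zero_locus (\<Union>f\<in>F. GL_orbit f)"
  proof
    show "Z \<subseteq> zero_locus (\<Union>f\<in>F. GL_orbit f)"
    proof
      fix \<pp> assume \<pp>: "\<pp> \<in> Z"
      have "act g f \<in> \<pp>" if "f \<in> F" "g \<in> GL_infty" for f g
      proof -
        have "vlinear g" "bij g" using that(2) by (auto simp: GL_infty_def)
        define g' where "g' = inv_into UNIV g"
        have gg': "g (g' v) = v" "g' (g v) = v" for v
          using \<open>bij g\<close> by (auto simp: g'_def bij_def surj_f_inv_f)
        have "vlinear g'"
        proof (rule vlinearI)
          show "g' (v + w) = g' v + g' w" for v w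
            using gg'(2)[of "g' v + g' w"] by (simp add: vlinear_add[OF \<open>vlinear g\<close>] gg'(1))
          show "g' (smult_vec c v) = smult_vec c (g' v)" for c v
            using gg'(2)[of "smult_vec c (g' v)"] by (simp add: vlinear_smult[OF \<open>vlinear g\<close>] gg'(1))
        qed
        moreover have "bij g'" using \<open>bij g\<close> by (simp add: g'_def bij_imp_bij_inv)
        ultimately have "g' \<in> GL_infty" by (simp add: GL_infty_def)
        then have "act g' ` \<pp> \<in> Z" using assms(4) \<pp> unfolding GL_stable_def by blast
        then have "f \<in> act g' ` \<pp>" using that(1) F(2) by (auto simp: I_def)
        then obtain y where y: "y \<in> \<pp>" "f = act g' y" by auto
        have "g \<circ> g' = id" using gg' by auto
        then show ?thesis using y act_comp[OF \<open>vlinear g\<close>, of g' y] by (simp add: act_id)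
      qed
      moreover have "\<pp> \<in> P3" using \<pp> S by (simp add: zero_locus_def)
      ultimately show "\<pp> \<in> zero_locus (\<Union>f\<in>F. GL_orbit f)"
        by (auto simp: zero_locus_def GL_orbit_def)
    qed
  next
    show "zero_locus (\<Union>f\<in>F. GL_orbit f) \<subseteq> Z"
    proof
      fix \<pp> assume "\<pp> \<in> zero_locus (\<Union>f\<in>F. GL_orbit f)"
      then have \<pp>: "primeideal \<pp> (ring_of_type_algebra :: 'k equation ring)" "\<pp> \<in> P3"
        and orbits: "\<And>f g. f \<in> F \<Longrightarrow> g \<in> GL_infty \<Longrightarrow> act g f \<in> \<pp>"
        by (auto simp: zero_locus_def P3_def GL_orbit_def)
      have translates: "\<forall>g\<in>GL_block 0. act g x \<in> \<pp>" if "x \<in> radical_closure ?G UNIV F" for x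
        using that
      proof induction
        case (gen x)
        then show ?case using orbits GL_block_subset_GL_infty by blast
      next
        case zero
        then show ?case by (simp add: act_zero primeideal_zero[OF \<pp>(1)])
      next
        case (add x y)
        then show ?case by (simp add: act_add primeideal_add[OF \<pp>(1)])
      next
        case (mult c x)
        then show ?case by (simp add: act_mult primeideal_mult[OF \<pp>(1)])
      next
        case (act g x)
        then obtain g0 where g0: "g0 \<in> GL_block 0" "g = act g0" by auto
        show ?case
        proof
          fix g1 :: "(nat \<Rightarrow>\<^sub>0 'k) \<Rightarrow> _" assume g1: "g1 \<in> GL_block 0"
          then have "act g1 (g x) = act (g1 \<circ> g0) x" using g0(2) by (simp add: act_comp GL_block_def)
          then show "act g1 (g x) \<in> \<pp>" using act.IH GL_block_0_comp[OF g1 g0(1)] by simp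
        qed
      next
        case (root x k)
        then show ?case using primeideal_root[OF \<pp>(1)] by (auto simp: act_power)
      qed
      have "id \<in> GL_block 0"
        by (auto simp: GL_block_def block_def intro!: vlinearI exI[of _ id])
      then have "act id x \<in> \<pp>" if "x \<in> I" for x using translates F(3) that by blast
      then have "I \<subseteq> \<pp>" by (simp add: act_id subset_iff)
      moreover have "S \<subseteq> I" using S by (auto simp: I_def zero_locus_def)
      ultimately show "\<pp> \<in> Z" using \<pp>(2) S by (auto simp: zero_locus_def)
    qed
  qed
  with F(1) show ?thesis by blast
qed

end
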